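(* Let $(\Lambda,d)$ be a finitely aligned $k$-graph, and let $\mathcal{E} \subset \mathrm{FE}(\Lambda)$ be satiated. Let $\{t_\lambda : \lambda \in \Lambda\}$ be a relative Cuntz-Krieger $(\Lambda;\mathcal{E})$-family in a $C^*$-algebra $B$, and suppose that (1) $t_v \neq 0$ for all $v \in \Lambda^0$; (2) $\prod_{\lambda \in F}(t_{r(F)} - t_\lambda t^*_\lambda) \neq 0$ for all $F \in \mathrm{FE}(\Lambda) \setminus \mathcal{E}$; and (3) there exists an action (group homomorphism) $\theta : \mathbb{T}^k \to \mathrm{Aut}(B)$ such that $\theta_z(t_\lambda) = z^{d(\lambda)} t_\lambda$ for all $z \in \mathbb{T}^k$ and $\lambda \in \Lambda$. Then the homomorphism $\pi^{\mathcal{E}}_t : C^*(\Lambda;\mathcal{E}) \to B$ is injective.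
   Context: $k$-graphs. $\mathbb{N}$ contains $0$; $\mathbb{N}^k$ is ordered coordinatewise, $m\vee n$ is the coordinatewise maximum, and $0<n$ means $n \ge 0$, $n\neq 0$. For $k\in\mathbb{N}\setminus\{0\}$, a $k$-graph is a pair $(\Lambda,d)$ where $\Lambda$ is a countable category and $d:\Lambda\to\mathbb{N}^k$ is a functor satisfying the factorisation property: for every morphism $\lambda$ and all $m,n\in\mathbb{N}^k$ with $d(\lambda)=m+n$ there are unique morphisms $\mu,\nu$ with $d(\mu)=m$, $d(\nu)=n$, $\lambda=\mu\nu$. Write $\lambda\in\Lambda$ for morphisms ("paths"), $r,s$ for codomain and domain (so $\lambda\mu$ is defined when $s(\lambda)=r(\mu)$); objects ("vertices") are identified with the elements of $\Lambda^0=\{\lambda: d(\lambda)=0\}$. For $v\in\Lambda^0$, $v\Lambda=\{\lambda: r(\lambda)=v\}$. For $E\subset\Lambda$, $\lambda E=\{\lambda\mu:\mu\in E, r(\mu)=s(\lambda)\}$ and $E\Lambda=\{\lambda\mu:\lambda\in E,\ \mu \in s(\lambda)\Lambda\}$. For $l\le m\le d(\lambda)$, $\lambda(l,m)$ is the unique path of degree $m-l$ with $\lambda=\lambda(0,l)\lambda(l,m)\lambda(m,d(\lambda))$. Finite exhaustive sets. For $\mu,\nu\in\Lambda$, $\mathrm{MCE}(\mu,\nu)$ is the set of $\lambda$ with $d(\lambda)=d(\mu)\vee d(\nu)$, $\lambda(0,d(\mu))=\mu$, $\lambda(0,d(\nu))=\nu$; $\Lambda^{\min}(\mu,\nu)=\{(\alpha,\beta)\in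 \Lambda\times\Lambda:\mu\alpha=\nu\beta\in\mathrm{MCE}(\mu,\nu)\}$. $\Lambda$ is finitely aligned if every $\mathrm{MCE}(\mu,\nu)$ is finite (possibly empty). For $E\subset\Lambda$, $\mathrm{Ext}(\mu;E)=\{\alpha\in s(\mu)\Lambda:(\alpha,\beta)\in\Lambda^{\min}(\mu,\nu)\text{ for some }\nu\in E \text{ and some } \beta\}$. A set $E\subset v\Lambda$ is exhaustive if $\mathrm{Ext}(\lambda;E)\neq\emptyset$ for all $\lambda\in v\Lambda$. $\mathrm{FE}(\Lambda)=\bigcup_{v\in\Lambda^0}\{E\subset v\Lambda\setminus\{v\}: E\text{ finite and exhaustive}\}$; for $E\in\mathrm{FE}(\Lambda)$, $r(E)$ is the vertex $v$ with $E\subset v\Lambda$. Relative Cuntz-Krieger algebras. For $\mathcal{E}\subset\mathrm{FE}(\Lambda)$, a relative Cuntz-Krieger $(\Lambda;\mathcal{E})$-family is a collection $\{t_\lambda:\lambda\in\Lambda\}$ of partial isometries in a $C^*$-algebra such that: (TCK1) $\{t_v:v\in\Lambda^0\}$ are mutually orthogonal projections; (TCK2) $t_\lambda t_\mu=t_{\lambda\mu}$ whenever $s(\lambda)=r(\mu)$; (TCK3) $t_\lambda^*t_\mu=\sum_{(\alpha,\beta)\in\Lambda^{\min}(\lambda,\mu)}t_\alpha t_\beta^*$ for all $\lambda,\mu$ (empty sum $=0$); (CK) $\prod_{\lambda\in E}(t_{r(E)}-t_\lambda t_\lambda^* )=0$ for all $E\in\mathcal{E}$. (By (TCK3) the projections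 $t_\lambda t_\lambda^*$ commute, so products are well defined.) $C^*(\Lambda;\mathcal{E})$ is the universal $C^*$-algebra generated by a relative Cuntz-Krieger $(\Lambda;\mathcal{E})$-family $\{s_{\mathcal{E}}(\lambda)\}$; given a relative Cuntz-Krieger $(\Lambda;\mathcal{E})$-family $\{t_\lambda\}$ in $B$, $\pi^{\mathcal{E}}_t:C^*(\Lambda;\mathcal{E})\to B$ is the unique homomorphism with $\pi^{\mathcal{E}}_t(s_{\mathcal{E}}(\lambda))=t_\lambda$. For $z\in\mathbb{T}^k$, $n\in\mathbb{N}^k$, $z^n=\prod_i z_i^{n_i}$. Satiated. $\mathcal{E}\subset\mathrm{FE}(\Lambda)$ is satiated if: (S1) $G\in\mathcal{E}$, $E\in\mathrm{FE}(\Lambda)$, $G\subset E$ imply $E\in\mathcal{E}$; (S2) if $G\in\mathcal{E}$ with $r(G)=v$ and $\mu\in v\Lambda\setminus G\Lambda$, then $\mathrm{Ext}(\mu;G)\in\mathcal{E}$; (S3) if $G\in\mathcal{E}$ and $0<n_\lambda\le d(\lambda)$ for each $\lambda\in G$, then $\{\lambda(0,n_\lambda):\lambda\in G\}\in\mathcal{E}$; (S4) if $G\in\mathcal{E}$, $G'\subset G$ and $G'_\lambda\in\mathcal{E}$ with $r(G'_\lambda)=s(\lambda)$ for each $\lambda\in G'$, then $(G\setminus G')\cup\bigcup_{\lambda\in G'}\lambda G'_\lambda\in\mathcal{E}$. *)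

theory Defs
  imports "HOL-Analysis.Analysis" "HOL-Algebra.Module" "HOL-Library.FuncSet"
begin

section \<open>Higher-rank graphs\<close>

text \<open>
  A small category is given by its morphisms alone: \<open>rng\<close> and \<open>src\<close> send a morphism to the identity
  morphisms of its codomain and domain, and \<open>cmp \<Lambda> \<mu> \<nu>\<close> is meaningful if \<open>src \<Lambda> \<mu> = rng \<Lambda> \<nu>\<close>.
  The rank $k \geq 1$ is the cardinality of the finite index type \<open>'k\<close>.
\<close>

record ('p, 'k) kgraph =
  paths :: "'p set"
  rng :: "'p \<Rightarrow> 'p"
  src :: "'p \<Rightarrow> 'p"
  cmp :: "'p \<Rightarrow> 'p \<Rightarrow> 'p"
  dg :: "'p \<Rightarrow> nat ^ 'k"

definition is_category :: "('p, 'k::finite) kgraph \<Rightarrow> bool" where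
  "is_category \<Lambda> \<longleftrightarrow>
     (\<forall>\<kappa>\<in>paths \<Lambda>.
        rng \<Lambda> \<kappa> \<in> paths \<Lambda> \<and> src \<Lambda> \<kappa> \<in> paths \<Lambda> \<and>
        rng \<Lambda> (rng \<Lambda> \<kappa>) = rng \<Lambda> \<kappa> \<and> src \<Lambda> (rng \<Lambda> \<kappa>) = rng \<Lambda> \<kappa> \<and>
        rng \<Lambda> (src \<Lambda> \<kappa>) = src \<Lambda> \<kappa> \<and> src \<Lambda> (src \<Lambda> \<kappa>) = src \<Lambda> \<kappa> \<and>
        cmp \<Lambda> (rng \<Lambda> \<kappa>) \<kappa> = \<kappa> \<and> cmp \<Lambda> \<kappa> (src \<Lambda> \<kappa>) = \<kappa>) \<and>
     (\<forall>\<kappa>\<in>paths \<Lambda>. \<forall>\<mu>\<in>paths \<Lambda>. src \<Lambda> \<kappa> = rng \<Lambda> \<mu> \<longrightarrow>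
        cmp \<Lambda> \<kappa> \<mu> \<in> paths \<Lambda> \<and>
        rng \<Lambda> (cmp \<Lambda> \<kappa> \<mu>) = rng \<Lambda> \<kappa> \<and> src \<Lambda> (cmp \<Lambda> \<kappa> \<mu>) = src \<Lambda> \<mu>) \<and>
     (\<forall>\<kappa>\<in>paths \<Lambda>. \<forall>\<mu>\<in>paths \<Lambda>. \<forall>\<nu>\<in>paths \<Lambda>.
        src \<Lambda> \<kappa> = rng \<Lambda> \<mu> \<and> src \<Lambda> \<mu> = rng \<Lambda> \<nu> \<longrightarrow>
        cmp \<Lambda> (cmp \<Lambda> \<kappa> \<mu>) \<nu> = cmp \<Lambda> \<kappa> (cmp \<Lambda> \<mu> \<nu>))"

definition k_graph :: "('p, 'k::finite) kgraph \<Rightarrow> bool" where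
  "k_graph \<Lambda> \<longleftrightarrow>
     is_category \<Lambda> \<and> countable (paths \<Lambda>) \<and>
     (\<forall>\<kappa>\<in>paths \<Lambda>. dg \<Lambda> (rng \<Lambda> \<kappa>) = 0 \<and> dg \<Lambda> (src \<Lambda> \<kappa>) = 0) \<and>
     (\<forall>\<kappa>\<in>paths \<Lambda>. \<forall>\<mu>\<in>paths \<Lambda>. src \<Lambda> \<kappa> = rng \<Lambda> \<mu> \<longrightarrow>
        dg \<Lambda> (cmp \<Lambda> \<kappa> \<mu>) = dg \<Lambda> \<kappa> + dg \<Lambda> \<mu>) \<and>
     (\<forall>\<kappa>\<in>paths \<Lambda>. \<forall>m n. dg \<Lambda> \<kappa> = m + n \<longrightarrow>
        (\<exists>!(\<mu>, \<nu>). \<mu> \<in> paths \<Lambda> \<and> \<nu> \<in> paths \<Lambda> \<and> dg \<Lambda> \<mu> = m \<and> dg \<Lambda> \<nu> = n \<and>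
           src \<Lambda> \<mu> = rng \<Lambda> \<nu> \<and> \<kappa> = cmp \<Lambda> \<mu> \<nu>))"

definition vertices :: "('p, 'k::finite) kgraph \<Rightarrow> 'p set" where
  "vertices \<Lambda> = {\<kappa> \<in> paths \<Lambda>. dg \<Lambda> \<kappa> = 0}"

definition paths_to :: "('p, 'k::finite) kgraph \<Rightarrow> 'p \<Rightarrow> 'p set" where
  "paths_to \<Lambda> v = {\<kappa> \<in> paths \<Lambda>. rng \<Lambda> \<kappa> = v}"

definition left_mult :: "('p, 'k::finite) kgraph \<Rightarrow> 'p \<Rightarrow> 'p set \<Rightarrow> 'p set" where
  "left_mult \<Lambda> \<kappa> E = {cmp \<Lambda> \<kappa> \<mu> |\<mu>. \<mu> \<in> E \<and> rng \<Lambda> \<mu> = src \<Lambda> \<kappa>}"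

definition extensions :: "('p, 'k::finite) kgraph \<Rightarrow> 'p set \<Rightarrow> 'p set" where
  "extensions \<Lambda> E = {cmp \<Lambda> \<kappa> \<mu> |\<kappa> \<mu>. \<kappa> \<in> E \<and> \<mu> \<in> paths_to \<Lambda> (src \<Lambda> \<kappa>)}"

text \<open>The path $\lambda(l,m)$, for $l \leq m \leq d(\lambda)$.\<close>

definition segment :: "('p, 'k::finite) kgraph \<Rightarrow> 'p \<Rightarrow> nat ^ 'k \<Rightarrow> nat ^ 'k \<Rightarrow> 'p" where
  "segment \<Lambda> \<kappa> l m = (THE \<nu>. \<nu> \<in> paths \<Lambda> \<and> dg \<Lambda> \<nu> = m - l \<and>
     (\<exists>\<mu>\<in>paths \<Lambda>. \<exists>\<rho>\<in>paths \<Lambda>. dg \<Lambda> \<mu> = l \<and> dg \<Lambda> \<rho> = dg \<Lambda> \<kappa> - m \<and>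
        src \<Lambda> \<mu> = rng \<Lambda> \<nu> \<and> src \<Lambda> \<nu> = rng \<Lambda> \<rho> \<and> \<kappa> = cmp \<Lambda> \<mu> (cmp \<Lambda> \<nu> \<rho>)))"

definition deg_join :: "nat ^ 'k \<Rightarrow> nat ^ 'k \<Rightarrow> nat ^ ('k::finite)" where
  "deg_join m n = (\<chi> i. max (m $ i) (n $ i))"

definition MCE :: "('p, 'k::finite) kgraph \<Rightarrow> 'p \<Rightarrow> 'p \<Rightarrow> 'p set" where
  "MCE \<Lambda> \<mu> \<nu> = {\<kappa> \<in> paths \<Lambda>. dg \<Lambda> \<kappa> = deg_join (dg \<Lambda> \<mu>) (dg \<Lambda> \<nu>) \<and>
     segment \<Lambda> \<kappa> 0 (dg \<Lambda> \<mu>) = \<mu> \<and> segment \<Lambda> \<kappa> 0 (dg \<Lambda> \<nu>) = \<nu>}"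

definition lambda_min :: "('p, 'k::finite) kgraph \<Rightarrow> 'p \<Rightarrow> 'p \<Rightarrow> ('p \<times> 'p) set" where
  "lambda_min \<Lambda> \<mu> \<nu> = {(\<alpha>, \<beta>). \<alpha> \<in> paths \<Lambda> \<and> \<beta> \<in> paths \<Lambda> \<and>
     src \<Lambda> \<mu> = rng \<Lambda> \<alpha> \<and> src \<Lambda> \<nu> = rng \<Lambda> \<beta> \<and>
     cmp \<Lambda> \<mu> \<alpha> = cmp \<Lambda> \<nu> \<beta> \<and> cmp \<Lambda> \<mu> \<alpha> \<in> MCE \<Lambda> \<mu> \<nu>}"

definition finitely_aligned :: "('p, 'k::finite) kgraph \<Rightarrow> bool" where
  "finitely_aligned \<Lambda> \<longleftrightarrow> (\<forall>\<mu>\<in>paths \<Lambda>. \<forall>\<nu>\<in>paths \<Lambda>. finite (MCE \<Lambda> \<mu> \<nu>))"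

definition Ext :: "('p, 'k::finite) kgraph \<Rightarrow> 'p \<Rightarrow> 'p set \<Rightarrow> 'p set" where
  "Ext \<Lambda> \<mu> E = {\<alpha> \<in> paths_to \<Lambda> (src \<Lambda> \<mu>). \<exists>\<nu>\<in>E. \<exists>\<beta>. (\<alpha>, \<beta>) \<in> lambda_min \<Lambda> \<mu> \<nu>}"

definition exhaustive :: "('p, 'k::finite) kgraph \<Rightarrow> 'p \<Rightarrow> 'p set \<Rightarrow> bool" where
  "exhaustive \<Lambda> v E \<longleftrightarrow> E \<subseteq> paths_to \<Lambda> v \<and> (\<forall>\<kappa>\<in>paths_to \<Lambda> v. Ext \<Lambda> \<kappa> E \<noteq> {})"

definition FE :: "('p, 'k::finite) kgraph \<Rightarrow> 'p set set" where
  "FE \<Lambda> = (\<Union>v\<in>vertices \<Lambda>. {E. E \<subseteq> paths_to \<Lambda> v - {v} \<and> finite E \<and> exhaustive \<Lambda> v E})"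

text \<open>Members of \<open>FE \<Lambda>\<close> are nonempty, because the vertex itself has an extension; so \<open>set_rng\<close> is
  well defined on them.\<close>

definition set_rng :: "('p, 'k::finite) kgraph \<Rightarrow> 'p set \<Rightarrow> 'p" where
  "set_rng \<Lambda> E = (THE v. v \<in> vertices \<Lambda> \<and> E \<subseteq> paths_to \<Lambda> v)"

definition satiated :: "('p, 'k::finite) kgraph \<Rightarrow> 'p set set \<Rightarrow> bool" where
  "satiated \<Lambda> \<E> \<longleftrightarrow>
     (\<forall>G\<in>\<E>. \<forall>E\<in>FE \<Lambda>. G \<subseteq> E \<longrightarrow> E \<in> \<E>) \<and>
     (\<forall>G\<in>\<E>. \<forall>\<mu>\<in>paths_to \<Lambda> (set_rng \<Lambda> G) - extensions \<Lambda> G. Ext \<Lambda> \<mu> G \<in> \<E>) \<and>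
     (\<forall>G\<in>\<E>. \<forall>n. (\<forall>\<kappa>\<in>G. 0 < n \<kappa> \<and> n \<kappa> \<le> dg \<Lambda> \<kappa>) \<longrightarrow>
        (\<lambda>\<kappa>. segment \<Lambda> \<kappa> 0 (n \<kappa>)) ` G \<in> \<E>) \<and>
     (\<forall>G\<in>\<E>. \<forall>G'\<subseteq>G. \<forall>H. (\<forall>\<kappa>\<in>G'. H \<kappa> \<in> \<E> \<and> set_rng \<Lambda> (H \<kappa>) = src \<Lambda> \<kappa>) \<longrightarrow>
        (G - G') \<union> (\<Union>\<kappa>\<in>G'. left_mult \<Lambda> \<kappa> (H \<kappa>)) \<in> \<E>)"

section \<open>C*-algebras\<close>

text \<open>
  C*-algebras are not assumed to be unital: the field \<open>one\<close>, which \<open>module\<close> inherits from \<open>ring\<close>,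
  is never referred to, just as in the locale \<open>module\<close>.
\<close>

record 'a cstar = "(complex, 'a) module" +
  adj :: "'a \<Rightarrow> 'a"
  nrm :: "'a \<Rightarrow> real"

definition complex_ring :: "complex ring" where
  "complex_ring = \<lparr>carrier = UNIV, mult = (*), one = 1, zero = 0, add = (+)\<rparr>"

definition cstar_algebra :: "'a cstar \<Rightarrow> bool" where
  "cstar_algebra A \<longleftrightarrow>
     Module.module complex_ring A \<and>
     (\<forall>x\<in>carrier A. \<forall>y\<in>carrier A. x \<otimes>\<^bsub>A\<^esub> y \<in> carrier A) \<and>
     (\<forall>x\<in>carrier A. \<forall>y\<in>carrier A. \<forall>z\<in>carrier A.
        (x \<otimes>\<^bsub>A\<^esub> y) \<otimes>\<^bsub>A\<^esub> z = x \<otimes>\<^bsub>A\<^esub> (y \<otimes>\<^bsub>A\<^esub> z) \<and>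
        (x \<oplus>\<^bsub>A\<^esub> y) \<otimes>\<^bsub>A\<^esub> z = (x \<otimes>\<^bsub>A\<^esub> z) \<oplus>\<^bsub>A\<^esub> (y \<otimes>\<^bsub>A\<^esub> z) \<and>
        z \<otimes>\<^bsub>A\<^esub> (x \<oplus>\<^bsub>A\<^esub> y) = (z \<otimes>\<^bsub>A\<^esub> x) \<oplus>\<^bsub>A\<^esub> (z \<otimes>\<^bsub>A\<^esub> y)) \<and>
     (\<forall>c. \<forall>x\<in>carrier A. \<forall>y\<in>carrier A.
        (c \<odot>\<^bsub>A\<^esub> x) \<otimes>\<^bsub>A\<^esub> y = c \<odot>\<^bsub>A\<^esub> (x \<otimes>\<^bsub>A\<^esub> y) \<and>
        x \<otimes>\<^bsub>A\<^esub> (c \<odot>\<^bsub>A\<^esub> y) = c \<odot>\<^bsub>A\<^esub> (x \<otimes>\<^bsub>A\<^esub> y)) \<and>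
     (\<forall>x\<in>carrier A. adj A x \<in> carrier A \<and> adj A (adj A x) = x) \<and>
     (\<forall>x\<in>carrier A. \<forall>y\<in>carrier A.
        adj A (x \<oplus>\<^bsub>A\<^esub> y) = adj A x \<oplus>\<^bsub>A\<^esub> adj A y \<and>
        adj A (x \<otimes>\<^bsub>A\<^esub> y) = adj A y \<otimes>\<^bsub>A\<^esub> adj A x) \<and>
     (\<forall>c. \<forall>x\<in>carrier A. adj A (c \<odot>\<^bsub>A\<^esub> x) = cnj c \<odot>\<^bsub>A\<^esub> adj A x) \<and>
     (\<forall>x\<in>carrier A. 0 \<le> nrm A x \<and> (nrm A x = 0 \<longleftrightarrow> x = \<zero>\<^bsub>A\<^esub>)) \<and>
     (\<forall>c. \<forall>x\<in>carrier A. nrm A (c \<odot>\<^bsub>A\<^esub> x) = cmod c * nrm A x) \<and>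
     (\<forall>x\<in>carrier A. \<forall>y\<in>carrier A.
        nrm A (x \<oplus>\<^bsub>A\<^esub> y) \<le> nrm A x + nrm A y \<and>
        nrm A (x \<otimes>\<^bsub>A\<^esub> y) \<le> nrm A x * nrm A y) \<and>
     (\<forall>x\<in>carrier A. nrm A (adj A x \<otimes>\<^bsub>A\<^esub> x) = (nrm A x)\<^sup>2) \<and>
     (\<forall>X :: nat \<Rightarrow> 'a. (\<forall>n. X n \<in> carrier A) \<and>
        (\<forall>e>0. \<exists>N. \<forall>m\<ge>N. \<forall>n\<ge>N. nrm A (X m \<ominus>\<^bsub>A\<^esub> X n) < e) \<longrightarrow>
        (\<exists>l\<in>carrier A. (\<lambda>n. nrm A (X n \<ominus>\<^bsub>A\<^esub> l)) \<longlonglongrightarrow> 0))"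

definition cstar_subalgebra :: "'a cstar \<Rightarrow> 'a set \<Rightarrow> bool" where
  "cstar_subalgebra A S \<longleftrightarrow>
     S \<subseteq> carrier A \<and> \<zero>\<^bsub>A\<^esub> \<in> S \<and>
     (\<forall>x\<in>S. \<forall>y\<in>S. x \<oplus>\<^bsub>A\<^esub> y \<in> S \<and> x \<otimes>\<^bsub>A\<^esub> y \<in> S) \<and>
     (\<forall>c. \<forall>x\<in>S. c \<odot>\<^bsub>A\<^esub> x \<in> S) \<and>
     (\<forall>x\<in>S. adj A x \<in> S) \<and>
     (\<forall>X :: nat \<Rightarrow> 'a. \<forall>l\<in>carrier A. (\<forall>n. X n \<in> S) \<and>
        (\<lambda>n. nrm A (X n \<ominus>\<^bsub>A\<^esub> l)) \<longlonglongrightarrow> 0 \<longrightarrow> l \<in> S)"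

definition star_hom :: "'a cstar \<Rightarrow> 'b cstar \<Rightarrow> ('a \<Rightarrow> 'b) set" where
  "star_hom A B = {\<phi> \<in> carrier A \<rightarrow> carrier B.
     (\<forall>x\<in>carrier A. \<forall>y\<in>carrier A.
        \<phi> (x \<oplus>\<^bsub>A\<^esub> y) = \<phi> x \<oplus>\<^bsub>B\<^esub> \<phi> y \<and> \<phi> (x \<otimes>\<^bsub>A\<^esub> y) = \<phi> x \<otimes>\<^bsub>B\<^esub> \<phi> y) \<and>
     (\<forall>c. \<forall>x\<in>carrier A. \<phi> (c \<odot>\<^bsub>A\<^esub> x) = c \<odot>\<^bsub>B\<^esub> \<phi> x) \<and>
     (\<forall>x\<in>carrier A. \<phi> (adj A x) = adj B (\<phi> x))}"

definition star_aut :: "'a cstar \<Rightarrow> ('a \<Rightarrow> 'a) set" where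
  "star_aut A = {\<phi> \<in> star_hom A A. bij_betw \<phi> (carrier A) (carrier A)}"

section \<open>Relative Cuntz--Krieger families\<close>

text \<open>
  The product $\prod_{\kappa \in E} (t_{r(E)} - t_\kappa t_\kappa^*)$, which needs no unit: it starts from
  the projection $t_{r(E)}$, which is a unit for each of the factors. The factors commute.
\<close>

definition gap_prod ::
  "('p, 'k::finite) kgraph \<Rightarrow> 'b cstar \<Rightarrow> ('p \<Rightarrow> 'b) \<Rightarrow> 'p set \<Rightarrow> 'b" where
  "gap_prod \<Lambda> B t E =
     foldD (carrier B)
       (\<lambda>\<kappa> x. (t (set_rng \<Lambda> E) \<ominus>\<^bsub>B\<^esub> (t \<kappa> \<otimes>\<^bsub>B\<^esub> adj B (t \<kappa>))) \<otimes>\<^bsub>B\<^esub> x) (t (set_rng \<Lambda> E)) E"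

definition ck_family ::
  "('p, 'k::finite) kgraph \<Rightarrow> 'p set set \<Rightarrow> 'b cstar \<Rightarrow> ('p \<Rightarrow> 'b) \<Rightarrow> bool" where
  "ck_family \<Lambda> \<E> B t \<longleftrightarrow>
     (\<forall>\<kappa>\<in>paths \<Lambda>. t \<kappa> \<in> carrier B \<and> t \<kappa> \<otimes>\<^bsub>B\<^esub> adj B (t \<kappa>) \<otimes>\<^bsub>B\<^esub> t \<kappa> = t \<kappa>) \<and>
     (\<forall>v\<in>vertices \<Lambda>. adj B (t v) = t v \<and> t v \<otimes>\<^bsub>B\<^esub> t v = t v) \<and>
     (\<forall>v\<in>vertices \<Lambda>. \<forall>w\<in>vertices \<Lambda>. v \<noteq> w \<longrightarrow> t v \<otimes>\<^bsub>B\<^esub> t w = \<zero>\<^bsub>B\<^esub>) \<and>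
     (\<forall>\<kappa>\<in>paths \<Lambda>. \<forall>\<mu>\<in>paths \<Lambda>. src \<Lambda> \<kappa> = rng \<Lambda> \<mu> \<longrightarrow> t \<kappa> \<otimes>\<^bsub>B\<^esub> t \<mu> = t (cmp \<Lambda> \<kappa> \<mu>)) \<and>
     (\<forall>\<kappa>\<in>paths \<Lambda>. \<forall>\<mu>\<in>paths \<Lambda>.
        adj B (t \<kappa>) \<otimes>\<^bsub>B\<^esub> t \<mu> =
          finsum B (\<lambda>(\<alpha>, \<beta>). t \<alpha> \<otimes>\<^bsub>B\<^esub> adj B (t \<beta>)) (lambda_min \<Lambda> \<kappa> \<mu>)) \<and>
     (\<forall>E\<in>\<E>. gap_prod \<Lambda> B t E = \<zero>\<^bsub>B\<^esub>)"

text \<open>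
  \<open>universal_ck \<Lambda> \<E> A s\<close> says that \<open>A\<close>, generated by the family \<open>s\<close>, is the universal C*-algebra of
  relative Cuntz--Krieger families. The universal property is tested on the C*-algebras \<open>C\<close> whose
  elements are sets of natural numbers. This is no restriction: \<open>paths \<Lambda>\<close> is countable, so a family
  in any C*-algebra generates a separable C*-subalgebra; that has at most the cardinality of the
  continuum, hence an isomorphic copy among these \<open>C\<close>.
\<close>

definition universal_ck ::
  "('p, 'k::finite) kgraph \<Rightarrow> 'p set set \<Rightarrow> 'a cstar \<Rightarrow> ('p \<Rightarrow> 'a) \<Rightarrow> bool" where
  "universal_ck \<Lambda> \<E> A s \<longleftrightarrow>
     cstar_algebra A \<and> ck_family \<Lambda> \<E> A s \<and>
     (\<forall>S. cstar_subalgebra A S \<and> s ` paths \<Lambda> \<subseteq> S \<longrightarrow> S = carrier A) \<and>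
     (\<forall>(C :: nat set cstar) t. cstar_algebra C \<and> ck_family \<Lambda> \<E> C t \<longrightarrow>
        (\<exists>\<pi>\<in>star_hom A C. \<forall>\<kappa>\<in>paths \<Lambda>. \<pi> (s \<kappa>) = t \<kappa>))"

text \<open>The homomorphism $\pi^{\mathcal E}_t$ from the universal algebra \<open>A\<close> to \<open>B\<close>; it is made unique as a
  total function by \<open>extensional\<close>.\<close>

definition ck_hom ::
  "('p, 'k::finite) kgraph \<Rightarrow> 'a cstar \<Rightarrow> ('p \<Rightarrow> 'a) \<Rightarrow> 'b cstar \<Rightarrow> ('p \<Rightarrow> 'b) \<Rightarrow> 'a \<Rightarrow> 'b" where
  "ck_hom \<Lambda> A s B t =
     (THE \<pi>. \<pi> \<in> star_hom A B \<and> \<pi> \<in> extensional (carrier A) \<and> (\<forall>\<kappa>\<in>paths \<Lambda>. \<pi> (s \<kappa>) = t \<kappa>))"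

section \<open>Torus actions\<close>

definition torus :: "(complex ^ 'k::finite) set" where
  "torus = {z. \<forall>i. cmod (z $ i) = 1}"

definition torus_pow :: "complex ^ 'k \<Rightarrow> nat ^ 'k::finite \<Rightarrow> complex" where
  "torus_pow z n = (\<Prod>i\<in>UNIV. z $ i ^ (n $ i))"

text \<open>Multiplication on \<open>complex ^ 'k\<close> is coordinatewise. No continuity is required of an action.\<close>

definition torus_action :: "'b cstar \<Rightarrow> (complex ^ 'k::finite \<Rightarrow> 'b \<Rightarrow> 'b) \<Rightarrow> bool" where
  "torus_action B \<theta> \<longleftrightarrow>
     (\<forall>z\<in>torus. \<theta> z \<in> star_aut B) \<and>
     (\<forall>z\<in>torus. \<forall>w\<in>torus. \<forall>x\<in>carrier B. \<theta> (z * w) x = \<theta> z (\<theta> w x))"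

end

theory Submission
  imports Defs
begin

text \<open>
  Call \<open>\<pi>\<close> the homomorphism in question. The elements $s_\kappa s_\mu^*$ with $s(\kappa) = s(\mu)$ span a
  dense *-subalgebra of the universal algebra, and *-homomorphisms are contractive
  (\<open>contractive\<close>). So it suffices to show that \<open>\<pi>\<close> does not decrease the norm on this span;
  injectivity follows by density (\<open>inj_if_isometric_on_dense\<close>).

  The main device is that a bad estimate can be improved by taking powers. Since
  $|(x^*x)^N| = |x|^{2N}$ for $N = 2^n$, a bound $|y| \leq K N^k |\pi(y)|$ for all $y = (x^*x)^N$ already
  implies $|x| \leq |\pi(x)|$ (\<open>nrm_le_if_powers_le\<close>). It is applied twice.

  For the core, the span of the $s_\kappa s_\mu^*$ with $d(\kappa) = d(\mu)$, the constant comes from finite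
  dimensionality. Each element of the core involves finitely many paths, and these lie in a finite
  set \<open>C\<close> such that the $s_\kappa s_\mu^*$ with $\kappa, \mu$ in \<open>C\<close> of equal degree and source span a
  *-algebra (\<open>finite_path_closure\<close>). This algebra is spanned by matrix units whose diagonal is given by gap
  projections $s_\xi \bigl(\prod_{\nu \in T} (s_{s(\xi)} - s_\nu s_\nu^*)\bigr) s_\xi^*$, where \<open>T\<close> is the finite set of paths
  that lead from \<open>\<xi>\<close> to its proper extensions in \<open>C\<close> (\<open>q_eq_sum_Q\<close>, \<open>core_nrm_bound\<close>). The gap of
  \<open>T\<close> is zero for the universal family if and only if it is zero for \<open>t\<close>: both gaps are nonzero if \<open>T\<close>
  is not exhaustive, because vertex projections are nonzero; both vanish if \<open>T\<close> belongs to \<open>\<E>\<close>;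
  otherwise the gap for \<open>t\<close> is nonzero by assumption, and so is the gap for the universal family,
  which \<open>\<pi>\<close> maps to it. Hence \<open>\<pi>\<close> kills no nonzero matrix unit, the norm of an element of the
  core is bounded by a constant times the norm of its image, and the constant can be removed
  (\<open>core_isometric\<close>).

  For a general element of the span the constant comes from the grading by degree. A homogeneous
  element \<open>y\<close> is mapped isometrically, since $y^*y$ lies in the core. The power $(x^*x)^N$ has only
  $O(N^k)$ homogeneous components, and the gauge action on \<open>B\<close> bounds the norm of each component of
  its image by the norm of the image: the component is an average over a finite group of roots of
  unity (\<open>spectral_component_nrm_le\<close>). So $|(x^*x)^N| = O(N^k) |\pi((x^*x)^N)|$
  (\<open>isometric_on_span\<close>).

  That \<open>\<pi>\<close> exists has to be derived from the universal property on algebras of sets of natural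
  numbers, by transport of the separable subalgebra of \<open>B\<close> generated by \<open>t\<close>
  (\<open>universal_hom_exists\<close>).
\<close>

section \<open>Elementary facts on C*-algebras\<close>

locale cstar =
  fixes A :: "'a cstar" (structure)
  assumes cstar_algebra: "cstar_algebra A"

lemma cstar_module: "cstar_algebra A \<Longrightarrow> Module.module complex_ring A"
  by (simp add: cstar_algebra_def)

sublocale cstar \<subseteq> abelian_group A
  using cstar_module[OF cstar_algebra] by (simp add: Module.module_def)

context cstar
begin

lemma smult_closed [simp, intro]: "x \<in> carrier A \<Longrightarrow> c \<odot> x \<in> carrier A"
  and smult_add_left: "x \<in> carrier A \<Longrightarrow> (c + d) \<odot> x = c \<odot> x \<oplus> d \<odot> x"
  and smult_add: "x \<in> carrier A \<Longrightarrow> y \<in> carrier A \<Longrightarrow> c \<odot> (x \<oplus> y) = c \<odot> x \<oplus> c \<odot> y"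
  and smult_smult [simp]: "x \<in> carrier A \<Longrightarrow> c \<odot> (d \<odot> x) = (c * d) \<odot> x"
  and smult_1 [simp]: "x \<in> carrier A \<Longrightarrow> 1 \<odot> x = x"
  using cstar_module[OF cstar_algebra]
  by (auto simp: Module.module_def module_axioms_def complex_ring_def)

lemma mult_closed [simp, intro]: "x \<in> carrier A \<Longrightarrow> y \<in> carrier A \<Longrightarrow> x \<otimes> y \<in> carrier A"
  and m_assoc: "x \<in> carrier A \<Longrightarrow> y \<in> carrier A \<Longrightarrow> z \<in> carrier A \<Longrightarrow> (x \<otimes> y) \<otimes> z = x \<otimes> (y \<otimes> z)"
  and l_distr: "x \<in> carrier A \<Longrightarrow> y \<in> carrier A \<Longrightarrow> z \<in> carrier A \<Longrightarrow> (x \<oplus> y) \<otimes> z = x \<otimes> z \<oplus> y \<otimes> z"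
  and r_distr: "x \<in> carrier A \<Longrightarrow> y \<in> carrier A \<Longrightarrow> z \<in> carrier A \<Longrightarrow> z \<otimes> (x \<oplus> y) = z \<otimes> x \<oplus> z \<otimes> y"
  and smult_mult_left [simp]: "x \<in> carrier A \<Longrightarrow> y \<in> carrier A \<Longrightarrow> (c \<odot> x) \<otimes> y = c \<odot> (x \<otimes> y)"
  and smult_mult_right [simp]: "x \<in> carrier A \<Longrightarrow> y \<in> carrier A \<Longrightarrow> x \<otimes> (c \<odot> y) = c \<odot> (x \<otimes> y)"
  and adj_closed [simp, intro]: "x \<in> carrier A \<Longrightarrow> adj A x \<in> carrier A"
  and adj_adj [simp]: "x \<in> carrier A \<Longrightarrow> adj A (adj A x) = x"
  and adj_add [simp]: "x \<in> carrier A \<Longrightarrow> y \<in> carrier A \<Longrightarrow> adj A (x \<oplus> y) = adj A x \<oplus> adj A y"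
  and adj_mult [simp]: "x \<in> carrier A \<Longrightarrow> y \<in> carrier A \<Longrightarrow> adj A (x \<otimes> y) = adj A y \<otimes> adj A x"
  and adj_smult [simp]: "x \<in> carrier A \<Longrightarrow> adj A (c \<odot> x) = cnj c \<odot> adj A x"
  and nrm_nonneg [simp]: "x \<in> carrier A \<Longrightarrow> 0 \<le> nrm A x"
  and nrm_eq_0 [simp]: "x \<in> carrier A \<Longrightarrow> nrm A x = 0 \<longleftrightarrow> x = \<zero>"
  and nrm_smult [simp]: "x \<in> carrier A \<Longrightarrow> nrm A (c \<odot> x) = cmod c * nrm A x"
  and nrm_add: "x \<in> carrier A \<Longrightarrow> y \<in> carrier A \<Longrightarrow> nrm A (x \<oplus> y) \<le> nrm A x + nrm A y"
  and nrm_mult: "x \<in> carrier A \<Longrightarrow> y \<in> carrier A \<Longrightarrow> nrm A (x \<otimes> y) \<le> nrm A x * nrm A y"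
  and nrm_adj_mult: "x \<in> carrier A \<Longrightarrow> nrm A (adj A x \<otimes> x) = (nrm A x)\<^sup>2"
  using cstar_algebra unfolding cstar_algebra_def by (elim conjE; simp)+

lemma complete: "(\<And>n::nat. X n \<in> carrier A) \<Longrightarrow>
     (\<And>e. e > 0 \<Longrightarrow> \<exists>N. \<forall>m\<ge>N. \<forall>n\<ge>N. nrm A (X m \<ominus> X n) < e) \<Longrightarrow>
     \<exists>l\<in>carrier A. (\<lambda>n. nrm A (X n \<ominus> l)) \<longlonglongrightarrow> 0"
  using cstar_algebra unfolding cstar_algebra_def by (elim conjE; simp)+

lemma add_eq_self: "x \<in> carrier A \<Longrightarrow> y \<in> carrier A \<Longrightarrow> x \<oplus> y = x \<Longrightarrow> y = \<zero>"
  by (metis add.l_cancel_one)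

lemma smult_0 [simp]: "x \<in> carrier A \<Longrightarrow> 0 \<odot> x = \<zero>"
  by (metis nrm_smult nrm_eq_0 smult_closed norm_zero mult_zero_left)

lemma smult_zero [simp]: "c \<odot> \<zero> = \<zero>"
  using smult_smult[of \<zero> c 0] by simp

lemma zero_mult [simp]: "x \<in> carrier A \<Longrightarrow> \<zero> \<otimes> x = \<zero>"
  using smult_mult_left[of \<zero> x 0] by simp

lemma mult_zero [simp]: "x \<in> carrier A \<Longrightarrow> x \<otimes> \<zero> = \<zero>"
  using smult_mult_right[of x \<zero> 0] by simp

lemma adj_zero [simp]: "adj A \<zero> = \<zero>"
  using adj_smult[of \<zero> 0] by simp

lemma nrm_zero [simp]: "nrm A \<zero> = 0"
  by simp

lemma minus_as_smult: "x \<in> carrier A \<Longrightarrow> \<ominus> x = (-1) \<odot> x"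
proof -
  assume x: "x \<in> carrier A"
  have "(-1) \<odot> x \<oplus> x = (-1 + 1) \<odot> x" using x by (simp only: smult_add_left smult_1)
  then show ?thesis using x by (simp add: minus_equality)
qed

lemma diff_as_smult: "x \<in> carrier A \<Longrightarrow> y \<in> carrier A \<Longrightarrow> x \<ominus> y = x \<oplus> (-1) \<odot> y"
  by (simp add: minus_eq minus_as_smult)

lemma mult_diff_right: "x \<in> carrier A \<Longrightarrow> y \<in> carrier A \<Longrightarrow> z \<in> carrier A \<Longrightarrow> z \<otimes> (x \<ominus> y) = z \<otimes> x \<ominus> z \<otimes> y"
  and mult_diff_left: "x \<in> carrier A \<Longrightarrow> y \<in> carrier A \<Longrightarrow> z \<in> carrier A \<Longrightarrow> (x \<ominus> y) \<otimes> z = x \<otimes> z \<ominus> y \<otimes> z"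
  and smult_diff: "x \<in> carrier A \<Longrightarrow> y \<in> carrier A \<Longrightarrow> c \<odot> (x \<ominus> y) = c \<odot> x \<ominus> c \<odot> y"
  and adj_diff [simp]: "x \<in> carrier A \<Longrightarrow> y \<in> carrier A \<Longrightarrow> adj A (x \<ominus> y) = adj A x \<ominus> adj A y"
  by (simp_all add: diff_as_smult l_distr r_distr smult_add)

lemma minus_self [simp]: "x \<in> carrier A \<Longrightarrow> x \<ominus> x = \<zero>"
  by (simp add: minus_eq r_neg)

lemma minus_zero_right [simp]: "x \<in> carrier A \<Longrightarrow> x \<ominus> \<zero> = x"
  by (simp add: diff_as_smult)

lemma diff_eq_zero: "x \<in> carrier A \<Longrightarrow> y \<in> carrier A \<Longrightarrow> x \<ominus> y = \<zero> \<longleftrightarrow> x = y"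
  by (metis add.inv_closed add.inv_equality minus_self minus_eq minus_minus)

lemma diff_add_diff: "x \<in> carrier A \<Longrightarrow> y \<in> carrier A \<Longrightarrow> z \<in> carrier A \<Longrightarrow> (x \<ominus> y) \<oplus> (y \<ominus> z) = x \<ominus> z"
  by (simp add: minus_eq a_assoc r_neg2 r_neg1)

lemma nrm_diff_commute: "x \<in> carrier A \<Longrightarrow> y \<in> carrier A \<Longrightarrow> nrm A (x \<ominus> y) = nrm A (y \<ominus> x)"
proof -
  assume xy: "x \<in> carrier A" "y \<in> carrier A"
  have "(-1) \<odot> (x \<ominus> y) = y \<ominus> x"
    using xy by (simp add: diff_as_smult smult_add a_comm)
  then show ?thesis using nrm_smult[of "x \<ominus> y" "-1"] xy by simp
qed

lemma nrm_diff_triangle: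
  "x \<in> carrier A \<Longrightarrow> y \<in> carrier A \<Longrightarrow> z \<in> carrier A \<Longrightarrow> nrm A (x \<ominus> z) \<le> nrm A (x \<ominus> y) + nrm A (y \<ominus> z)"
  using nrm_add[of "x \<ominus> y" "y \<ominus> z"] diff_add_diff[of x y z] by simp

lemma nrm_le_diff: "x \<in> carrier A \<Longrightarrow> y \<in> carrier A \<Longrightarrow> nrm A x \<le> nrm A (x \<ominus> y) + nrm A y"
  using nrm_diff_triangle[of x y \<zero>] by simp

lemma nrm_adj [simp]: "x \<in> carrier A \<Longrightarrow> nrm A (adj A x) = nrm A x"
proof -
  have le: "nrm A x \<le> nrm A (adj A x)" if x: "x \<in> carrier A" for x
  proof (cases "nrm A x = 0")
    case False
    have "nrm A x * nrm A x \<le> nrm A (adj A x) * nrm A x"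
      using nrm_adj_mult[of x] nrm_mult[of "adj A x" x] x by (simp add: power2_eq_square)
    then show ?thesis using False nrm_nonneg[OF x] by (simp add: mult_le_cancel_right)
  qed (use x in simp)
  assume "x \<in> carrier A"
  then show ?thesis using le[of x] le[of "adj A x"] by simp
qed

lemma nrm_projection:
  assumes "p \<in> carrier A" "adj A p = p" "p \<otimes> p = p"
  shows "nrm A p = (if p = \<zero> then 0 else 1)"
  using nrm_adj_mult[of p] assms by (auto simp: power2_eq_square)

lemma nrm_finsum:
  assumes "finite I" "f \<in> I \<rightarrow> carrier A"
  shows "nrm A (finsum A f I) \<le> (\<Sum>i\<in>I. nrm A (f i))"
  using assms
proof (induction I)
  case (insert i I)
  have "nrm A (f i \<oplus> finsum A f I) \<le> nrm A (f i) + nrm A (finsum A f I)"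
    using insert by (intro nrm_add finsum_closed) auto
  then show ?case using insert by (simp add: Pi_iff)
qed simp

end

text \<open>
  Products, adjoints, *-homomorphisms and averages all commute with finite sums for this one reason.
\<close>

lemma additive_finsum:
  assumes "abelian_group G" "abelian_group H"
    and add: "\<And>x y. x \<in> carrier G \<Longrightarrow> y \<in> carrier G \<Longrightarrow> \<phi> (x \<oplus>\<^bsub>G\<^esub> y) = \<phi> x \<oplus>\<^bsub>H\<^esub> \<phi> y"
    and car: "\<And>x. x \<in> carrier G \<Longrightarrow> \<phi> x \<in> carrier H"
    and f: "f \<in> I \<rightarrow> carrier G"
  shows "\<phi> (finsum G f I) = finsum H (\<lambda>i. \<phi> (f i)) I"
proof -
  interpret G: abelian_group G by fact
  interpret H: abelian_group H by fact
  have "\<phi> \<zero>\<^bsub>G\<^esub> \<oplus>\<^bsub>H\<^esub> \<phi> \<zero>\<^bsub>G\<^esub> = \<phi> \<zero>\<^bsub>G\<^esub>" using add[of "\<zero>\<^bsub>G\<^esub>" "\<zero>\<^bsub>G\<^esub>"] by simp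
  then have zero: "\<phi> \<zero>\<^bsub>G\<^esub> = \<zero>\<^bsub>H\<^esub>" using car[of "\<zero>\<^bsub>G\<^esub>"] by (metis G.zero_closed H.add.l_cancel_one)
  show ?thesis
  proof (cases "finite I")
    case True
    then show ?thesis using f
    proof (induction I)
      case (insert i I)
      have "\<phi> (finsum G f (insert i I)) = \<phi> (f i) \<oplus>\<^bsub>H\<^esub> \<phi> (finsum G f I)"
        using insert by (subst G.finsum_insert) (auto simp: add Pi_iff intro!: add G.finsum_closed)
      also have "\<dots> = finsum H (\<lambda>i. \<phi> (f i)) (insert i I)"
        using insert car by (subst H.finsum_insert) (auto simp: Pi_iff)
      finally show ?case .
    qed (simp add: zero)
  qed (simp add: zero G.finsum_infinite H.finsum_infinite)
qed

context cstar
begin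

lemma mult_finsum:
  assumes "f \<in> I \<rightarrow> carrier A" "x \<in> carrier A"
  shows "x \<otimes> finsum A f I = finsum A (\<lambda>i. x \<otimes> f i) I"
  using assms by (intro additive_finsum abelian_group_axioms) (auto simp: r_distr)

lemma finsum_mult:
  assumes "f \<in> I \<rightarrow> carrier A" "x \<in> carrier A"
  shows "finsum A f I \<otimes> x = finsum A (\<lambda>i. f i \<otimes> x) I"
  using assms by (intro additive_finsum abelian_group_axioms) (auto simp: l_distr)

lemma adj_finsum:
  assumes "f \<in> I \<rightarrow> carrier A"
  shows "adj A (finsum A f I) = finsum A (\<lambda>i. adj A (f i)) I"
  using assms by (intro additive_finsum abelian_group_axioms) auto

lemma finsum_only:
  assumes "finite I" "i \<in> I" "f \<in> I \<rightarrow> carrier A" "\<And>j. j \<in> I \<Longrightarrow> j \<noteq> i \<Longrightarrow> f j = \<zero>"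
  shows "finsum A f I = f i"
proof -
  have "finsum A f I = finsum A f (insert i (I - {i}))" using assms by (simp add: insert_absorb)
  also have "\<dots> = f i \<oplus> finsum A f (I - {i})" using assms by (intro finsum_insert) auto
  also have "finsum A f (I - {i}) = finsum A (\<lambda>_. \<zero>) (I - {i})" 
    using assms by (intro finsum_cong') auto
  finally show ?thesis using assms by (auto simp: finsum_zero Pi_iff)
qed

lemma finsum_all_zero: "(\<And>i. i \<in> I \<Longrightarrow> f i = \<zero>) \<Longrightarrow> finsum A f I = \<zero>"
  using finsum_cong'[of I I "\<lambda>_. \<zero>" f] by (simp add: finsum_zero)

lemma finsum_smult_const:
  assumes "x \<in> carrier A" "finite I"
  shows "finsum A (\<lambda>i. c i \<odot> x) I = (\<Sum>i\<in>I. c i) \<odot> x"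
  using assms(2) by (induction I) (auto simp: assms smult_add_left)

subsection \<open>Limits\<close>

definition converges :: "(nat \<Rightarrow> 'a) \<Rightarrow> 'a \<Rightarrow> bool" where
  "converges X l \<longleftrightarrow> (\<lambda>n. nrm A (X n \<ominus> l)) \<longlonglongrightarrow> 0"

lemma converges_bound:
  assumes "u \<longlonglongrightarrow> 0" "\<And>n. nrm A (X n \<ominus> l) \<le> u n" "\<And>n. X n \<in> carrier A" "l \<in> carrier A"
  shows "converges X l"
  unfolding converges_def
  by (rule tendsto_sandwich[OF _ _ tendsto_const assms(1)]) (use assms in auto)

lemma converges_unique:
  assumes "converges X l" "converges X m" "\<And>n. X n \<in> carrier A" "l \<in> carrier A" "m \<in> carrier A"
  shows "l = m"
proof -
  have "(\<lambda>n. nrm A (X n \<ominus> l) + nrm A (X n \<ominus> m)) \<longlonglongrightarrow> 0 + 0"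
    using assms unfolding converges_def by (intro tendsto_add)
  moreover have "nrm A (l \<ominus> m) \<le> nrm A (X n \<ominus> l) + nrm A (X n \<ominus> m)" for n
    using nrm_diff_triangle[of l "X n" m] nrm_diff_commute[of l "X n"] assms by simp
  ultimately have "nrm A (l \<ominus> m) \<le> 0 + 0" by (intro LIMSEQ_le_const) auto
  then have "nrm A (l \<ominus> m) = 0"
    using assms nrm_nonneg[of "l \<ominus> m"] by (metis add_0 minus_closed order_antisym)
  then show ?thesis using assms by (simp add: diff_eq_zero)
qed

lemma converges_const: "l \<in> carrier A \<Longrightarrow> converges (\<lambda>_. l) l"
  by (simp add: converges_def)

lemma converges_add:
  assumes "converges X l" "converges Y m" and [simp]: "\<And>n. X n \<in> carrier A" "\<And>n. Y n \<in> carrier A"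
    "l \<in> carrier A" "m \<in> carrier A"
  shows "converges (\<lambda>n. X n \<oplus> Y n) (l \<oplus> m)"
proof (rule converges_bound)
  show "(\<lambda>n. nrm A (X n \<ominus> l) + nrm A (Y n \<ominus> m)) \<longlonglongrightarrow> 0"
    using tendsto_add[OF assms(1,2)[unfolded converges_def]] by simp
  show "nrm A ((X n \<oplus> Y n) \<ominus> (l \<oplus> m)) \<le> nrm A (X n \<ominus> l) + nrm A (Y n \<ominus> m)" for n
  proof -
    have "(X n \<oplus> Y n) \<ominus> (l \<oplus> m) = (X n \<ominus> l) \<oplus> (Y n \<ominus> m)"
      by (simp add: minus_eq minus_add a_ac)
    then show ?thesis using nrm_add[of "X n \<ominus> l" "Y n \<ominus> m"] by simp
  qed
qed auto

lemma converges_smult: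
  assumes "converges X l" and [simp]: "\<And>n. X n \<in> carrier A" "l \<in> carrier A"
  shows "converges (\<lambda>n. c \<odot> X n) (c \<odot> l)"
proof (rule converges_bound)
  show "(\<lambda>n. cmod c * nrm A (X n \<ominus> l)) \<longlonglongrightarrow> 0"
    using tendsto_mult_left[OF assms(1)[unfolded converges_def], of "cmod c"] by simp
qed (simp_all flip: smult_diff)

lemma converges_adj:
  assumes "converges X l" and [simp]: "\<And>n. X n \<in> carrier A" "l \<in> carrier A"
  shows "converges (\<lambda>n. adj A (X n)) (adj A l)"
  using assms(1) unfolding converges_def by (simp flip: adj_diff)

lemma nrm_mult_diff:
  assumes [simp]: "x \<in> carrier A" "y \<in> carrier A" "l \<in> carrier A" "m \<in> carrier A"
  shows "nrm A (x \<otimes> y \<ominus> l \<otimes> m) \<le> nrm A (x \<ominus> l) * nrm A y + nrm A l * nrm A (y \<ominus> m)"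
proof -
  have "nrm A (x \<otimes> y \<ominus> l \<otimes> m) \<le> nrm A (x \<otimes> y \<ominus> l \<otimes> y) + nrm A (l \<otimes> y \<ominus> l \<otimes> m)"
    by (rule nrm_diff_triangle) auto
  also have "\<dots> \<le> nrm A (x \<ominus> l) * nrm A y + nrm A l * nrm A (y \<ominus> m)"
    using nrm_mult[of "x \<ominus> l" y] nrm_mult[of l "y \<ominus> m"] by (simp add: mult_diff_left mult_diff_right)
  finally show ?thesis .
qed

lemma converges_mult:
  assumes "converges X l" "converges Y m" and [simp]: "\<And>n. X n \<in> carrier A" "\<And>n. Y n \<in> carrier A"
    "l \<in> carrier A" "m \<in> carrier A"
  shows "converges (\<lambda>n. X n \<otimes> Y n) (l \<otimes> m)"
proof (rule converges_bound)
  let ?u = "\<lambda>n. nrm A (X n \<ominus> l)" and ?v = "\<lambda>n. nrm A (Y n \<ominus> m)"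
  have "(\<lambda>n. ?u n * (?v n + nrm A m) + nrm A l * ?v n) \<longlonglongrightarrow> 0 * (0 + nrm A m) + nrm A l * 0"
    using assms(1,2)[unfolded converges_def] by (intro tendsto_intros)
  then show "(\<lambda>n. ?u n * (?v n + nrm A m) + nrm A l * ?v n) \<longlonglongrightarrow> 0" by simp
  show "nrm A (X n \<otimes> Y n \<ominus> l \<otimes> m) \<le> ?u n * (?v n + nrm A m) + nrm A l * ?v n" for n
  proof -
    have "?u n * nrm A (Y n) \<le> ?u n * (?v n + nrm A m)"
      using nrm_le_diff[of "Y n" m] by (intro mult_left_mono) auto
    then show ?thesis using nrm_mult_diff[of "X n" "Y n" l m] by simp
  qed
qed auto

text \<open>
  The form of completeness that a contracting iteration needs.
\<close>

lemma geometric_converges: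
  assumes [simp]: "\<And>n. X n \<in> carrier A" and r: "0 \<le> r" "r < 1"
    and step: "\<And>n. nrm A (X (Suc n) \<ominus> X n) \<le> c * r ^ n"
  shows "\<exists>l\<in>carrier A. converges X l"
  unfolding converges_def
proof (rule complete)
  fix e :: real assume e: "e > 0"
  have c: "0 \<le> c" using order_trans[OF nrm_nonneg step[of 0]] by simp
  have tail: "nrm A (X (n + j) \<ominus> X n) \<le> c * (\<Sum>i<j. r ^ (n + i))" for n j
  proof (induction j)
    case (Suc j)
    have "nrm A (X (Suc (n + j)) \<ominus> X n) \<le> nrm A (X (Suc (n + j)) \<ominus> X (n + j)) + nrm A (X (n + j) \<ominus> X n)"
      by (rule nrm_diff_triangle) auto
    then show ?case using Suc step[of "n + j"] by (simp add: algebra_simps)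
  qed simp
  have tail': "nrm A (X (n + j) \<ominus> X n) \<le> c / (1 - r) * r ^ n" for n j
  proof -
    have "(\<Sum>i<j. r ^ (n + i)) = r ^ n * (\<Sum>i<j. r ^ i)" by (simp add: power_add sum_distrib_left)
    also have "\<dots> \<le> r ^ n * (1 / (1 - r))"
      using r by (intro mult_left_mono) (auto simp: sum_gp_strict divide_right_mono)
    finally have "(\<Sum>i<j. r ^ (n + i)) \<le> r ^ n * (1 / (1 - r))" .
    from mult_left_mono[OF this c] show ?thesis using tail[of n j] by simp
  qed
  have "(\<lambda>n. c / (1 - r) * r ^ n) \<longlonglongrightarrow> c / (1 - r) * 0"
    using r by (intro tendsto_intros LIMSEQ_power_zero) auto
  then obtain N where N: "\<And>n. n \<ge> N \<Longrightarrow> \<bar>c / (1 - r) * r ^ n\<bar> < e / 2"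
    using e unfolding LIMSEQ_iff by (metis diff_zero half_gt_zero mult_zero_right real_norm_def)
  have far: "nrm A (X n \<ominus> X N) < e / 2" if "n \<ge> N" for n
    using order_le_less_trans[OF order_trans[OF tail'[of N "n - N"] abs_ge_self] N[of N]] that by simp
  show "\<exists>N. \<forall>m\<ge>N. \<forall>n\<ge>N. nrm A (X m \<ominus> X n) < e"
  proof (intro exI allI impI)
    fix m n assume "N \<le> m" "N \<le> n"
    then show "nrm A (X m \<ominus> X n) < e"
      using far[of m] far[of n] nrm_diff_triangle[of "X m" "X N" "X n"] nrm_diff_commute[of "X N" "X n"] by simp
  qed
qed simp

end

section \<open>Automatic contractivity of *-homomorphisms\<close>

text \<open>
  The element $g = 1 - (1 - h^2)^{1/2}$, which exists without a unit: it solves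
  $g = (h^2 + g^2)/2$, and this right-hand side is a contraction of the ball of radius
  $\<rho> = 1 - (1 - |h|^2)^{1/2} < 1$. All iterates are self-adjoint and commute with $h$.
\<close>

lemma (in cstar) quasi_square_root:
  assumes h: "h \<in> carrier A" "adj A h = h" "nrm A h < 1"
  shows "\<exists>g\<in>carrier A. adj A g = g \<and> g \<otimes> h = h \<otimes> g \<and> g = (1/2) \<odot> (h \<otimes> h \<oplus> g \<otimes> g)"
proof -
  define a where "a = (nrm A h)\<^sup>2"
  define \<rho> where "\<rho> = 1 - sqrt (1 - a)"
  have a: "0 \<le> a" "a < 1" using h nrm_nonneg[OF h(1)] by (auto simp: a_def power_less_one_iff abs_square_less_1)
  have \<rho>: "0 \<le> \<rho>" "\<rho> < 1" using a by (auto simp: \<rho>_def)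
  \<comment> \<open>This equation keeps the iterates in the ball of radius \<open>\<rho>\<close>, where squaring has Lipschitz constant \<open>2 * \<rho>\<close>.\<close>
  have \<rho>_eq: "(a + \<rho>\<^sup>2) / 2 = \<rho>" using a by (simp add: \<rho>_def power2_diff)
  define X where "X = rec_nat \<zero> (\<lambda>_ g. (1/2) \<odot> (h \<otimes> h \<oplus> g \<otimes> g))"
  have X_0: "X 0 = \<zero>" and X_Suc: "X (Suc n) = (1/2) \<odot> (h \<otimes> h \<oplus> X n \<otimes> X n)" for n
    by (simp_all add: X_def)
  have X [simp]: "X n \<in> carrier A" for n
    by (induction n) (use h in \<open>auto simp: X_0 X_Suc\<close>)
  have X_adj: "adj A (X n) = X n" for n
    by (induction n) (use h in \<open>auto simp: X_0 X_Suc\<close>)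
  have X_comm: "X n \<otimes> h = h \<otimes> X n" for n
  proof (induction n)
    case (Suc n)
    have "X n \<otimes> X n \<otimes> h = h \<otimes> (X n \<otimes> X n)" using Suc h by (metis X m_assoc)
    then show ?case using h by (simp add: X_Suc l_distr r_distr m_assoc)
  qed (use h in \<open>simp add: X_0\<close>)
  have X_nrm: "nrm A (X n) \<le> \<rho>" for n
  proof (induction n)
    case (Suc n)
    have "nrm A (h \<otimes> h \<oplus> X n \<otimes> X n) \<le> nrm A (h \<otimes> h) + nrm A (X n \<otimes> X n)"
      using h by (intro nrm_add) auto
    also have "nrm A (X n \<otimes> X n) \<le> nrm A (X n) * nrm A (X n)" by (simp add: nrm_mult)
    also have "\<dots> \<le> \<rho> * \<rho>" using Suc by (intro mult_mono) (auto simp: \<rho>)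
    also have "nrm A (h \<otimes> h) = a" using nrm_adj_mult[of h] h by (simp add: a_def)
    finally show ?case using \<rho>_eq h by (simp add: X_Suc power2_eq_square)
  qed (simp add: X_0 \<rho>)
  have step: "nrm A (X (Suc n) \<ominus> X n) \<le> \<rho> * \<rho> ^ n" for n
  proof (induction n)
    case (Suc n)
    have "X (Suc (Suc n)) \<ominus> X (Suc n) = (1/2) \<odot> (X (Suc n) \<otimes> X (Suc n) \<ominus> X n \<otimes> X n)"
    proof -
      have "(h \<otimes> h \<oplus> y) \<ominus> (h \<otimes> h \<oplus> x) = y \<ominus> x" if "x \<in> carrier A" "y \<in> carrier A" for x y
        using h that by (simp add: minus_eq minus_add a_ac r_neg1 r_neg2 r_neg)
      then show ?thesis using h by (simp add: X_Suc flip: smult_diff)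
    qed
    then have "nrm A (X (Suc (Suc n)) \<ominus> X (Suc n)) = nrm A (X (Suc n) \<otimes> X (Suc n) \<ominus> X n \<otimes> X n) / 2"
      by simp
    also have "\<dots> \<le> (nrm A (X (Suc n) \<ominus> X n) * nrm A (X (Suc n)) + nrm A (X n) * nrm A (X (Suc n) \<ominus> X n)) / 2"
      by (intro divide_right_mono nrm_mult_diff) auto
    also have "\<dots> \<le> (nrm A (X (Suc n) \<ominus> X n) * \<rho> + \<rho> * nrm A (X (Suc n) \<ominus> X n)) / 2"
      by (intro divide_right_mono add_mono mult_mono X_nrm) (auto simp: \<rho>)
    also have "\<dots> \<le> \<rho> * (\<rho> * \<rho> ^ n)" using mult_left_mono[OF Suc \<rho>(1)] by simp
    finally show ?case by simp
  qed (use X_nrm[of "Suc 0"] in \<open>simp add: X_0\<close>)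
  obtain g where g: "g \<in> carrier A" and lim: "converges X g"
    using geometric_converges[OF X \<rho> step] by blast
  have "adj A g = g"
    using converges_unique[OF converges_adj[OF lim] _ _ _ g] lim g by (simp add: X_adj)
  moreover have "g \<otimes> h = h \<otimes> g"
    using converges_unique[OF converges_mult[OF lim converges_const[OF h(1)]]
        converges_mult[OF converges_const[OF h(1)] lim, folded X_comm]] h g by simp
  moreover have "g = (1/2) \<odot> (h \<otimes> h \<oplus> g \<otimes> g)"
  proof (rule converges_unique)
    show "converges (\<lambda>n. X (Suc n)) g"
      using lim unfolding converges_def by (rule LIMSEQ_Suc)
    show "converges (\<lambda>n. X (Suc n)) ((1/2) \<odot> (h \<otimes> h \<oplus> g \<otimes> g))"
      unfolding X_Suc using h g lim
      by (intro converges_smult converges_add converges_mult converges_const) auto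
  qed (use h g in auto)
  ultimately show ?thesis using g by blast
qed

text \<open>
  The hypotheses say that $k^2 + (1 - f)^2 = 1$ with $k$ and $f$ commuting, so $k$ is the real part of
  the unitary $u = k + i(1 - f)$ and has norm at most 1. There need not be a unit, so $u$ and $u^*$
  are applied to the element $k$: with $y = k k$ and $w = (1 - f) k$ they give $y + i w$ and $y - i w$.
\<close>

lemma (in cstar) nrm_le_1:
  assumes k: "k \<in> carrier A" "adj A k = k" and f: "f \<in> carrier A" "adj A f = f"
    and comm: "f \<otimes> k = k \<otimes> f" and f_eq: "f = (1/2) \<odot> (k \<otimes> k \<oplus> f \<otimes> f)"
  shows "nrm A k \<le> 1"
proof -
  define y where "y = k \<otimes> k"
  define w where "w = k \<ominus> f \<otimes> k"
  have [simp]: "y \<in> carrier A" "w \<in> carrier A" using k f by (auto simp: y_def w_def)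
  have two: "f \<oplus> f = k \<otimes> k \<oplus> f \<otimes> f"
  proof -
    have "f \<oplus> f = (1 + 1) \<odot> f" using f by (simp only: smult_add_left smult_1)
    also have "\<dots> = 2 \<odot> ((1/2) \<odot> (k \<otimes> k \<oplus> f \<otimes> f))" using f_eq by simp
    finally show ?thesis using k f by simp
  qed
  \<comment> \<open>The mixed terms of \<open>(y + c w)* (y + c w)\<close> cancel because \<open>f\<close> and \<open>k\<close> commute.\<close>
  have cross: "adj A y \<otimes> w = adj A w \<otimes> y"
    using k f by (simp add: y_def w_def mult_diff_left mult_diff_right m_assoc comm)
      (metis comm m_assoc mult_closed)
  have "adj A w \<otimes> w = k \<otimes> k \<ominus> k \<otimes> ((f \<oplus> f) \<ominus> f \<otimes> f) \<otimes> k"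
    using k f by (simp add: w_def mult_diff_left mult_diff_right m_assoc l_distr r_distr)
      (simp add: minus_eq minus_add a_ac r_neg)
  also have "(f \<oplus> f) \<ominus> f \<otimes> f = k \<otimes> k"
    using k f by (simp add: two minus_eq a_assoc r_neg)
  finally have ww: "adj A y \<otimes> y \<oplus> adj A w \<otimes> w = k \<otimes> k"
    using k f by (simp add: y_def m_assoc minus_eq a_ac r_neg1 r_neg2 r_neg)
  have u: "nrm A (y \<oplus> c \<odot> w) \<le> nrm A k" if c: "cnj c = - c" "c * c = -1" for c
  proof -
    have "adj A (y \<oplus> c \<odot> w) \<otimes> (y \<oplus> c \<odot> w) = 
        (adj A y \<otimes> y \<oplus> adj A w \<otimes> w) \<oplus> (c \<odot> (adj A y \<otimes> w) \<oplus> (- c) \<odot> (adj A w \<otimes> y))"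
      using c by (simp add: l_distr r_distr smult_add a_ac)
    also have "c \<odot> (adj A y \<otimes> w) \<oplus> (- c) \<odot> (adj A w \<otimes> y) = \<zero>"
      unfolding cross by (simp flip: smult_add_left)
    finally have "adj A (y \<oplus> c \<odot> w) \<otimes> (y \<oplus> c \<odot> w) = adj A k \<otimes> k"
      using ww k by simp
    then have "(nrm A (y \<oplus> c \<odot> w))\<^sup>2 = (nrm A k)\<^sup>2"
      by (metis nrm_adj_mult k(1) a_closed smult_closed \<open>y \<in> carrier A\<close> \<open>w \<in> carrier A\<close>)
    then show ?thesis using k by simp
  qed
  have "2 \<odot> y = (y \<oplus> \<i> \<odot> w) \<oplus> (y \<oplus> (- \<i>) \<odot> w)"
  proof -
    have "(y \<oplus> \<i> \<odot> w) \<oplus> (y \<oplus> (- \<i>) \<odot> w) = (1 \<odot> y \<oplus> 1 \<odot> y) \<oplus> (\<i> \<odot> w \<oplus> (- \<i>) \<odot> w)"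
      by (simp add: a_ac)
    moreover have "2 \<odot> y = 1 \<odot> y \<oplus> 1 \<odot> y"
      using smult_add_left[of y 1 1] \<open>y \<in> carrier A\<close> by (simp only: one_add_one)
    ultimately show ?thesis by (simp flip: smult_add_left)
  qed
  then have "2 * nrm A y \<le> nrm A (y \<oplus> \<i> \<odot> w) + nrm A (y \<oplus> (- \<i>) \<odot> w)"
    using nrm_smult[of y 2] nrm_add[of "y \<oplus> \<i> \<odot> w" "y \<oplus> (- \<i>) \<odot> w"] by simp
  then have "nrm A y \<le> nrm A k" using u[of \<i>] u[of "- \<i>"] by simp
  then have "nrm A k * nrm A k \<le> 1 * nrm A k"
    using nrm_adj_mult[of k] k by (simp add: y_def power2_eq_square)
  then show ?thesis using nrm_nonneg[OF k(1)] by (metis mult_le_cancel_right not_le zero_le_one order_trans)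
qed

locale cstar_hom = A: cstar A + B: cstar B for A :: "'a cstar" and B :: "'b cstar" +
  fixes \<phi> :: "'a \<Rightarrow> 'b"
  assumes hom: "\<phi> \<in> star_hom A B"
begin

lemma hom_closed [simp, intro]: "x \<in> carrier A \<Longrightarrow> \<phi> x \<in> carrier B"
  and hom_add [simp]: "x \<in> carrier A \<Longrightarrow> y \<in> carrier A \<Longrightarrow> \<phi> (x \<oplus>\<^bsub>A\<^esub> y) = \<phi> x \<oplus>\<^bsub>B\<^esub> \<phi> y"
  and hom_mult [simp]: "x \<in> carrier A \<Longrightarrow> y \<in> carrier A \<Longrightarrow> \<phi> (x \<otimes>\<^bsub>A\<^esub> y) = \<phi> x \<otimes>\<^bsub>B\<^esub> \<phi> y"
  and hom_smult [simp]: "x \<in> carrier A \<Longrightarrow> \<phi> (c \<odot>\<^bsub>A\<^esub> x) = c \<odot>\<^bsub>B\<^esub> \<phi> x"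
  and hom_adj [simp]: "x \<in> carrier A \<Longrightarrow> \<phi> (adj A x) = adj B (\<phi> x)"
  using hom by (auto simp: star_hom_def)

lemma hom_zero [simp]: "\<phi> \<zero>\<^bsub>A\<^esub> = \<zero>\<^bsub>B\<^esub>"
  using hom_smult[of "\<zero>\<^bsub>A\<^esub>" 0] by (simp del: hom_smult)

lemma hom_diff [simp]: "x \<in> carrier A \<Longrightarrow> y \<in> carrier A \<Longrightarrow> \<phi> (x \<ominus>\<^bsub>A\<^esub> y) = \<phi> x \<ominus>\<^bsub>B\<^esub> \<phi> y"
  by (simp add: A.diff_as_smult B.diff_as_smult)

lemma hom_finsum: "f \<in> I \<rightarrow> carrier A \<Longrightarrow> \<phi> (finsum A f I) = finsum B (\<lambda>i. \<phi> (f i)) I"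
  by (intro additive_finsum A.abelian_group_axioms B.abelian_group_axioms) auto

text \<open>
  The relations of \<open>quasi_square_root\<close> are algebraic, so they survive in the image, where
  \<open>nrm_le_1\<close> turns them into a bound.
\<close>

theorem contractive:
  assumes x: "x \<in> carrier A"
  shows "nrm B (\<phi> x) \<le> nrm A x"
proof -
  have unit: "nrm B (\<phi> h) \<le> 1" if h: "h \<in> carrier A" "adj A h = h" "nrm A h < 1" for h
  proof -
    obtain g where g: "g \<in> carrier A" "adj A g = g" "g \<otimes>\<^bsub>A\<^esub> h = h \<otimes>\<^bsub>A\<^esub> g"
      "g = (1/2) \<odot>\<^bsub>A\<^esub> (h \<otimes>\<^bsub>A\<^esub> h \<oplus>\<^bsub>A\<^esub> g \<otimes>\<^bsub>A\<^esub> g)"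
      using A.quasi_square_root[OF h] by blast
    have "\<phi> g = (1/2) \<odot>\<^bsub>B\<^esub> (\<phi> h \<otimes>\<^bsub>B\<^esub> \<phi> h \<oplus>\<^bsub>B\<^esub> \<phi> g \<otimes>\<^bsub>B\<^esub> \<phi> g)"
      by (subst g(4)) (use g(1) h in simp)
    moreover have "\<phi> g \<otimes>\<^bsub>B\<^esub> \<phi> h = \<phi> h \<otimes>\<^bsub>B\<^esub> \<phi> g" "adj B (\<phi> g) = \<phi> g" "adj B (\<phi> h) = \<phi> h"
      using g h by (metis hom_mult hom_adj)+
    ultimately show ?thesis using g h by (intro B.nrm_le_1[of "\<phi> h" "\<phi> g"]) auto
  qed
  have sa: "nrm B (\<phi> h) \<le> nrm A h" if h: "h \<in> carrier A" "adj A h = h" for h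
  proof (rule dense_ge)
    fix c assume c: "nrm A h < c"
    then have "c > 0" using A.nrm_nonneg[OF h(1)] by linarith
    then have "nrm B (\<phi> (complex_of_real (1 / c) \<odot>\<^bsub>A\<^esub> h)) \<le> 1"
      using h c by (intro unit) (auto simp: norm_divide)
    then show "nrm B (\<phi> h) \<le> c" using h \<open>c > 0\<close> by (simp add: norm_divide)
  qed
  have "(nrm B (\<phi> x))\<^sup>2 = nrm B (\<phi> (adj A x \<otimes>\<^bsub>A\<^esub> x))" using x by (simp add: B.nrm_adj_mult)
  also have "\<dots> \<le> nrm A (adj A x \<otimes>\<^bsub>A\<^esub> x)" using x by (intro sa) auto
  also have "\<dots> = (nrm A x)\<^sup>2" using x by (simp add: A.nrm_adj_mult)
  finally show ?thesis using x by (simp add: power2_le_iff_abs_le)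
qed

end

section \<open>Generated C*-subalgebras\<close>

context cstar
begin

definition norm_closure :: "'a set \<Rightarrow> 'a set" where
  "norm_closure D = {x \<in> carrier A. \<forall>e>0. \<exists>d\<in>D. nrm A (x \<ominus> d) < e}"

lemma norm_closure_sequence:
  assumes "D \<subseteq> carrier A"
  shows "x \<in> norm_closure D \<longleftrightarrow> x \<in> carrier A \<and> (\<exists>X. (\<forall>n. X n \<in> D) \<and> converges X x)"
proof safe
  assume x: "x \<in> norm_closure D"
  then show xc: "x \<in> carrier A" by (simp add: norm_closure_def)
  have "\<forall>n. \<exists>d\<in>D. nrm A (x \<ominus> d) < inverse (real (Suc n))"
    using x by (auto simp: norm_closure_def)
  then obtain X where X: "\<And>n. X n \<in> D" "\<And>n. nrm A (x \<ominus> X n) < inverse (real (Suc n))" by metis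
  have Xc: "X n \<in> carrier A" for n using X(1) assms by blast
  have "nrm A (X n \<ominus> x) \<le> inverse (real (Suc n))" for n
    using X(2)[of n] nrm_diff_commute[OF xc Xc, of n] by simp
  then have "converges X x"
    using LIMSEQ_inverse_real_of_nat Xc xc by (intro converges_bound) auto
  then show "\<exists>X. (\<forall>n. X n \<in> D) \<and> converges X x" using X by blast
next
  fix X assume x: "x \<in> carrier A" and X: "\<forall>n. X n \<in> D" "converges X x"
  show "x \<in> norm_closure D"
    unfolding norm_closure_def
  proof safe
    fix e :: real assume "e > 0"
    then obtain n where "\<bar>nrm A (X n \<ominus> x)\<bar> < e"
      using X(2) unfolding converges_def LIMSEQ_iff by (metis diff_zero order_refl real_norm_def)
    then show "\<exists>d\<in>D. nrm A (x \<ominus> d) < e"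
      using X(1) x assms nrm_diff_commute[of x "X n"] by (metis abs_less_iff subsetD)
  qed (fact x)
qed

lemma norm_closure_subset: "D \<subseteq> carrier A \<Longrightarrow> D \<subseteq> norm_closure D"
  unfolding norm_closure_def by safe (auto intro!: bexI)

lemma norm_closure_carrier: "norm_closure D \<subseteq> carrier A"
  by (auto simp: norm_closure_def)

lemma norm_closure_closed:
  assumes D: "D \<subseteq> carrier A" and X: "\<And>n. X n \<in> norm_closure D" "converges X l" "l \<in> carrier A"
  shows "l \<in> norm_closure D"
  unfolding norm_closure_def
proof safe
  fix e :: real assume "e > 0"
  then obtain n where n: "\<bar>nrm A (X n \<ominus> l)\<bar> < e / 2"
    using X(2) unfolding converges_def LIMSEQ_iff by (metis diff_zero order_refl real_norm_def half_gt_zero)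
  obtain d where d: "d \<in> D" "nrm A (X n \<ominus> d) < e / 2"
    using X(1)[of n] \<open>e > 0\<close> unfolding norm_closure_def by (auto dest: spec[of _ "e/2"])
  have c: "X n \<in> carrier A" "d \<in> carrier A" using X(1)[of n] d(1) D norm_closure_carrier by auto
  have "nrm A (l \<ominus> d) < e"
    using nrm_diff_triangle[OF X(3) c] nrm_diff_commute[OF c(1) X(3)] n d(2) by linarith
  then show "\<exists>d\<in>D. nrm A (l \<ominus> d) < e" using d(1) by blast
qed (fact X(3))

text \<open>
  A dense set of scalars is enough: the lemma serves both for the span of the generators and for a
  countable set, on which only countably many scalars can act.
\<close>

lemma norm_closure_subalgebra:
  assumes D: "D \<subseteq> carrier A" "\<zero> \<in> D"
    and add: "\<And>x y. x \<in> D \<Longrightarrow> y \<in> D \<Longrightarrow> x \<oplus> y \<in> D"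
    and mult: "\<And>x y. x \<in> D \<Longrightarrow> y \<in> D \<Longrightarrow> x \<otimes> y \<in> D"
    and adj: "\<And>x. x \<in> D \<Longrightarrow> adj A x \<in> D"
    and smult: "\<And>q x. q \<in> Q \<Longrightarrow> x \<in> D \<Longrightarrow> q \<odot> x \<in> D"
    and Q: "\<And>c e. e > 0 \<Longrightarrow> \<exists>q\<in>Q. cmod (c - q) < e"
  shows "cstar_subalgebra A (norm_closure D)"
proof -
  note seq = norm_closure_sequence[OF D(1)]
  have carr: "x \<in> carrier A" if "x \<in> D" for x using that D by blast
  have am: "x \<oplus> y \<in> norm_closure D \<and> x \<otimes> y \<in> norm_closure D"
    if xy: "x \<in> norm_closure D" "y \<in> norm_closure D" for x y
  proof -
    obtain X Y where X: "\<And>n. X n \<in> D" "converges X x" and Y: "\<And>n. Y n \<in> D" "converges Y y"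
      using xy seq by meson
    have c: "x \<in> carrier A" "y \<in> carrier A" using xy seq by auto
    have "converges (\<lambda>n. X n \<oplus> Y n) (x \<oplus> y)" "converges (\<lambda>n. X n \<otimes> Y n) (x \<otimes> y)"
      using X Y c carr by (auto intro!: converges_add converges_mult)
    then show ?thesis using X Y c add mult seq by (meson a_closed mult_closed)
  qed
  have ad: "adj A x \<in> norm_closure D" if x: "x \<in> norm_closure D" for x
  proof -
    obtain X where X: "\<And>n. X n \<in> D" "converges X x" using x seq by meson
    have "converges (\<lambda>n. adj A (X n)) (adj A x)"
      using X x carr seq by (intro converges_adj) auto
    then show ?thesis using X x adj seq by (meson adj_closed)
  qed
  have sm: "c \<odot> x \<in> norm_closure D" if x: "x \<in> norm_closure D" for c x
  proof -
    obtain X where X: "\<And>n. X n \<in> D" "converges X x" using x seq by meson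
    have xc: "x \<in> carrier A" using x seq by simp
    have Xc: "X n \<in> carrier A" for n using X carr by blast
    have "c \<odot> X n \<in> norm_closure D" for n
      unfolding norm_closure_def
    proof safe
      fix e :: real assume "e > 0"
      then obtain q where q: "q \<in> Q" "cmod (c - q) < e / (nrm A (X n) + 1)"
        using Q[of "e / (nrm A (X n) + 1)" c] nrm_nonneg[OF Xc, of n] by auto
      have "c \<odot> X n \<ominus> q \<odot> X n = (c - q) \<odot> X n"
        using Xc[of n] smult_add_left[OF Xc, of c "-q" n] by (simp add: diff_as_smult)
      then have "nrm A (c \<odot> X n \<ominus> q \<odot> X n) = cmod (c - q) * nrm A (X n)"
        using Xc by simp
      also have "\<dots> \<le> cmod (c - q) * (nrm A (X n) + 1)" by (intro mult_left_mono) auto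
      also have "\<dots> < e" using q(2) nrm_nonneg[OF Xc, of n] by (simp add: field_simps)
      finally show "\<exists>d\<in>D. nrm A (c \<odot> X n \<ominus> d) < e" using smult[OF q(1) X(1)] by blast
    qed (use Xc in simp)
    moreover have "converges (\<lambda>n. c \<odot> X n) (c \<odot> x)"
      using X(2) Xc xc by (rule converges_smult)
    ultimately show ?thesis by (rule norm_closure_closed[OF D(1)]) (use xc in simp)
  qed
  have ze: "\<zero> \<in> norm_closure D" using norm_closure_subset D by blast
  have cl: "l \<in> norm_closure D" if "\<And>n. X n \<in> norm_closure D" "(\<lambda>n. nrm A (X n \<ominus> l)) \<longlonglongrightarrow> 0"
    "l \<in> carrier A" for X l
    using norm_closure_closed[OF D(1)] that unfolding converges_def by blast
  show ?thesis
    unfolding cstar_subalgebra_def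
  proof (intro conjI)
    show "\<forall>X. \<forall>l\<in>carrier A. (\<forall>n. X n \<in> norm_closure D) \<and> (\<lambda>n. nrm A (X n \<ominus> l)) \<longlonglongrightarrow> 0 \<longrightarrow>
        l \<in> norm_closure D"
      using cl by blast
  qed (use norm_closure_carrier[of D] am ad sm ze in simp_all)
qed

end

text \<open>
  Terms over countably many generators and scalars, which make it evident that the *-algebra
  generated by a sequence over a countable dense set of scalars is countable.
\<close>

datatype star_term = Zero | Gen nat | Add star_term star_term | Mul star_term star_term
  | Adj star_term | Scale nat star_term

instance star_term :: countable
  by countable_datatype

primrec (in cstar) star_eval :: "(nat \<Rightarrow> 'a) \<Rightarrow> (nat \<Rightarrow> complex) \<Rightarrow> star_term \<Rightarrow> 'a" where
  "star_eval x q Zero = \<zero>"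
| "star_eval x q (Gen i) = x i"
| "star_eval x q (Add s t) = star_eval x q s \<oplus> star_eval x q t"
| "star_eval x q (Mul s t) = star_eval x q s \<otimes> star_eval x q t"
| "star_eval x q (Adj s) = adj A (star_eval x q s)"
| "star_eval x q (Scale i s) = q i \<odot> star_eval x q s"

lemma (in cstar) separable_subalgebra:
  fixes x :: "nat \<Rightarrow> 'a"
  assumes x: "\<And>i. x i \<in> carrier A"
  obtains D where "countable D" "D \<noteq> {}" "D \<subseteq> carrier A" "range x \<subseteq> norm_closure D"
    "cstar_subalgebra A (norm_closure D)"
proof -
  obtain Q :: "complex set" where Q: "countable Q" "\<And>S. open S \<Longrightarrow> S \<noteq> {} \<Longrightarrow> \<exists>q\<in>Q. q \<in> S"
    using countable_dense_exists by blast
  have dense: "\<exists>q\<in>Q. cmod (c - q) < e" if "e > 0" for c e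
    using Q(2)[of "ball c e"] that by (auto simp: dist_norm)
  have "Q \<noteq> {}" using dense[of 1 0] by auto
  define q where "q = from_nat_into Q"
  have range_q: "range q = Q" unfolding q_def using Q(1) \<open>Q \<noteq> {}\<close> by (rule range_from_nat_into[rotated])
  define D where "D = range (star_eval x q)"
  have Dc: "D \<subseteq> carrier A"
  proof -
    have "star_eval x q s \<in> carrier A" for s
      by (induction s) (auto simp: x)
    then show ?thesis by (auto simp: D_def)
  qed
  have D_mem: "star_eval x q s \<in> D" for s by (simp add: D_def)
  have "cstar_subalgebra A (norm_closure D)"
  proof (rule norm_closure_subalgebra[where Q = Q])
    show "\<zero> \<in> D" using D_mem[of Zero] by simp
    show "a \<oplus> b \<in> D" if "a \<in> D" "b \<in> D" for a b
      using that D_mem[of "Add _ _"] by (auto simp: D_def)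
    show "a \<otimes> b \<in> D" if "a \<in> D" "b \<in> D" for a b
      using that D_mem[of "Mul _ _"] by (auto simp: D_def)
    show "adj A a \<in> D" if "a \<in> D" for a
      using that D_mem[of "Adj _"] by (auto simp: D_def)
    show "c \<odot> a \<in> D" if "c \<in> Q" "a \<in> D" for c a
      using that D_mem[of "Scale _ _"] unfolding range_q[symmetric] by (auto simp: D_def)
  qed (use Dc dense in auto)
  moreover have "range x \<subseteq> norm_closure D"
    using norm_closure_subset[OF Dc] D_mem[of "Gen _"] by auto
  moreover have "countable D" "D \<noteq> {}" by (auto simp: D_def)
  ultimately show ?thesis using that Dc by blast
qed

text \<open>
  A point of the closure of a countable set $\{d_0, d_1, \dots\}$ is determined by the set of pairs
  $(n, m)$ with $|x - d_m| < 1/(n+1)$.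
\<close>

lemma (in cstar) norm_closure_continuum:
  assumes "countable D" "D \<noteq> {}" and D: "D \<subseteq> carrier A"
  shows "\<exists>f :: 'a \<Rightarrow> nat set. inj_on f (norm_closure D)"
proof
  define d where "d = from_nat_into D"
  have d: "range d = D" unfolding d_def using assms by (intro range_from_nat_into)
  then have dc: "d m \<in> carrier A" for m using D by auto
  define f where "f x = {prod_encode (n, m) |n m. nrm A (x \<ominus> d m) < inverse (real (Suc n))}" for x
  have f: "prod_encode (n, m) \<in> f x \<longleftrightarrow> nrm A (x \<ominus> d m) < inverse (real (Suc n))" for x n m
    by (auto simp: f_def)
  show "inj_on f (norm_closure D)"
  proof (rule inj_onI)
    fix x y assume x: "x \<in> norm_closure D" and y: "y \<in> norm_closure D" and eq: "f x = f y"
    have c: "x \<in> carrier A" "y \<in> carrier A" using x y norm_closure_carrier by auto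
    have "nrm A (x \<ominus> y) \<le> e" if "e > 0" for e
    proof -
      obtain n where n: "inverse (real (Suc n)) < e / 2" using \<open>e > 0\<close> reals_Archimedean[of "e/2"] by auto
      have "\<exists>z\<in>D. nrm A (x \<ominus> z) < inverse (real (Suc n))"
        using x unfolding norm_closure_def by (auto simp del: of_nat_Suc)
      then obtain m where m: "nrm A (x \<ominus> d m) < inverse (real (Suc n))" using d by auto
      then have "nrm A (y \<ominus> d m) < inverse (real (Suc n))" using eq f by auto
      then show ?thesis
        using m n nrm_diff_triangle[OF c(1) dc c(2), of m] nrm_diff_commute[OF dc c(2), of m] by linarith
    qed
    then have "nrm A (x \<ominus> y) \<le> 0" using field_le_epsilon[of "nrm A (x \<ominus> y)" 0] by simp
    then have "nrm A (x \<ominus> y) = 0" using nrm_nonneg[of "x \<ominus> y"] c by (metis minus_closed order_antisym)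
    then show "x = y" using c by (simp add: diff_eq_zero)
  qed
qed

section \<open>Transport of structure\<close>

text \<open>
  The copy of the C*-subalgebra \<open>S\<close> of \<open>B\<close> on the set \<open>f ` S\<close>, for \<open>f\<close> injective on \<open>S\<close>.
\<close>

definition transport :: "('b \<Rightarrow> 'c) \<Rightarrow> 'b cstar \<Rightarrow> 'b set \<Rightarrow> 'c cstar" where
  "transport f B S =
     (let g = inv_into S f in
      \<lparr>carrier = f ` S, mult = \<lambda>x y. f (g x \<otimes>\<^bsub>B\<^esub> g y), one = f \<zero>\<^bsub>B\<^esub>, zero = f \<zero>\<^bsub>B\<^esub>,
       add = \<lambda>x y. f (g x \<oplus>\<^bsub>B\<^esub> g y), smult = \<lambda>c x. f (c \<odot>\<^bsub>B\<^esub> g x),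
       adj = \<lambda>x. f (adj B (g x)), nrm = \<lambda>x. nrm B (g x)\<rparr>)"

lemma (in cstar) transport_cstar:
  fixes f :: "'a \<Rightarrow> 'c"
  assumes S: "cstar_subalgebra A S" and f: "inj_on f S"
  shows "cstar_algebra (transport f A S)" (is ?cstar)
    and "inv_into S f \<in> star_hom (transport f A S) A" (is ?hom)
proof -
  let ?C = "transport f A S"
  define g where "g = inv_into S f"
  have g [simp]: "g (f x) = x" if "x \<in> S" for x using that f by (simp add: g_def)
  have C: "carrier ?C = f ` S" "x \<otimes>\<^bsub>?C\<^esub> y = f (g x \<otimes> g y)" "x \<oplus>\<^bsub>?C\<^esub> y = f (g x \<oplus> g y)"
    "\<zero>\<^bsub>?C\<^esub> = f \<zero>" "c \<odot>\<^bsub>?C\<^esub> x = f (c \<odot> g x)" "adj ?C x = f (adj A (g x))" "nrm ?C x = nrm A (g x)" for x y c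
    by (simp_all add: transport_def g_def Let_def)
  have Sc: "x \<in> carrier A" if "x \<in> S" for x using S that by (auto simp: cstar_subalgebra_def)
  have S_closed: "\<zero> \<in> S" "x \<in> S \<Longrightarrow> y \<in> S \<Longrightarrow> x \<oplus> y \<in> S" "x \<in> S \<Longrightarrow> y \<in> S \<Longrightarrow> x \<otimes> y \<in> S"
    "x \<in> S \<Longrightarrow> c \<odot> x \<in> S" "x \<in> S \<Longrightarrow> adj A x \<in> S" for x y c
    using S by (auto simp: cstar_subalgebra_def)
  have S_minus: "\<ominus> x \<in> S" if "x \<in> S" for x using that by (simp add: minus_as_smult Sc S_closed)
  have group: "abelian_group ?C"
  proof (rule abelian_groupI)
    fix x assume "x \<in> carrier ?C"
    then obtain a where a: "a \<in> S" "x = f a" by (auto simp: C)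
    show "\<exists>y\<in>carrier ?C. y \<oplus>\<^bsub>?C\<^esub> x = \<zero>\<^bsub>?C\<^esub>"
      by (rule bexI[of _ "f (\<ominus> a)"]) (use a S_minus in \<open>auto simp: C l_neg Sc\<close>)
  qed (auto simp: C S_closed Sc a_ac)
  interpret C: abelian_group ?C by (rule group)
  have g_mem: "g x \<in> S" if "x \<in> carrier ?C" for x using that by (auto simp: C)
  have g_minus: "g (x \<ominus>\<^bsub>?C\<^esub> y) = g x \<ominus> g y"
    if xy: "x \<in> carrier ?C" "y \<in> carrier ?C" for x y
  proof -
    note mem = g_mem
    have add: "g (u \<oplus>\<^bsub>?C\<^esub> w) = g u \<oplus> g w" if "u \<in> carrier ?C" "w \<in> carrier ?C" for u w
      using that mem by (simp add: C S_closed)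
    have "g (\<ominus>\<^bsub>?C\<^esub> y) \<oplus> g y = \<zero>"
      using add[of "\<ominus>\<^bsub>?C\<^esub> y" y] xy S_closed(1) by (simp add: C.l_neg) (simp add: C)
    then have "\<ominus> g y = g (\<ominus>\<^bsub>?C\<^esub> y)"
      using mem xy C.a_inv_closed by (intro minus_equality) (auto intro!: Sc mem)
    then show "g (x \<ominus>\<^bsub>?C\<^esub> y) = g x \<ominus> g y"
      using add xy by (simp add: C.minus_eq minus_eq)
  qed
  have module: "Module.module complex_ring ?C"
  proof (rule moduleI)
    show "cring complex_ring" using cstar_module[OF cstar_algebra] by (simp add: Module.module_def)
  qed (use group in \<open>auto simp: complex_ring_def C S_closed Sc smult_add_left smult_add\<close>)
  have complete: "\<exists>l\<in>carrier ?C. (\<lambda>n. nrm ?C (X n \<ominus>\<^bsub>?C\<^esub> l)) \<longlonglongrightarrow> 0"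
    if X: "\<forall>n. X n \<in> carrier ?C" "\<forall>e>0. \<exists>N. \<forall>m\<ge>N. \<forall>n\<ge>N. nrm ?C (X m \<ominus>\<^bsub>?C\<^esub> X n) < e" for X :: "nat \<Rightarrow> 'c"
  proof -
    have "\<exists>l\<in>carrier A. (\<lambda>n. nrm A (g (X n) \<ominus> l)) \<longlonglongrightarrow> 0"
      using X g_mem by (intro complete) (auto simp: C(7) g_minus intro!: Sc)
    then obtain l where l: "l \<in> carrier A" "(\<lambda>n. nrm A (g (X n) \<ominus> l)) \<longlonglongrightarrow> 0" by blast
    have "l \<in> S"
      using S l X g_mem unfolding cstar_subalgebra_def by (auto dest: spec[of _ "\<lambda>n. g (X n)"])
    then have fl: "f l \<in> carrier ?C" by (simp add: C)
    have "nrm ?C (X n \<ominus>\<^bsub>?C\<^esub> f l) = nrm A (g (X n) \<ominus> l)" for n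
      using X(1) fl \<open>l \<in> S\<close> by (simp only: C(7) g_minus g)
    then show ?thesis using l(2) fl by (intro bexI[of _ "f l"]) simp_all
  qed
  show ?cstar
    unfolding cstar_algebra_def
    apply (intro conjI)
    subgoal by (rule module)
    subgoal by (simp add: C S_closed Sc)
    subgoal by (simp add: C S_closed Sc m_assoc l_distr r_distr)
    subgoal by (simp add: C S_closed Sc)
    subgoal by (simp add: C S_closed Sc)
    subgoal by (simp add: C S_closed Sc)
    subgoal by (simp add: C S_closed Sc)
    subgoal by (simp add: C S_closed Sc inj_on_eq_iff[OF f])
    subgoal by (simp add: C S_closed Sc)
    subgoal by (simp add: C S_closed Sc nrm_add nrm_mult)
    subgoal by (simp add: C S_closed Sc nrm_adj_mult)
    subgoal using complete by blast
    done
  show ?hom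
    unfolding g_def[symmetric] star_hom_def by (simp add: Pi_iff C S_closed Sc)
qed

lemma (in cstar) transport_inj: "inj_on f S \<Longrightarrow> inj_on (inv_into S f) (carrier (transport f A S))"
  by (auto simp: transport_def Let_def inj_on_def)

text \<open>
  Contractivity makes the equalizer closed; so a *-homomorphism is determined by its values on
  generators.
\<close>

lemma equalizer_subalgebra:
  assumes "cstar_algebra A" "cstar_algebra B" "\<phi> \<in> star_hom A B" "\<psi> \<in> star_hom A B"
  shows "cstar_subalgebra A {x \<in> carrier A. \<phi> x = \<psi> x}"
proof -
  interpret P: cstar_hom A B \<phi> using assms by unfold_locales
  interpret Q: cstar_hom A B \<psi> using assms by unfold_locales
  have lim: "P.B.converges (\<lambda>n. \<eta> (X n)) (\<eta> l)"
    if \<eta>: "\<eta> \<in> star_hom A B" and X: "\<And>n. X n \<in> carrier A" "(\<lambda>n. nrm A (X n \<ominus>\<^bsub>A\<^esub> l)) \<longlonglongrightarrow> 0" "l \<in> carrier A" for \<eta> X l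
  proof -
    interpret E: cstar_hom A B \<eta> using assms \<eta> by unfold_locales
    show ?thesis using X E.contractive[of "X _ \<ominus>\<^bsub>A\<^esub> l"] by (intro P.B.converges_bound[OF X(2)]) auto
  qed
  have "\<phi> l = \<psi> l" if X: "\<And>n. X n \<in> carrier A" "\<And>n. \<phi> (X n) = \<psi> (X n)"
    "(\<lambda>n. nrm A (X n \<ominus>\<^bsub>A\<^esub> l)) \<longlonglongrightarrow> 0" "l \<in> carrier A" for X l
    using P.B.converges_unique[OF lim[OF assms(3) X(1,3,4)]] lim[OF assms(4) X(1,3,4)] X by simp
  then show ?thesis unfolding cstar_subalgebra_def by auto
qed

section \<open>Comparing norms on powers\<close>

text \<open>
  If $b < a$ then $(b/a)^N$ decays exponentially in $N = 2^n$, faster than any polynomial grows.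
\<close>

lemma le_if_powers_le:
  fixes a b K :: real
  assumes a: "0 \<le> a" and b: "0 \<le> b"
    and le: "\<And>n. a ^ 2 ^ n \<le> K * (2 ^ n) ^ k * b ^ 2 ^ n"
  shows "a \<le> b"
proof (rule ccontr)
  assume "\<not> a \<le> b"
  then have ab: "b < a" "0 < a" using b by auto
  define r where "r = b / a"
  have r: "0 \<le> r" "r < 1" using ab b by (auto simp: r_def)
  have one: "1 \<le> K * ((2 ^ n) ^ k * r ^ 2 ^ n)" for n
    using le[of n] ab by (simp add: r_def power_divide field_simps)
  have "(\<lambda>n. real n ^ k * r ^ n) \<longlonglongrightarrow> 0"
  proof -
    define \<rho> where "\<rho> = root (Suc k) r"
    have \<rho>: "0 \<le> \<rho>" "\<rho> < 1" "\<rho> ^ Suc k = r" using r by (simp_all add: \<rho>_def real_root_pow_pos2 del: power_Suc)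
    have "(\<lambda>n. (real n * \<rho> ^ n) ^ k * \<rho> ^ n) \<longlonglongrightarrow> 0 ^ k * 0"
      using \<rho> powser_times_n_limit_0[of \<rho>] by (intro tendsto_intros LIMSEQ_power_zero) auto
    moreover have "(real n * \<rho> ^ n) ^ k * \<rho> ^ n = real n ^ k * r ^ n" for n
      by (simp add: power_mult_distrib flip: \<rho>(3) power_mult power_add) (simp add: power_mult mult.commute power_add)
    ultimately show ?thesis by simp
  qed
  moreover have "filterlim (\<lambda>n. 2 ^ n :: nat) sequentially sequentially"
    by (intro filterlim_subseq strict_monoI) simp
  ultimately have "(\<lambda>n. real (2 ^ n) ^ k * r ^ 2 ^ n) \<longlonglongrightarrow> 0"
    by (rule filterlim_compose)
  then have "(\<lambda>n. K * (real (2 ^ n) ^ k * r ^ 2 ^ n)) \<longlonglongrightarrow> K * 0" by (intro tendsto_intros)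
  then have "1 \<le> K * 0" by (rule LIMSEQ_le_const) (use one in auto)
  then show False by simp
qed

context cstar
begin

definition sq :: "'a \<Rightarrow> 'a" where "sq y = y \<otimes> y"

lemma sq_Suc: "(sq ^^ Suc n) y = (sq ^^ n) y \<otimes> (sq ^^ n) y"
  by (simp add: sq_def[of "(sq ^^ n) y"])

lemma sq_closed [simp]: "y \<in> carrier A \<Longrightarrow> (sq ^^ n) y \<in> carrier A"
  by (induction n) (auto simp: sq_Suc simp del: funpow.simps(2))

lemma adj_sq: "y \<in> carrier A \<Longrightarrow> adj A y = y \<Longrightarrow> adj A ((sq ^^ n) y) = (sq ^^ n) y"
proof (induction n)
  case (Suc n)
  then show ?case using sq_closed[of y n] by (simp add: sq_Suc del: funpow.simps(2))
qed simp

lemma nrm_sq: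
  assumes "y \<in> carrier A" "adj A y = y"
  shows "nrm A ((sq ^^ n) y) = nrm A y ^ 2 ^ n"
proof (induction n)
  case (Suc n)
  have "nrm A ((sq ^^ Suc n) y) = (nrm A ((sq ^^ n) y))\<^sup>2"
    using nrm_adj_mult[of "(sq ^^ n) y"] adj_sq[OF assms, of n] assms
    by (simp add: sq_Suc del: funpow.simps(2))
  then show ?case using Suc by (simp add: mult.commute flip: power_mult)
qed simp

end

text \<open>
  The C*-identity gives $|(x^*x)^{N}| = |x|^{2N}$ for $N = 2^n$, in the domain and for the image. So a
  norm estimate whose constant grows polynomially in $N$ improves itself to an estimate with
  constant 1.
\<close>

lemma (in cstar_hom) nrm_le_if_powers_le:
  assumes x: "x \<in> carrier A"
    and le: "\<And>n. nrm A ((A.sq ^^ n) (adj A x \<otimes>\<^bsub>A\<^esub> x)) \<le> K * (2 ^ n) ^ k * nrm B (\<phi> ((A.sq ^^ n) (adj A x \<otimes>\<^bsub>A\<^esub> x)))"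
  shows "nrm A x \<le> nrm B (\<phi> x)"
proof -
  let ?h = "adj A x \<otimes>\<^bsub>A\<^esub> x"
  have sq: "\<phi> ((A.sq ^^ n) y) = (B.sq ^^ n) (\<phi> y)" if "y \<in> carrier A" for n y
    
    using that A.sq_closed by (induction n) (simp_all add: A.sq_Suc B.sq_Suc del: funpow.simps(2))
  have "(nrm A x)\<^sup>2 \<le> (nrm B (\<phi> x))\<^sup>2"
  proof (rule le_if_powers_le)
    fix n
    have "nrm A ((A.sq ^^ n) ?h) = (nrm A x)\<^sup>2 ^ 2 ^ n"
      using x by (subst A.nrm_sq) (auto simp: A.nrm_adj_mult)
    moreover have "nrm B (\<phi> ((A.sq ^^ n) ?h)) = (nrm B (\<phi> x))\<^sup>2 ^ 2 ^ n"
      using x by (subst sq) (auto simp: B.nrm_sq B.nrm_adj_mult)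
    ultimately show "(nrm A x)\<^sup>2 ^ 2 ^ n \<le> K * (2 ^ n) ^ k * (nrm B (\<phi> x))\<^sup>2 ^ 2 ^ n"
      using le[of n] by simp
  qed auto
  then show ?thesis using x by (simp add: power2_le_iff_abs_le)
qed

section \<open>Spectral components of torus actions\<close>

definition deg_box :: "nat \<Rightarrow> ('k::finite \<Rightarrow> int) set" where
  "deg_box N = PiE UNIV (\<lambda>_. {- int N..int N})"

lemma mem_deg_box: "m \<in> deg_box N \<longleftrightarrow> (\<forall>i. \<bar>m i\<bar> \<le> int N)"
  by (auto simp: deg_box_def PiE_UNIV_domain Pi_iff abs_le_iff) (meson le_minus_iff minus_le_iff)+

lemma deg_box_mono: "M \<le> N \<Longrightarrow> deg_box M \<subseteq> deg_box N"
  unfolding subset_iff mem_deg_box by (meson of_nat_mono order_trans)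

lemma uminus_deg_box: "uminus ` deg_box N = (deg_box N :: ('k::finite \<Rightarrow> int) set)"
proof -
  have "m \<in> uminus ` deg_box N" if "m \<in> deg_box N" for m :: "'k \<Rightarrow> int"
    using that by (intro image_eqI[of _ _ "- m"]) (auto simp: mem_deg_box)
  moreover have "- m \<in> deg_box N" if "m \<in> deg_box N" for m :: "'k \<Rightarrow> int"
    using that by (simp add: mem_deg_box)
  ultimately show ?thesis by blast
qed

lemma finite_deg_box [simp]: "finite (deg_box N)"
  by (simp add: deg_box_def finite_PiE)

lemma card_deg_box: "card (deg_box N :: ('k::finite \<Rightarrow> int) set) = (2 * N + 1) ^ CARD('k)"
  by (simp add: deg_box_def card_PiE nat_add_distrib nat_mult_distrib)

definition torus_char :: "('k::finite \<Rightarrow> int) \<Rightarrow> complex ^ 'k \<Rightarrow> complex" where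
  "torus_char m z = (\<Prod>i\<in>UNIV. (z $ i) powi m i)"

lemma root_of_unity_sum:
  fixes j :: int
  assumes "\<bar>j\<bar> < int L"
  shows "(\<Sum>r<L. (cis (2 * pi / real L) powi j) ^ r) = (if j = 0 then of_nat L else 0)"
proof (cases "j = 0")
  case False
  let ?w = "cis (2 * pi / real L) powi j"
  have L: "L > 0" using assms by linarith
  have w: "?w = cis (2 * pi * real_of_int j / real L)" by (simp add: cis_power_int mult_ac)
  have "?w \<noteq> 1"
  proof
    assume "?w = 1"
    then have "cis (2 * pi * real_of_int j / real L) = 1" using w by simp
    then obtain n :: int where
      "Im (\<i> * complex_of_real (2 * pi * real_of_int j / real L)) = of_int (2 * n) * pi"
      unfolding cis_conv_exp exp_eq_1 by blast
    then have "2 * pi * real_of_int j / real L = 2 * pi * real_of_int n" by simp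
    then have "real_of_int j = real_of_int (n * int L)" using L by (simp add: field_simps)
    then have j: "j = n * int L" by linarith
    then have "n \<noteq> 0" using False by auto
    then have "1 * int L \<le> \<bar>n\<bar> * int L" by (intro mult_right_mono) auto
    then show False using assms j by (simp add: abs_mult)
  qed
  moreover have "?w ^ L = 1"
  proof -
    have "?w ^ L = cis (real L * (2 * pi * real_of_int j / real L))" unfolding w by (rule Complex.DeMoivre)
    also have "real L * (2 * pi * real_of_int j / real L) = 2 * pi * real_of_int j" using L by simp
    also have "cis (2 * pi * real_of_int j) = 1" by (intro cis_multiple_2pi) simp
    finally show ?thesis .
  qed
  ultimately show ?thesis using False by (simp add: geometric_sum)
qed simp

text \<open>
  The component of degree $m$ of $x$ is the average over the $k$-tuples $z$ of $L$-th roots of unity of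
  $z^{-m} \theta_z(x)$, hence no larger than $x$. A finite group suffices because the degrees of $x$ lie
  in a box, in which no two of them agree modulo $L$ in every coordinate.
\<close>

lemma (in cstar) spectral_component_nrm_le:
  fixes \<theta> :: "complex ^ 'k::finite \<Rightarrow> 'a \<Rightarrow> 'a" and b :: "('k \<Rightarrow> int) \<Rightarrow> 'a"
  assumes \<theta>: "\<And>z. z \<in> torus \<Longrightarrow> \<theta> z \<in> star_hom A A"
    and b: "\<And>p. p \<in> deg_box N \<Longrightarrow> b p \<in> carrier A"
    and eig: "\<And>p z. p \<in> deg_box N \<Longrightarrow> z \<in> torus \<Longrightarrow> \<theta> z (b p) = torus_char p z \<odot> b p"
    and m: "m \<in> deg_box N"
  shows "nrm A (b m) \<le> nrm A (finsum A b (deg_box N))"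
proof -
  \<comment> \<open>Two coordinates of points of the box differ by at most \<open>2 * N\<close>, hence by less than \<open>L\<close>.\<close>
  define L where "L = 2 * N + 1"
  define \<omega> where "\<omega> = cis (2 * pi / real L)"
  define J :: "('k \<Rightarrow> nat) set" where "J = PiE UNIV (\<lambda>_. {..<L})"
  define z :: "('k \<Rightarrow> nat) \<Rightarrow> complex ^ 'k" where "z r = (\<chi> i. \<omega> ^ r i)" for r
  define c where "c r = torus_char (\<lambda>i. - m i) (z r)" for r
  have J: "finite J" "card J = L ^ CARD('k)" by (simp_all add: J_def finite_PiE card_PiE)
  have \<omega>: "\<omega> \<noteq> 0" "cmod \<omega> = 1" by (simp_all add: \<omega>_def)
  have z: "z r \<in> torus" for r by (simp add: torus_def z_def norm_power \<omega>)
  have c_norm: "cmod (c r) = 1" for r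
    by (simp add: c_def torus_char_def z_def norm_power_int norm_power \<omega> prod_norm[symmetric])
  have coeff: "(\<Sum>r\<in>J. c r * torus_char p (z r)) = (if p = m then of_nat (L ^ CARD('k)) else 0)"
    if p: "p \<in> deg_box N" for p
  proof -
    have "(\<Sum>r\<in>J. c r * torus_char p (z r)) = (\<Sum>r\<in>J. \<Prod>i\<in>UNIV. (\<omega> powi (p i - m i)) ^ r i)"
    proof (rule sum.cong)
      fix r
      have "(\<omega> ^ r i) powi (- m i) * (\<omega> ^ r i) powi p i = (\<omega> powi (p i - m i)) ^ r i" for i
      proof -
        have "(\<omega> ^ r i) powi (- m i) * (\<omega> ^ r i) powi p i = (\<omega> ^ r i) powi (p i - m i)"
          using \<omega> by (subst power_int_add[symmetric]) auto
        also have "\<dots> = \<omega> powi (int (r i) * (p i - m i))"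
          by (simp add: power_int_mult)
        also have "\<dots> = (\<omega> powi (p i - m i)) ^ r i"
          by (simp add: power_int_mult mult.commute[of "int (r i)"])
        finally show ?thesis .
      qed
      then show "c r * torus_char p (z r) = (\<Prod>i\<in>UNIV. (\<omega> powi (p i - m i)) ^ r i)"
        by (simp add: c_def torus_char_def z_def flip: prod.distrib)
    qed simp
    also have "\<dots> = (\<Prod>i\<in>UNIV. \<Sum>r<L. (\<omega> powi (p i - m i)) ^ r)"
      unfolding J_def by (subst prod_sum_PiE) auto
    also have "\<dots> = (\<Prod>i\<in>UNIV. if p i = m i then of_nat L else 0)"
    proof (rule prod.cong)
      fix i
      have "\<bar>p i\<bar> \<le> int N" "\<bar>m i\<bar> \<le> int N" using p m by (auto simp: mem_deg_box)
      then have "\<bar>p i - m i\<bar> < int L" by (simp add: L_def)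
      then show "(\<Sum>r<L. (\<omega> powi (p i - m i)) ^ r) = (if p i = m i then of_nat L else 0)"
        unfolding \<omega>_def by (subst root_of_unity_sum) auto
    qed simp
    also have "\<dots> = (if p = m then of_nat (L ^ CARD('k)) else 0)"
      by (auto simp: fun_eq_iff)
    finally show ?thesis .
  qed
  \<comment> \<open>The unnormalised average: it multiplies the component of degree \<open>m\<close> by \<open>L ^ CARD('k)\<close> and kills the others.\<close>
  define \<Phi> where "\<Phi> x = finsum A (\<lambda>r. c r \<odot> \<theta> (z r) x) J" for x
  have hom: "cstar_hom A A (\<theta> (z r))" for r by unfold_locales (rule \<theta>[OF z])
  note hom_rules = cstar_hom.hom_closed[OF hom] cstar_hom.hom_add[OF hom]
  have \<Phi>_closed: "\<Phi> x \<in> carrier A" if "x \<in> carrier A" for x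
    unfolding \<Phi>_def using that hom_rules by (intro finsum_closed) auto
  have \<Phi>_add: "\<Phi> (x \<oplus> y) = \<Phi> x \<oplus> \<Phi> y" if "x \<in> carrier A" "y \<in> carrier A" for x y
    unfolding \<Phi>_def using that hom_rules
    by (subst finsum_addf[symmetric]) (auto intro!: finsum_cong' simp: smult_add)
  have \<Phi>_b: "\<Phi> (b p) = (if p = m then of_nat (L ^ CARD('k)) \<odot> b m else \<zero>)" if p: "p \<in> deg_box N" for p
  proof -
    have "\<Phi> (b p) = finsum A (\<lambda>r. (c r * torus_char p (z r)) \<odot> b p) J"
      unfolding \<Phi>_def using p b eig z by (intro finsum_cong') auto
    also have "\<dots> = (\<Sum>r\<in>J. c r * torus_char p (z r)) \<odot> b p"
      using b[OF p] J by (intro finsum_smult_const) auto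
    finally show ?thesis using coeff[OF p] b p by simp
  qed
  let ?x = "finsum A b (deg_box N)"
  have x: "?x \<in> carrier A" using b by (intro finsum_closed) auto
  have "\<Phi> ?x = finsum A (\<lambda>p. \<Phi> (b p)) (deg_box N)"
    using b by (intro additive_finsum abelian_group_axioms \<Phi>_closed \<Phi>_add) auto
  also have "\<dots> = \<Phi> (b m)"
    using m b \<Phi>_b \<Phi>_closed by (intro finsum_only) auto
  finally have "\<Phi> ?x = of_nat (L ^ CARD('k)) \<odot> b m" using \<Phi>_b[OF m] by simp
  then have "real (L ^ CARD('k)) * nrm A (b m) = nrm A (\<Phi> ?x)" using b[OF m] by (simp add: norm_power)
  also have "\<dots> \<le> (\<Sum>r\<in>J. nrm A (c r \<odot> \<theta> (z r) ?x))"
    unfolding \<Phi>_def using J hom_rules x by (intro nrm_finsum) auto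
  also have "\<dots> \<le> (\<Sum>r\<in>J. nrm A ?x)"
    using cstar_hom.contractive[OF hom x] hom_rules x by (intro sum_mono) (simp add: c_norm)
  also have "\<dots> = real (L ^ CARD('k)) * nrm A ?x" using J by simp
  finally show ?thesis by (simp add: L_def)
qed

section \<open>Factorisation in k-graphs\<close>

lemma deg_join_nth [simp]: "deg_join m n $ i = max (m $ i) (n $ i)"
  by (simp add: deg_join_def)

lemma deg_le_iff_add: "(m :: nat ^ 'k::finite) \<le> n \<longleftrightarrow> (\<exists>l. n = m + l)"
proof
  assume "m \<le> n"
  then have "n = m + (n - m)" by (simp add: less_eq_vec_def vec_eq_iff)
  then show "\<exists>l. n = m + l" by blast
qed (auto simp: less_eq_vec_def)

lemma deg_le_join: "m \<le> deg_join m n" "n \<le> deg_join m n"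
  by (auto simp: less_eq_vec_def)

lemma deg_join_least: "m \<le> l \<Longrightarrow> n \<le> l \<Longrightarrow> deg_join m n \<le> l"
  by (auto simp: less_eq_vec_def)

lemma deg_join_commute: "deg_join m n = deg_join n m"
  by (auto simp: vec_eq_iff)

definition deg_size :: "nat ^ 'k::finite \<Rightarrow> nat" where
  "deg_size n = (\<Sum>i\<in>UNIV. n $ i)"

lemma deg_size_add [simp]: "deg_size (m + n) = deg_size m + deg_size n"
  by (simp add: deg_size_def sum.distrib)

lemma deg_size_eq_0 [simp]: "deg_size n = 0 \<longleftrightarrow> n = 0"
  by (auto simp: deg_size_def vec_eq_iff)

locale fa_kgraph =
  fixes \<Lambda> :: "('p, 'k::finite) kgraph"
  assumes k_graph: "k_graph \<Lambda>" and finitely_aligned: "finitely_aligned \<Lambda>"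
begin

abbreviation "P \<equiv> paths \<Lambda>"
abbreviation "cod \<equiv> rng \<Lambda>"
abbreviation "dmn \<equiv> src \<Lambda>"
abbreviation "deg \<equiv> dg \<Lambda>"
abbreviation comp (infixr \<open>\<cdot>\<close> 75) where "\<kappa> \<cdot> \<mu> \<equiv> cmp \<Lambda> \<kappa> \<mu>"

lemma path_simps [simp]:
  assumes "\<kappa> \<in> P"
  shows "cod \<kappa> \<in> P" "dmn \<kappa> \<in> P" 
    and "cod (cod \<kappa>) = cod \<kappa>" "dmn (cod \<kappa>) = cod \<kappa>" "cod (dmn \<kappa>) = dmn \<kappa>" "dmn (dmn \<kappa>) = dmn \<kappa>"
    "cod \<kappa> \<cdot> \<kappa> = \<kappa>" "\<kappa> \<cdot> dmn \<kappa> = \<kappa>" "deg (cod \<kappa>) = 0" "deg (dmn \<kappa>) = 0"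
  using assms k_graph unfolding k_graph_def is_category_def by simp_all

lemma comp_simps [simp]:
  assumes "\<kappa> \<in> P" "\<mu> \<in> P" "dmn \<kappa> = cod \<mu>"
  shows "\<kappa> \<cdot> \<mu> \<in> P" "cod (\<kappa> \<cdot> \<mu>) = cod \<kappa>" "dmn (\<kappa> \<cdot> \<mu>) = dmn \<mu>" "deg (\<kappa> \<cdot> \<mu>) = deg \<kappa> + deg \<mu>"
  using assms k_graph unfolding k_graph_def is_category_def by simp_all

lemma comp_assoc [simp]:
  assumes "\<kappa> \<in> P" "\<mu> \<in> P" "\<nu> \<in> P" "dmn \<kappa> = cod \<mu>" "dmn \<mu> = cod \<nu>"
  shows "(\<kappa> \<cdot> \<mu>) \<cdot> \<nu> = \<kappa> \<cdot> (\<mu> \<cdot> \<nu>)"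
  using assms k_graph unfolding k_graph_def is_category_def by simp

lemma factor_ex1:
  "\<kappa> \<in> P \<Longrightarrow> deg \<kappa> = m + n \<Longrightarrow>
    \<exists>!(\<mu>, \<nu>). \<mu> \<in> P \<and> \<nu> \<in> P \<and> deg \<mu> = m \<and> deg \<nu> = n \<and> dmn \<mu> = cod \<nu> \<and> \<kappa> = \<mu> \<cdot> \<nu>"
  using k_graph unfolding k_graph_def by blast

lemma factor:
  assumes "\<kappa> \<in> P" "m \<le> deg \<kappa>"
  obtains \<mu> \<nu> where "\<mu> \<in> P" "\<nu> \<in> P" "deg \<mu> = m" "dmn \<mu> = cod \<nu>" "\<kappa> = \<mu> \<cdot> \<nu>"
proof -
  obtain n where "deg \<kappa> = m + n" using assms(2) unfolding deg_le_iff_add by blast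
  from ex1_implies_ex[OF factor_ex1[OF assms(1) this]] show ?thesis using that by blast
qed

lemma factor_unique:
  assumes "\<mu> \<in> P" "\<nu> \<in> P" "dmn \<mu> = cod \<nu>" "\<mu>' \<in> P" "\<nu>' \<in> P" "dmn \<mu>' = cod \<nu>'"
    and "\<mu> \<cdot> \<nu> = \<mu>' \<cdot> \<nu>'" "deg \<mu> = deg \<mu>'"
  shows "\<mu> = \<mu>' \<and> \<nu> = \<nu>'"
proof -
  have "deg \<nu> = deg \<nu>'" using assms by (metis add_left_cancel comp_simps(4))
  then obtain p where p: "\<And>\<mu>' \<nu>'. \<mu>' \<in> P \<and> \<nu>' \<in> P \<and> deg \<mu>' = deg \<mu> \<and> deg \<nu>' = deg \<nu> \<and>
      dmn \<mu>' = cod \<nu>' \<and> \<mu> \<cdot> \<nu> = \<mu>' \<cdot> \<nu>' \<Longrightarrow> (\<mu>', \<nu>') = p"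
    using factor_ex1[of "\<mu> \<cdot> \<nu>" "deg \<mu>" "deg \<nu>"] assms(1-3) by (auto elim!: ex1E)
  have "(\<mu>, \<nu>) = p" "(\<mu>', \<nu>') = p" using assms \<open>deg \<nu> = deg \<nu>'\<close> by (auto intro!: p)
  then show ?thesis by auto
qed

lemma comp_cancel:
  assumes "\<mu> \<in> P" "\<nu> \<in> P" "\<nu>' \<in> P" "dmn \<mu> = cod \<nu>" "dmn \<mu> = cod \<nu>'" 
  shows "\<mu> \<cdot> \<nu> = \<mu> \<cdot> \<nu>' \<longleftrightarrow> \<nu> = \<nu>'"
  using factor_unique[of \<mu> \<nu> \<mu> \<nu>'] assms by auto

lemma deg_0:
  assumes "v \<in> P" "deg v = 0"
  shows "cod v = v" "dmn v = v"
  using factor_unique[of "cod v" v v "dmn v"] assms by auto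

lemma cod_vertex [simp]: "\<kappa> \<in> P \<Longrightarrow> cod \<kappa> \<in> vertices \<Lambda>"
  and dmn_vertex [simp]: "\<kappa> \<in> P \<Longrightarrow> dmn \<kappa> \<in> vertices \<Lambda>"
  by (simp_all add: vertices_def)

lemma segment_initial:
  assumes "\<mu> \<in> P" "\<nu> \<in> P" "dmn \<mu> = cod \<nu>"
  shows "segment \<Lambda> (\<mu> \<cdot> \<nu>) 0 (deg \<mu>) = \<mu>"
  unfolding segment_def
proof (rule the_equality, goal_cases)
  case 1
  have d: "deg \<mu> - 0 = deg \<mu>" "deg \<mu> + deg \<nu> - deg \<mu> = deg \<nu>" by (simp_all add: vec_eq_iff)
  have "\<mu> \<cdot> \<nu> = cod \<mu> \<cdot> \<mu> \<cdot> \<nu>" using assms by (metis comp_simps(1,2) path_simps(7))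
  then have "\<exists>\<mu>'\<in>P. \<exists>\<rho>\<in>P. deg \<mu>' = 0 \<and> deg \<rho> = deg (\<mu> \<cdot> \<nu>) - deg \<mu> \<and>
      dmn \<mu>' = cod \<mu> \<and> dmn \<mu> = cod \<rho> \<and> \<mu> \<cdot> \<nu> = \<mu>' \<cdot> \<mu> \<cdot> \<rho>"
    by (intro bexI[of _ "cod \<mu>" P] bexI[of _ \<nu> P] conjI) (simp_all only: assms d comp_simps path_simps)
  then show ?case using assms d by metis
next
  case (2 \<mu>')
  then obtain v \<rho> where *: "\<mu>' \<in> P" "deg \<mu>' = deg \<mu>" "v \<in> P" "\<rho> \<in> P" "deg v = 0" "dmn v = cod \<mu>'"
    "dmn \<mu>' = cod \<rho>" "\<mu> \<cdot> \<nu> = v \<cdot> \<mu>' \<cdot> \<rho>" 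
    by (auto simp: vec_eq_iff)
  then have "v = cod (\<mu>' \<cdot> \<rho>)" using deg_0 by simp
  then have "\<mu> \<cdot> \<nu> = \<mu>' \<cdot> \<rho>" using * by (metis comp_simps(1) path_simps(7))
  then show ?case using factor_unique[of \<mu> \<nu> \<mu>' \<rho>] * assms by simp
qed

definition extends :: "'p \<Rightarrow> 'p \<Rightarrow> bool" where
  "extends \<mu> \<kappa> \<longleftrightarrow> (\<exists>\<alpha>\<in>P. dmn \<mu> = cod \<alpha> \<and> \<kappa> = \<mu> \<cdot> \<alpha>)"

text \<open>
  This replaces the segments in the definitions of common extensions by compositions.
\<close>

lemma segment_initial_iff:
  assumes "\<kappa> \<in> P" "\<mu> \<in> P" "deg \<mu> \<le> deg \<kappa>"
  shows "segment \<Lambda> \<kappa> 0 (deg \<mu>) = \<mu> \<longleftrightarrow> extends \<mu> \<kappa>"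
proof -
  obtain \<mu>' \<nu> where *: "\<mu>' \<in> P" "\<nu> \<in> P" "deg \<mu>' = deg \<mu>" "dmn \<mu>' = cod \<nu>" "\<kappa> = \<mu>' \<cdot> \<nu>"
    using factor[OF assms(1,3)] by metis
  have "segment \<Lambda> \<kappa> 0 (deg \<mu>) = \<mu>'" using segment_initial[OF *(1,2,4)] * by simp
  then show ?thesis using * assms segment_initial unfolding extends_def by metis
qed

lemma extends_deg_le: "\<mu> \<in> P \<Longrightarrow> extends \<mu> \<kappa> \<Longrightarrow> deg \<mu> \<le> deg \<kappa>"
  by (auto simp: extends_def deg_le_iff_add)

lemma MCE_iff:
  assumes "\<mu> \<in> P" "\<nu> \<in> P"
  shows "\<kappa> \<in> MCE \<Lambda> \<mu> \<nu> \<longleftrightarrow>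
    \<kappa> \<in> P \<and> deg \<kappa> = deg_join (deg \<mu>) (deg \<nu>) \<and> extends \<mu> \<kappa> \<and> extends \<nu> \<kappa>"
  unfolding MCE_def mem_Collect_eq
  using segment_initial_iff[of \<kappa> \<mu>] segment_initial_iff[of \<kappa> \<nu>] assms
    deg_le_join[where m = "deg \<mu>" and n = "deg \<nu>"]
  by auto

lemma lambda_min_iff:
  assumes "\<mu> \<in> P" "\<nu> \<in> P"
  shows "(\<alpha>, \<beta>) \<in> lambda_min \<Lambda> \<mu> \<nu> \<longleftrightarrow> \<alpha> \<in> P \<and> \<beta> \<in> P \<and> dmn \<mu> = cod \<alpha> \<and> dmn \<nu> = cod \<beta> \<and>
    \<mu> \<cdot> \<alpha> = \<nu> \<cdot> \<beta> \<and> deg \<mu> + deg \<alpha> = deg_join (deg \<mu>) (deg \<nu>)"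
proof -
  have "\<mu> \<cdot> \<alpha> \<in> MCE \<Lambda> \<mu> \<nu> \<longleftrightarrow> deg \<mu> + deg \<alpha> = deg_join (deg \<mu>) (deg \<nu>)"
    if c: "\<alpha> \<in> P" "\<beta> \<in> P" "dmn \<mu> = cod \<alpha>" "dmn \<nu> = cod \<beta>" "\<mu> \<cdot> \<alpha> = \<nu> \<cdot> \<beta>"
  proof -
    have "extends \<mu> (\<mu> \<cdot> \<alpha>)" using c by (auto simp: extends_def)
    moreover have "extends \<nu> (\<mu> \<cdot> \<alpha>)" unfolding c(5) using c by (auto simp: extends_def)
    ultimately show ?thesis unfolding MCE_iff[OF assms] using comp_simps[OF assms(1) c(1,3)] by simp
  qed
  then show ?thesis unfolding lambda_min_def by blast
qed

lemma lambda_min_src: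
  assumes "\<mu> \<in> P" "\<nu> \<in> P" "(\<alpha>, \<beta>) \<in> lambda_min \<Lambda> \<mu> \<nu>"
  shows "dmn \<alpha> = dmn \<beta>"
  using assms by (metis comp_simps(3) lambda_min_iff)

lemma finite_lambda_min [simp]:
  assumes "\<mu> \<in> P" "\<nu> \<in> P"
  shows "finite (lambda_min \<Lambda> \<mu> \<nu>)"
proof (rule inj_on_finite[of "\<lambda>(\<alpha>, \<beta>). \<mu> \<cdot> \<alpha>"])
  show "inj_on (\<lambda>(\<alpha>, \<beta>). \<mu> \<cdot> \<alpha>) (lambda_min \<Lambda> \<mu> \<nu>)"
    using assms by (auto simp: inj_on_def lambda_min_iff) (metis comp_cancel)+
  show "(\<lambda>(\<alpha>, \<beta>). \<mu> \<cdot> \<alpha>) ` lambda_min \<Lambda> \<mu> \<nu> \<subseteq> MCE \<Lambda> \<mu> \<nu>" by (auto simp: lambda_min_def)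
  show "finite (MCE \<Lambda> \<mu> \<nu>)" using finitely_aligned assms by (simp add: finitely_aligned_def)
qed

lemma lambda_min_swap:
  assumes "\<mu> \<in> P" "\<nu> \<in> P" and l: "(\<alpha>, \<beta>) \<in> lambda_min \<Lambda> \<mu> \<nu>"
  shows "(\<beta>, \<alpha>) \<in> lambda_min \<Lambda> \<nu> \<mu>"
proof -
  note * = l[unfolded lambda_min_iff[OF assms(1,2)]]
  have "deg \<nu> + deg \<beta> = deg \<mu> + deg \<alpha>" using * assms(1,2) by (metis comp_simps(4))
  then show ?thesis
    unfolding lambda_min_iff[OF assms(2,1)] using * by (simp add: deg_join_commute)
qed

lemma lambda_min_extension:
  assumes "\<mu> \<in> P" "\<nu> \<in> P" "dmn \<mu> = cod \<nu>"
  shows "lambda_min \<Lambda> \<mu> (\<mu> \<cdot> \<nu>) = {(\<nu>, dmn \<nu>)}"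
proof -
  have "deg_join (deg \<mu>) (deg \<mu> + deg \<nu>) = deg \<mu> + deg \<nu>" by (simp add: vec_eq_iff)
  then have iff: "(\<alpha>, \<beta>) \<in> lambda_min \<Lambda> \<mu> (\<mu> \<cdot> \<nu>) \<longleftrightarrow> \<alpha> \<in> P \<and> \<beta> \<in> P \<and> dmn \<mu> = cod \<alpha> \<and> dmn \<nu> = cod \<beta> \<and>
      \<mu> \<cdot> \<alpha> = (\<mu> \<cdot> \<nu>) \<cdot> \<beta> \<and> deg \<alpha> = deg \<nu>" for \<alpha> \<beta>
    using assms by (subst lambda_min_iff) auto
  have only: "\<alpha> = \<nu> \<and> \<beta> = dmn \<nu>" if "(\<alpha>, \<beta>) \<in> lambda_min \<Lambda> \<mu> (\<mu> \<cdot> \<nu>)" for \<alpha> \<beta>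
  proof -
    note * = that[unfolded iff]
    then have "deg \<mu> + deg \<nu> = deg \<mu> + deg \<nu> + deg \<beta>"
      using assms by (metis comp_simps(1,3,4))
    then have "deg \<beta> = 0" by (metis add_cancel_left_right)
    then have \<beta>: "\<beta> = dmn \<nu>" using deg_0 * by metis
    then have "\<mu> \<cdot> \<alpha> = \<mu> \<cdot> \<nu>" using * assms by (metis comp_simps(1,3) path_simps(8))
    then show ?thesis using \<beta> * assms comp_cancel by blast
  qed
  have mem: "(\<nu>, dmn \<nu>) \<in> lambda_min \<Lambda> \<mu> (\<mu> \<cdot> \<nu>)"
    unfolding iff using assms by simp
  show ?thesis
  proof (intro equalityI subsetI)
    fix p assume "p \<in> lambda_min \<Lambda> \<mu> (\<mu> \<cdot> \<nu>)"
    then show "p \<in> {(\<nu>, dmn \<nu>)}" using only[of "fst p" "snd p"] by (simp add: prod_eq_iff)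
  qed (use mem in simp)
qed

lemma lambda_min_self: "\<mu> \<in> P \<Longrightarrow> lambda_min \<Lambda> \<mu> \<mu> = {(dmn \<mu>, dmn \<mu>)}"
  using lambda_min_extension[of \<mu> "dmn \<mu>"] by simp


lemma initial_segment_le:
  assumes "\<mu> \<in> P" "\<alpha> \<in> P" "dmn \<mu> = cod \<alpha>" "\<rho> \<in> P" "\<kappa> \<in> P" "dmn \<rho> = cod \<kappa>"
    and "\<mu> \<cdot> \<alpha> = \<rho> \<cdot> \<kappa>" "deg \<mu> \<le> deg \<rho>"
  obtains \<gamma> where "\<gamma> \<in> P" "dmn \<mu> = cod \<gamma>" "\<rho> = \<mu> \<cdot> \<gamma>" "dmn \<gamma> = cod \<kappa>" "\<alpha> = \<gamma> \<cdot> \<kappa>"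
proof -
  obtain \<mu>' \<gamma> where *: "\<mu>' \<in> P" "\<gamma> \<in> P" "deg \<mu>' = deg \<mu>" "dmn \<mu>' = cod \<gamma>" "\<rho> = \<mu>' \<cdot> \<gamma>"
    using factor[OF assms(4,8)] by metis
  have d: "dmn \<gamma> = cod \<kappa>" using * assms(6) by simp
  have "\<mu> \<cdot> \<alpha> = \<mu>' \<cdot> (\<gamma> \<cdot> \<kappa>)" using * assms d by simp
  then have "\<mu> = \<mu>' \<and> \<alpha> = \<gamma> \<cdot> \<kappa>"
    using * assms(1-5) d by (intro factor_unique) auto
  then show ?thesis using that * d by metis
qed

section \<open>Closing a finite set of paths\<close>

text \<open>
  The paths that occur when elements $s_\kappa s_\mu^*$ of degree zero are multiplied: the product of
  $s_\kappa s_\mu^*$ and $s_\sigma s_\tau^*$ is a sum of terms that begin with $s_{\kappa\alpha}$.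
\<close>

inductive_set path_closure :: "'p set \<Rightarrow> 'p set" for E where
  base: "\<xi> \<in> E \<Longrightarrow> \<xi> \<in> path_closure E"
| step: "\<kappa> \<in> path_closure E \<Longrightarrow> \<mu> \<in> path_closure E \<Longrightarrow> \<sigma> \<in> path_closure E \<Longrightarrow>
    deg \<kappa> = deg \<mu> \<Longrightarrow> dmn \<kappa> = dmn \<mu> \<Longrightarrow> (\<alpha>, \<beta>) \<in> lambda_min \<Lambda> \<mu> \<sigma> \<Longrightarrow> \<kappa> \<cdot> \<alpha> \<in> path_closure E"

lemma path_closure_paths:
  assumes E: "E \<subseteq> P" and "\<xi> \<in> path_closure E"
  shows "\<xi> \<in> P"
  using assms(2) by induction (use E in \<open>auto simp: lambda_min_iff\<close>)

lemma path_closure_deg_bound: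
  assumes E: "E \<subseteq> P" and N: "\<And>\<xi>. \<xi> \<in> E \<Longrightarrow> deg \<xi> \<le> N" and "\<xi> \<in> path_closure E"
  shows "deg \<xi> \<le> N"
  using assms(3)
proof induction
  case (step \<kappa> \<mu> \<sigma> \<alpha> \<beta>)
  note P = path_closure_paths[OF E]
  have "deg (\<kappa> \<cdot> \<alpha>) = deg_join (deg \<mu>) (deg \<sigma>)"
    using step lambda_min_iff[OF P P] P by auto
  then show ?case using step deg_join_least by metis
qed (rule N)

text \<open>
  Degrees do not grow beyond the join of the degrees in \<open>E\<close>, so it is enough to bound the number of
  paths of each length \<open>L\<close>, where the length is the sum of the coordinates of the degree. Given the
  finite set \<open>S\<close> of shorter paths in the closure, the paths of length \<open>L\<close> that belong to \<open>E\<close> or are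
  formed from three paths in \<open>S\<close> form a finite set \<open>Base\<close>. Every other path of length \<open>L\<close> arises
  from these by replacing an initial segment \<open>\<sigma> \<in> S\<close> by some \<open>\<tau> \<in> S\<close> of the same degree and source;
  the point is that a single replacement suffices. Indeed, let \<open>\<tau> \<cdot> \<beta>'\<close> result from one
  replacement, and let \<open>\<mu>\<close> be the initial segment of it that is to be replaced next. If the join of
  the degrees of \<open>\<mu>\<close> and \<open>\<tau>\<close> is the full degree, then the result lies in \<open>Base\<close>; otherwise the
  initial segment of that degree is shorter than \<open>L\<close>, and both replacements can be performed inside
  \<open>S\<close>, which makes them a single one.
\<close>

lemma finite_path_closure:
  assumes E: "E \<subseteq> P" "finite E"
  shows "finite (path_closure E)"
proof -
  note P = path_closure_paths[OF E(1)]
  let ?C = "path_closure E"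
  have fin: "finite {\<xi> \<in> ?C. deg_size (deg \<xi>) < L}" for L
  proof (induction L)
    case (Suc L)
    define S where "S = {\<xi> \<in> ?C. deg_size (deg \<xi>) < L}"
    define Base where "Base = E \<union> (\<Union>\<kappa>\<in>S. \<Union>\<mu>\<in>S. \<Union>\<sigma>\<in>S. (\<lambda>(\<alpha>, \<beta>). \<kappa> \<cdot> \<alpha>) ` lambda_min \<Lambda> \<mu> \<sigma>)"
    define Repl where "Repl = (\<Union>b\<in>Base. \<Union>\<sigma>\<in>S. \<Union>\<tau>\<in>S.
        {\<tau> \<cdot> \<beta> |\<beta>. \<beta> \<in> P \<and> dmn \<sigma> = cod \<beta> \<and> \<sigma> \<cdot> \<beta> = b \<and> dmn \<tau> = dmn \<sigma> \<and> deg \<tau> = deg \<sigma>})"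
    have SC: "\<xi> \<in> ?C" "\<xi> \<in> P" if "\<xi> \<in> S" for \<xi> using that P by (auto simp: S_def)
    have "finite S" using Suc by (simp add: S_def)
    have "finite Base" unfolding Base_def
      using E(2) \<open>finite S\<close> SC by (intro finite_UnI finite_UN_I finite_imageI finite_lambda_min)
    have one: "finite {\<tau> \<cdot> \<beta> |\<beta>. \<beta> \<in> P \<and> dmn \<sigma> = cod \<beta> \<and> \<sigma> \<cdot> \<beta> = b \<and> dmn \<tau> = dmn \<sigma> \<and> deg \<tau> = deg \<sigma>}"
      if "\<sigma> \<in> S" for \<sigma> \<tau> b
    proof (rule finite_subset)
      show "{\<tau> \<cdot> \<beta> |\<beta>. \<beta> \<in> P \<and> dmn \<sigma> = cod \<beta> \<and> \<sigma> \<cdot> \<beta> = b \<and> dmn \<tau> = dmn \<sigma> \<and> deg \<tau> = deg \<sigma>}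
        \<subseteq> {\<tau> \<cdot> (THE \<beta>. \<beta> \<in> P \<and> dmn \<sigma> = cod \<beta> \<and> \<sigma> \<cdot> \<beta> = b)}"
      proof clarify
        fix \<beta> assume \<beta>: "\<beta> \<in> P" "dmn \<sigma> = cod \<beta>" "b = \<sigma> \<cdot> \<beta>"
        have "(THE \<beta>'. \<beta>' \<in> P \<and> dmn \<sigma> = cod \<beta>' \<and> \<sigma> \<cdot> \<beta>' = \<sigma> \<cdot> \<beta>) = \<beta>"
          using \<beta> SC[OF that] comp_cancel[of \<sigma>] by (intro the_equality) auto
        then show "\<tau> \<cdot> \<beta> = \<tau> \<cdot> (THE \<beta>'. \<beta>' \<in> P \<and> dmn \<sigma> = cod \<beta>' \<and> \<sigma> \<cdot> \<beta>' = \<sigma> \<cdot> \<beta>)" by simp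
      qed
    qed simp
    have "finite Repl" unfolding Repl_def
      using \<open>finite Base\<close> \<open>finite S\<close> one by (intro finite_UN_I)
    have BaseI: "\<kappa> \<cdot> \<alpha> \<in> Base" if "\<kappa> \<in> S" "\<mu> \<in> S" "\<sigma> \<in> S" "(\<alpha>, \<beta>) \<in> lambda_min \<Lambda> \<mu> \<sigma>" for \<kappa> \<mu> \<sigma> \<alpha> \<beta>
      unfolding Base_def using that by force
    have ReplI: "\<tau> \<cdot> \<beta> \<in> Repl" if "\<sigma> \<cdot> \<beta> \<in> Base" "\<sigma> \<in> S" "\<tau> \<in> S" "\<beta> \<in> P" "dmn \<sigma> = cod \<beta>"
      "dmn \<tau> = dmn \<sigma>" "deg \<tau> = deg \<sigma>" for \<sigma> \<tau> \<beta>
      unfolding Repl_def using that by blast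
    have "\<xi> \<in> Base \<union> Repl" if "\<xi> \<in> ?C" "deg_size (deg \<xi>) = L" for \<xi>
      using that
    proof induction
      case (base \<xi>)
      then show ?case by (simp add: Base_def)
    next
      case (step \<kappa> \<mu> \<sigma> \<alpha> \<beta>)
      have pc: "\<kappa> \<in> P" "\<mu> \<in> P" "\<sigma> \<in> P" using step.hyps P by auto
      have lm: "\<alpha> \<in> P" "\<beta> \<in> P" "dmn \<mu> = cod \<alpha>" "dmn \<sigma> = cod \<beta>" "\<mu> \<cdot> \<alpha> = \<sigma> \<cdot> \<beta>"
        "deg \<mu> + deg \<alpha> = deg_join (deg \<mu>) (deg \<sigma>)"
        using step.hyps lambda_min_iff pc by auto
      have da: "dmn \<kappa> = cod \<alpha>" using step.hyps lm by simp
      have L: "deg_size (deg \<mu>) + deg_size (deg \<alpha>) = L"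
        using step pc lm da by (metis comp_simps(4) deg_size_add)
      then have L': "deg_size (deg \<sigma>) + deg_size (deg \<beta>) = L"
        using pc lm by (metis comp_simps(4) deg_size_add)
      consider "deg_size (deg \<mu>) = L" | "deg_size (deg \<mu>) < L" "deg_size (deg \<sigma>) < L"
        | "deg_size (deg \<mu>) < L" "deg_size (deg \<sigma>) = L"
        using L L' by linarith
      then show ?case
      proof cases
        case 1
        then have "deg \<alpha> = 0" using L by simp
        then have "\<kappa> \<cdot> \<alpha> = \<kappa>" using deg_0 lm da pc by (metis path_simps(8))
        then show ?thesis using step 1 by metis
      next
        case 2
        then have "\<kappa> \<in> S" "\<mu> \<in> S" "\<sigma> \<in> S" using step.hyps by (auto simp: S_def)
        then show ?thesis using BaseI step.hyps by blast
      next
        case 3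
        then have "deg \<beta> = 0" using L' by simp
        then have \<sigma>: "\<mu> \<cdot> \<alpha> = \<sigma>" using deg_0 lm pc by (metis path_simps(8))
        have S: "\<kappa> \<in> S" "\<mu> \<in> S" using step.hyps 3 by (auto simp: S_def)
        have "\<sigma> \<in> Base \<union> Repl" using step 3 by blast
        then show ?thesis
        proof
          assume "\<sigma> \<in> Base"
          then show ?thesis using ReplI[of \<mu> \<alpha> \<kappa>] S lm step.hyps \<sigma> by auto
        next
          assume "\<sigma> \<in> Repl"
          then obtain \<sigma>' \<tau> \<beta>' where r: "\<sigma>' \<cdot> \<beta>' \<in> Base" "\<sigma>' \<in> S" "\<tau> \<in> S" "\<beta>' \<in> P" "dmn \<sigma>' = cod \<beta>'"
            "dmn \<tau> = dmn \<sigma>'" "deg \<tau> = deg \<sigma>'" "\<sigma> = \<tau> \<cdot> \<beta>'"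
            unfolding Repl_def by blast
          have rP: "\<tau> \<in> P" "\<sigma>' \<in> P" "dmn \<tau> = cod \<beta>'" using r SC by auto
          let ?m = "deg_join (deg \<mu>) (deg \<tau>)"
          have deg\<sigma>: "deg \<sigma> = deg \<mu> + deg \<alpha>" "deg \<sigma> = deg \<tau> + deg \<beta>'"
            using \<sigma> lm(1-3) pc r(4,8) rP by (metis comp_simps(4))+
          then have le: "deg \<mu> \<le> deg \<sigma>" "deg \<tau> \<le> deg \<sigma>" unfolding deg_le_iff_add by blast+
          show ?thesis
          proof (cases "?m = deg \<sigma>")
            case True
            then have "(\<alpha>, \<beta>') \<in> lambda_min \<Lambda> \<mu> \<tau>"
              using lm pc r rP \<sigma> deg\<sigma> by (subst lambda_min_iff) auto
            then show ?thesis using BaseI S r(3) by blast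
          next
            case False
            obtain \<rho> \<eta> where \<rho>: "\<rho> \<in> P" "\<eta> \<in> P" "deg \<rho> = ?m" "dmn \<rho> = cod \<eta>" "\<sigma> = \<rho> \<cdot> \<eta>"
              using factor[OF pc(3) deg_join_least[OF le]] by metis
            obtain \<gamma> where \<gamma>: "\<gamma> \<in> P" "dmn \<mu> = cod \<gamma>" "\<rho> = \<mu> \<cdot> \<gamma>" "dmn \<gamma> = cod \<eta>" "\<alpha> = \<gamma> \<cdot> \<eta>"
              using initial_segment_le[of \<mu> \<alpha> \<rho> \<eta>] pc lm \<rho> \<sigma> deg_le_join by metis
            obtain \<delta> where \<delta>: "\<delta> \<in> P" "dmn \<tau> = cod \<delta>" "\<rho> = \<tau> \<cdot> \<delta>" "dmn \<delta> = cod \<eta>" "\<beta>' = \<delta> \<cdot> \<eta>"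
              using initial_segment_le[of \<tau> \<beta>' \<rho> \<eta>] rP r(4,8) \<rho> deg_le_join by metis
            \<comment> \<open>Both replacements are absorbed in the common initial segment \<open>\<rho>\<close>: \<open>\<kappa> \<cdot> \<gamma>\<close> takes the place of \<open>\<sigma>' \<cdot> \<delta>\<close>.\<close>
            have lm': "(\<gamma>, \<delta>) \<in> lambda_min \<Lambda> \<mu> \<tau>" "(\<delta>, \<gamma>) \<in> lambda_min \<Lambda> \<tau> \<mu>"
            proof -
              show "(\<gamma>, \<delta>) \<in> lambda_min \<Lambda> \<mu> \<tau>"
                unfolding lambda_min_iff[OF pc(2) rP(1)]
                using \<gamma> \<delta> \<rho>(3) comp_simps(4)[OF pc(2) \<gamma>(1,2)] by simp
              then show "(\<delta>, \<gamma>) \<in> lambda_min \<Lambda> \<tau> \<mu>" using lambda_min_swap pc rP by blast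
            qed
            have deg\<gamma>: "deg (\<kappa> \<cdot> \<gamma>) = ?m" "deg (\<sigma>' \<cdot> \<delta>) = ?m"
              using pc rP \<gamma> \<delta> \<rho>(3) da r step.hyps by (metis comp_simps(4))+
            have "deg \<eta> \<noteq> 0"
              using False \<rho> by (metis add.right_neutral comp_simps(4))
            then have "deg_size (deg \<eta>) \<noteq> 0" by simp
            then have "deg_size ?m < deg_size (deg \<sigma>)" using \<rho> by (simp del: deg_size_eq_0)
            then have "deg_size ?m < L" using 3 by simp
            moreover have "\<kappa> \<cdot> \<gamma> \<in> ?C" "\<sigma>' \<cdot> \<delta> \<in> ?C"
              using path_closure.step[OF _ _ _ _ _ lm'(1)] path_closure.step[OF _ _ _ _ _ lm'(2)]
                step.hyps SC r by auto
            ultimately have S': "\<kappa> \<cdot> \<gamma> \<in> S" "\<sigma>' \<cdot> \<delta> \<in> S" using deg\<gamma> by (auto simp: S_def)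
            have "(\<sigma>' \<cdot> \<delta>) \<cdot> \<eta> \<in> Base" using r rP \<delta> \<rho>(2) by simp
            moreover have "dmn (\<kappa> \<cdot> \<gamma>) = cod \<eta>" "dmn (\<sigma>' \<cdot> \<delta>) = cod \<eta>"
              using \<gamma>(1,2,4) \<delta>(1,2,4) r(6) rP(2) pc(1) step.hyps(5) by simp_all
            ultimately have "(\<kappa> \<cdot> \<gamma>) \<cdot> \<eta> \<in> Repl"
              using S' \<rho>(2) deg\<gamma> by (intro ReplI[of "\<sigma>' \<cdot> \<delta>" \<eta> "\<kappa> \<cdot> \<gamma>"]) simp_all
            then show ?thesis using \<gamma> \<rho>(2) pc step.hyps by simp
          qed
        qed
      qed
    qed
    then have "{\<xi> \<in> ?C. deg_size (deg \<xi>) < Suc L} \<subseteq> S \<union> Base \<union> Repl"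
      by (auto simp: S_def less_Suc_eq)
    then show ?case using \<open>finite S\<close> \<open>finite Base\<close> \<open>finite Repl\<close> by (meson finite_UnI finite_subset)
  qed simp
  define N where "N = (\<Sum>\<xi>\<in>E. deg \<xi>)"
  have "deg \<xi> \<le> N" if "\<xi> \<in> E" for \<xi>
    unfolding N_def deg_le_iff_add using sum.remove[OF E(2) that, of deg] by blast
  then have "deg_size (deg \<xi>) < Suc (deg_size N)" if "\<xi> \<in> ?C" for \<xi>
    using path_closure_deg_bound[OF E(1) _ that, of N]
    by (auto simp: deg_size_def less_eq_vec_def less_Suc_eq_le intro: sum_mono)
  then have "?C = {\<xi> \<in> ?C. deg_size (deg \<xi>) < Suc (deg_size N)}" by blast
  then show ?thesis using fin by metis
qed

end

section \<open>Toeplitz--Cuntz--Krieger families\<close>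

text \<open>
  The relations common to all relative families on \<open>\<Lambda>\<close>; they are those of the empty set of
  exhaustive sets.
\<close>

locale tck = fa_kgraph \<Lambda> + cstar A
  for \<Lambda> :: "('p, 'k::finite) kgraph" and A :: "'a cstar" (structure) +
  fixes s :: "'p \<Rightarrow> 'a"
  assumes family: "ck_family \<Lambda> {} A s"
begin

lemma s_closed [simp, intro]: "\<kappa> \<in> P \<Longrightarrow> s \<kappa> \<in> carrier A"
  using family by (simp add: ck_family_def)

lemma s_vertex: "v \<in> vertices \<Lambda> \<Longrightarrow> adj A (s v) = s v" "v \<in> vertices \<Lambda> \<Longrightarrow> s v \<otimes> s v = s v"
  using family by (simp_all add: ck_family_def)

lemma s_vertex_orth: "v \<in> vertices \<Lambda> \<Longrightarrow> w \<in> vertices \<Lambda> \<Longrightarrow> v \<noteq> w \<Longrightarrow> s v \<otimes> s w = \<zero>"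
  using family by (simp add: ck_family_def)

lemma s_comp: "\<kappa> \<in> P \<Longrightarrow> \<mu> \<in> P \<Longrightarrow> dmn \<kappa> = cod \<mu> \<Longrightarrow> s \<kappa> \<otimes> s \<mu> = s (\<kappa> \<cdot> \<mu>)"
  using family by (simp add: ck_family_def)

lemma s_adj_mult: "\<kappa> \<in> P \<Longrightarrow> \<mu> \<in> P \<Longrightarrow>
    adj A (s \<kappa>) \<otimes> s \<mu> = finsum A (\<lambda>(\<alpha>, \<beta>). s \<alpha> \<otimes> adj A (s \<beta>)) (lambda_min \<Lambda> \<kappa> \<mu>)"
  using family by (simp add: ck_family_def)

lemma vertex_path: "v \<in> vertices \<Lambda> \<Longrightarrow> v \<in> P" "v \<in> vertices \<Lambda> \<Longrightarrow> cod v = v" "v \<in> vertices \<Lambda> \<Longrightarrow> dmn v = v"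
  using deg_0 by (auto simp: vertices_def)

lemma s_source: "\<kappa> \<in> P \<Longrightarrow> adj A (s \<kappa>) \<otimes> s \<kappa> = s (dmn \<kappa>)"
  by (simp add: s_adj_mult lambda_min_self s_vertex)

lemma s_units: "\<kappa> \<in> P \<Longrightarrow> s (cod \<kappa>) \<otimes> s \<kappa> = s \<kappa>" "\<kappa> \<in> P \<Longrightarrow> s \<kappa> \<otimes> s (dmn \<kappa>) = s \<kappa>"
  by (simp_all add: s_comp)

lemma adj_s_units: "\<kappa> \<in> P \<Longrightarrow> adj A (s \<kappa>) \<otimes> s (cod \<kappa>) = adj A (s \<kappa>)"
    "\<kappa> \<in> P \<Longrightarrow> s (dmn \<kappa>) \<otimes> adj A (s \<kappa>) = adj A (s \<kappa>)"
  using s_units[THEN arg_cong[of _ _ "adj A"]] by (simp_all add: s_vertex)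

definition ss :: "'p \<Rightarrow> 'p \<Rightarrow> 'a" where
  "ss \<kappa> \<mu> = s \<kappa> \<otimes> adj A (s \<mu>)"

lemma ss_closed [simp, intro]: "\<kappa> \<in> P \<Longrightarrow> \<mu> \<in> P \<Longrightarrow> ss \<kappa> \<mu> \<in> carrier A"
  by (simp add: ss_def)

lemma adj_ss [simp]: "\<kappa> \<in> P \<Longrightarrow> \<mu> \<in> P \<Longrightarrow> adj A (ss \<kappa> \<mu>) = ss \<mu> \<kappa>"
  by (simp add: ss_def)

lemma ss_shift:
  assumes "\<kappa> \<in> P" "\<tau> \<in> P" "\<alpha> \<in> P" "\<beta> \<in> P" "dmn \<kappa> = cod \<alpha>" "dmn \<tau> = cod \<beta>"
  shows "s \<kappa> \<otimes> ss \<alpha> \<beta> \<otimes> adj A (s \<tau>) = ss (\<kappa> \<cdot> \<alpha>) (\<tau> \<cdot> \<beta>)"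
  using assms by (simp add: ss_def m_assoc flip: s_comp)

lemma ss_mult:
  assumes "\<kappa> \<in> P" "\<mu> \<in> P" "\<sigma> \<in> P" "\<tau> \<in> P" "dmn \<kappa> = dmn \<mu>" "dmn \<sigma> = dmn \<tau>"
  shows "ss \<kappa> \<mu> \<otimes> ss \<sigma> \<tau> = finsum A (\<lambda>(\<alpha>, \<beta>). ss (\<kappa> \<cdot> \<alpha>) (\<tau> \<cdot> \<beta>)) (lambda_min \<Lambda> \<mu> \<sigma>)"
proof -
  let ?f = "\<lambda>(\<alpha>, \<beta>). ss \<alpha> \<beta>"
  have f: "?f \<in> lambda_min \<Lambda> \<mu> \<sigma> \<rightarrow> carrier A" using assms by (auto simp: lambda_min_iff)
  have "ss \<kappa> \<mu> \<otimes> ss \<sigma> \<tau> = s \<kappa> \<otimes> (adj A (s \<mu>) \<otimes> s \<sigma>) \<otimes> adj A (s \<tau>)"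
    using assms by (simp add: ss_def m_assoc)
  also have "adj A (s \<mu>) \<otimes> s \<sigma> = finsum A ?f (lambda_min \<Lambda> \<mu> \<sigma>)"
    using assms by (simp add: s_adj_mult ss_def)
  also have "s \<kappa> \<otimes> \<dots> \<otimes> adj A (s \<tau>) = finsum A (\<lambda>p. s \<kappa> \<otimes> ?f p \<otimes> adj A (s \<tau>)) (lambda_min \<Lambda> \<mu> \<sigma>)"
    using assms f by (simp add: mult_finsum finsum_mult Pi_iff)
  also have "\<dots> = finsum A (\<lambda>(\<alpha>, \<beta>). ss (\<kappa> \<cdot> \<alpha>) (\<tau> \<cdot> \<beta>)) (lambda_min \<Lambda> \<mu> \<sigma>)"
    using assms by (intro finsum_cong') (auto simp: lambda_min_iff ss_shift)
  finally show ?thesis .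
qed

text \<open>
  The range projection of $s_\kappa$. These projections commute, and a product of two of them is the
  sum of those of the minimal common extensions.
\<close>

definition q :: "'p \<Rightarrow> 'a" where
  "q \<kappa> = ss \<kappa> \<kappa>"

lemma q_closed [simp, intro]: "\<kappa> \<in> P \<Longrightarrow> q \<kappa> \<in> carrier A"
  by (simp add: q_def)

lemma adj_q [simp]: "\<kappa> \<in> P \<Longrightarrow> adj A (q \<kappa>) = q \<kappa>"
  by (simp add: q_def)

lemma q_vertex: "v \<in> vertices \<Lambda> \<Longrightarrow> q v = s v"
  by (simp add: q_def ss_def s_vertex)

lemma q_mult:
  assumes "\<kappa> \<in> P" "\<mu> \<in> P"
  shows "q \<kappa> \<otimes> q \<mu> = finsum A (\<lambda>(\<alpha>, \<beta>). q (\<kappa> \<cdot> \<alpha>)) (lambda_min \<Lambda> \<kappa> \<mu>)"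
  unfolding q_def using assms
  by (subst ss_mult) (auto intro!: finsum_cong' simp: lambda_min_iff)

lemma q_comm:
  assumes "\<kappa> \<in> P" "\<mu> \<in> P"
  shows "q \<kappa> \<otimes> q \<mu> = q \<mu> \<otimes> q \<kappa>"
proof -
  have "q \<mu> \<otimes> q \<kappa> = adj A (q \<kappa> \<otimes> q \<mu>)" using assms by simp
  also have "\<dots> = q \<kappa> \<otimes> q \<mu>"
    unfolding q_mult[OF assms] using assms
    by (subst adj_finsum) (auto intro!: finsum_cong' simp: lambda_min_iff)
  finally show ?thesis by simp
qed

lemma q_s: "\<kappa> \<in> P \<Longrightarrow> q \<kappa> \<otimes> s \<kappa> = s \<kappa>"
  by (simp add: q_def ss_def m_assoc s_source s_units)

lemma q_ss: "\<kappa> \<in> P \<Longrightarrow> \<mu> \<in> P \<Longrightarrow> q \<kappa> \<otimes> ss \<kappa> \<mu> = ss \<kappa> \<mu>"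
  using q_s by (simp add: ss_def flip: m_assoc)

lemma q_idem: "\<kappa> \<in> P \<Longrightarrow> q \<kappa> \<otimes> q \<kappa> = q \<kappa>"
  using q_ss q_def by metis

lemma q_comp_s:
  assumes "\<kappa> \<in> P" "\<nu> \<in> P" "dmn \<kappa> = cod \<nu>"
  shows "q (\<kappa> \<cdot> \<nu>) \<otimes> s \<kappa> = s \<kappa> \<otimes> q \<nu>"
proof -
  have "q (\<kappa> \<cdot> \<nu>) = s \<kappa> \<otimes> q \<nu> \<otimes> adj A (s \<kappa>)"
    using assms ss_shift[of \<kappa> \<kappa> \<nu> \<nu>] by (simp add: q_def)
  then have "q (\<kappa> \<cdot> \<nu>) \<otimes> s \<kappa> = s \<kappa> \<otimes> q \<nu> \<otimes> (adj A (s \<kappa>) \<otimes> s \<kappa>)"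
    using assms by (simp add: m_assoc)
  also have "\<dots> = s \<kappa> \<otimes> q \<nu>"
    using assms adj_s_units(1)[of \<nu>] by (simp add: s_source q_def ss_def m_assoc)
  finally show ?thesis .
qed

lemma q_q_comp:
  assumes "\<kappa> \<in> P" "\<nu> \<in> P" "dmn \<kappa> = cod \<nu>"
  shows "q \<kappa> \<otimes> q (\<kappa> \<cdot> \<nu>) = q (\<kappa> \<cdot> \<nu>)" "q (\<kappa> \<cdot> \<nu>) \<otimes> q \<kappa> = q (\<kappa> \<cdot> \<nu>)"
proof -
  show "q \<kappa> \<otimes> q (\<kappa> \<cdot> \<nu>) = q (\<kappa> \<cdot> \<nu>)" using assms by (simp add: q_mult lambda_min_extension)
  then show "q (\<kappa> \<cdot> \<nu>) \<otimes> q \<kappa> = q (\<kappa> \<cdot> \<nu>)" using q_comm assms by simp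
qed

lemma q_orth: "\<kappa> \<in> P \<Longrightarrow> \<mu> \<in> P \<Longrightarrow> lambda_min \<Lambda> \<kappa> \<mu> = {} \<Longrightarrow> q \<kappa> \<otimes> q \<mu> = \<zero>"
  by (simp add: q_mult)

lemma q_cod: "\<kappa> \<in> P \<Longrightarrow> s (cod \<kappa>) \<otimes> q \<kappa> = q \<kappa>" "\<kappa> \<in> P \<Longrightarrow> q \<kappa> \<otimes> s (cod \<kappa>) = q \<kappa>"
  using q_q_comp[of "cod \<kappa>" \<kappa>] by (simp_all add: q_vertex)

section \<open>Gap projections\<close>

text \<open>
  The product in \<open>gap_prod\<close>, with the vertex made explicit so that it makes sense for the empty set
  as well. It is the largest projection below $s_v$ that is orthogonal to all \<open>q \<kappa>\<close> with \<open>\<kappa> \<in> T\<close>.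
\<close>

definition gap :: "'p \<Rightarrow> 'p set \<Rightarrow> 'a" where
  "gap v T = foldD (carrier A) (\<lambda>\<kappa> x. (s v \<ominus> q \<kappa>) \<otimes> x) (s v) T"

lemma gap_LCD:
  assumes v: "v \<in> vertices \<Lambda>"
  shows "LCD (paths_to \<Lambda> v) (carrier A) (\<lambda>\<kappa> x. (s v \<ominus> q \<kappa>) \<otimes> x)"
proof
  fix \<kappa> \<mu> z assume k: "\<kappa> \<in> paths_to \<Lambda> v" "\<mu> \<in> paths_to \<Lambda> v" and z: "z \<in> carrier A"
  note vp = vertex_path[OF v]
  have kP: "\<kappa> \<in> P" "\<mu> \<in> P" using k by (auto simp: paths_to_def)
  have "(s v \<ominus> q \<kappa>) \<otimes> (s v \<ominus> q \<mu>) = (s v \<ominus> q \<mu>) \<otimes> (s v \<ominus> q \<kappa>)"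
  proof -
    have "s v \<otimes> q x = q x \<otimes> s v" if "x \<in> P" for x using q_comm[of x v] that v vp by (simp add: q_vertex)
    then show ?thesis using kP vp q_comm[OF kP]
      by (simp add: mult_diff_left mult_diff_right) (simp add: minus_eq minus_add a_ac)
  qed
  then show "(s v \<ominus> q \<kappa>) \<otimes> ((s v \<ominus> q \<mu>) \<otimes> z) = (s v \<ominus> q \<mu>) \<otimes> ((s v \<ominus> q \<kappa>) \<otimes> z)"
    using kP vp z by (simp flip: m_assoc)
qed (use vertex_path[OF v] in \<open>auto simp: paths_to_def\<close>)

lemma gap_empty: "v \<in> vertices \<Lambda> \<Longrightarrow> gap v {} = s v"
  using vertex_path by (simp add: gap_def)

lemma gap_insert:
  assumes "v \<in> vertices \<Lambda>" "finite T" "T \<subseteq> paths_to \<Lambda> v" "\<kappa> \<in> paths_to \<Lambda> v" "\<kappa> \<notin> T"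
  shows "gap v (insert \<kappa> T) = (s v \<ominus> q \<kappa>) \<otimes> gap v T"
  unfolding gap_def using assms vertex_path
  by (intro LCD.foldD_insert[OF gap_LCD]) auto

lemma gap_induct [consumes 3, case_names empty insert]:
  assumes "v \<in> vertices \<Lambda>" "finite T" "T \<subseteq> paths_to \<Lambda> v"
    and "R {} (s v)"
    and "\<And>\<kappa> T. \<kappa> \<in> P \<Longrightarrow> \<kappa> \<in> paths_to \<Lambda> v \<Longrightarrow> finite T \<Longrightarrow> T \<subseteq> paths_to \<Lambda> v \<Longrightarrow> gap v T \<in> carrier A \<Longrightarrow> \<kappa> \<notin> T \<Longrightarrow> 
      R T (gap v T) \<Longrightarrow> R (insert \<kappa> T) ((s v \<ominus> q \<kappa>) \<otimes> gap v T)"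
  shows "gap v T \<in> carrier A \<and> R T (gap v T)"
  using assms(2,3)
proof (induction T)
  case empty
  then show ?case using assms(1,4) vertex_path by (simp add: gap_empty)
next
  case (insert \<kappa> T)
  then have "\<kappa> \<in> P" "\<kappa> \<in> paths_to \<Lambda> v" by (auto simp: paths_to_def)
  then show ?case using insert assms(1) assms(5)[of \<kappa> T] vertex_path by (simp add: gap_insert)
qed

context
  fixes v T
  assumes vT: "v \<in> vertices \<Lambda>" "finite T" "T \<subseteq> paths_to \<Lambda> v"
begin

private lemma v: "v \<in> P" "s v \<in> carrier A" "q v = s v"
  using vT vertex_path q_vertex by auto

lemma gap_closed [simp]: "gap v T \<in> carrier A"
  using gap_induct[OF vT, of "\<lambda>_ _. True"] by simp

lemma gap_q_comm:
  assumes \<kappa>: "\<kappa> \<in> P"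
  shows "q \<kappa> \<otimes> gap v T = gap v T \<otimes> q \<kappa>"
proof -
  have v_comm: "q \<kappa> \<otimes> s v = s v \<otimes> q \<kappa>" using q_comm[OF \<kappa> v(1)] v by simp
  have "gap v T \<in> carrier A \<and> q \<kappa> \<otimes> gap v T = gap v T \<otimes> q \<kappa>"
    using vT
  proof (induction rule: gap_induct)
    case (insert \<mu> T)
    have "q \<kappa> \<otimes> (s v \<ominus> q \<mu>) = (s v \<ominus> q \<mu>) \<otimes> q \<kappa>"
      using insert(1) \<kappa> v q_comm v_comm by (simp add: mult_diff_left mult_diff_right)
    then have "q \<kappa> \<otimes> (s v \<ominus> q \<mu>) \<otimes> gap v T = (s v \<ominus> q \<mu>) \<otimes> (q \<kappa> \<otimes> gap v T)"
      using insert \<kappa> v by (simp add: m_assoc)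
    then show ?case using insert \<kappa> v by (simp add: m_assoc)
  qed (rule v_comm)
  then show ?thesis by simp
qed

lemma gap_vertex: "s v \<otimes> gap v T = gap v T" "gap v T \<otimes> s v = gap v T"
proof -
  have "gap v T \<in> carrier A \<and> s v \<otimes> gap v T = gap v T"
    using vT
  proof (induction rule: gap_induct)
    case (insert \<mu> T)
    have "s v \<otimes> (s v \<ominus> q \<mu>) = s v \<ominus> q \<mu>"
      using insert v vT(1) q_cod[of \<mu>] by (simp add: paths_to_def mult_diff_right s_vertex)
    then show ?case using insert v by (simp flip: m_assoc)
  qed (use vT in \<open>simp add: s_vertex\<close>)
  then show "s v \<otimes> gap v T = gap v T" by simp
  then show "gap v T \<otimes> s v = gap v T" using gap_q_comm[of v] v by simp
qed

lemma gap_absorb: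
  assumes x: "x \<in> carrier A" "x \<otimes> s v = x" "\<And>\<kappa>. \<kappa> \<in> T \<Longrightarrow> x \<otimes> q \<kappa> = \<zero>"
  shows "x \<otimes> gap v T = x"
proof -
  have "gap v T \<in> carrier A \<and> ((\<forall>\<kappa>\<in>T. x \<otimes> q \<kappa> = \<zero>) \<longrightarrow> x \<otimes> gap v T = x)"
    using vT
  proof (induction rule: gap_induct)
    case (insert \<mu> T)
    show ?case
    proof
      assume z: "\<forall>\<kappa>\<in>insert \<mu> T. x \<otimes> q \<kappa> = \<zero>"
      then have "x \<otimes> (s v \<ominus> q \<mu>) = x" using x insert(1) v by (simp add: mult_diff_right)
      then have "x \<otimes> ((s v \<ominus> q \<mu>) \<otimes> gap v T) = x \<otimes> gap v T" using x insert v by (simp flip: m_assoc)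
      then show "x \<otimes> ((s v \<ominus> q \<mu>) \<otimes> gap v T) = x" using insert z by simp
    qed
  qed (use x in simp)
  then show ?thesis using x by blast
qed

lemma gap_kill:
  assumes "\<kappa> \<in> T"
  shows "q \<kappa> \<otimes> gap v T = \<zero>"
proof -
  have T: "finite (T - {\<kappa>})" "T - {\<kappa>} \<subseteq> paths_to \<Lambda> v" "\<kappa> \<in> paths_to \<Lambda> v" using vT assms by auto
  have \<kappa>: "\<kappa> \<in> P" "cod \<kappa> = v" using T by (auto simp: paths_to_def)
  have g: "gap v (T - {\<kappa>}) \<in> carrier A" using gap_induct[OF vT(1) T(1,2), of "\<lambda>_ _. True"] by simp
  have "gap v T = (s v \<ominus> q \<kappa>) \<otimes> gap v (T - {\<kappa>})"
    using gap_insert[OF vT(1) T] assms by (simp add: insert_absorb)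
  moreover have "q \<kappa> \<otimes> (s v \<ominus> q \<kappa>) = \<zero>"
    using \<kappa> v q_cod[of \<kappa>] by (simp add: mult_diff_right q_idem)
  ultimately show ?thesis using \<kappa> v g by (simp flip: m_assoc)
qed

lemma gap_idem: "gap v T \<otimes> gap v T = gap v T"
proof (rule gap_absorb)
  fix \<kappa> assume "\<kappa> \<in> T"
  then show "gap v T \<otimes> q \<kappa> = \<zero>" using gap_kill gap_q_comm[of \<kappa>] vT by (auto simp: paths_to_def)
qed (simp_all add: gap_vertex)

lemma gap_adj [simp]: "adj A (gap v T) = gap v T"
proof -
  have 1: "adj A (gap v T) \<otimes> gap v T = adj A (gap v T)"
  proof (rule gap_absorb)
    show "adj A (gap v T) \<otimes> s v = adj A (gap v T)"
      using gap_vertex(1)[THEN arg_cong[of _ _ "adj A"]] v vT by (simp add: s_vertex)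
    fix \<kappa> assume \<kappa>: "\<kappa> \<in> T"
    then have "\<kappa> \<in> P" using vT by (auto simp: paths_to_def)
    then show "adj A (gap v T) \<otimes> q \<kappa> = \<zero>"
      using gap_kill[OF \<kappa>, THEN arg_cong[of _ _ "adj A"]] by simp
  qed simp
  have "adj A (adj A (gap v T) \<otimes> gap v T) = adj A (gap v T) \<otimes> gap v T" by simp
  then show ?thesis using 1 by simp
qed

end

lemma gap_prod_eq:
  assumes "v \<in> vertices \<Lambda>" "T \<subseteq> paths_to \<Lambda> v" "T \<noteq> {}"
  shows "gap_prod \<Lambda> A s T = gap v T"
proof -
  have "set_rng \<Lambda> T = v"
    unfolding set_rng_def using assms by (intro the_equality) (auto simp: paths_to_def)
  then show ?thesis by (simp add: gap_prod_def gap_def q_def ss_def)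
qed

text \<open>
  A path with no common extension with any member of \<open>T\<close> has its range projection below the gap.
\<close>

lemma gap_not_exhaustive:
  assumes vT: "v \<in> vertices \<Lambda>" "finite T" "T \<subseteq> paths_to \<Lambda> v"
    and "\<not> exhaustive \<Lambda> v T" and nz: "\<And>w. w \<in> vertices \<Lambda> \<Longrightarrow> s w \<noteq> \<zero>"
  shows "gap v T \<noteq> \<zero>"
proof
  assume g: "gap v T = \<zero>"
  obtain \<kappa> where \<kappa>: "\<kappa> \<in> paths_to \<Lambda> v" "Ext \<Lambda> \<kappa> T = {}" using assms by (auto simp: exhaustive_def)
  then have kP: "\<kappa> \<in> P" "cod \<kappa> = v" by (auto simp: paths_to_def)
  have "q \<kappa> \<otimes> gap v T = q \<kappa>"
  proof (rule gap_absorb[OF vT])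
    fix \<mu> assume \<mu>: "\<mu> \<in> T"
    then have "\<mu> \<in> P" using vT by (auto simp: paths_to_def)
    moreover have "lambda_min \<Lambda> \<kappa> \<mu> = {}"
      using \<kappa>(2) \<mu> \<open>\<mu> \<in> P\<close> kP by (fastforce simp: Ext_def paths_to_def lambda_min_iff)
    ultimately show "q \<kappa> \<otimes> q \<mu> = \<zero>" using q_orth kP by simp
  qed (use kP q_cod in auto)
  then have "q \<kappa> = \<zero>" using g kP by simp
  then have "s \<kappa> = \<zero>" using q_s[OF kP(1)] kP by simp
  then have "s (dmn \<kappa>) = \<zero>" using s_source[OF kP(1)] kP by simp
  then show False using nz[of "dmn \<kappa>"] kP by simp
qed

end

section \<open>Matrix units for a closed finite set of paths\<close>

lemma (in cstar) finsum_if: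
  assumes "finite I" "f \<in> I \<rightarrow> carrier A"
  shows "finsum A (\<lambda>i. if p i then f i else \<zero>) I = finsum A f {i \<in> I. p i}"
  using assms
proof (induction I)
  case (insert i I)
  have *: "{j \<in> insert i I. p j} = (if p i then insert i {j \<in> I. p j} else {j \<in> I. p j})" by auto
  have c: "finsum A f {j \<in> I. p j} \<in> carrier A" using insert by (intro finsum_closed) auto
  show ?case
    unfolding * using insert c by (auto simp: Pi_iff)
qed simp

lemma (in fa_kgraph) extends_comp:
  "\<mu> \<in> P \<Longrightarrow> \<alpha> \<in> P \<Longrightarrow> dmn \<mu> = cod \<alpha> \<Longrightarrow> extends \<mu> (\<mu> \<cdot> \<alpha>)"
  by (auto simp: extends_def)

lemma (in fa_kgraph) extends_refl: "\<kappa> \<in> P \<Longrightarrow> extends \<kappa> \<kappa>"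
  unfolding extends_def by (rule bexI[of _ "dmn \<kappa>"]) simp_all

lemma (in fa_kgraph) extends_trans:
  assumes "\<mu> \<in> P" "extends \<mu> \<kappa>" "extends \<kappa> \<xi>"
  shows "extends \<mu> \<xi>"
proof -
  obtain \<alpha> \<beta> where *: "\<alpha> \<in> P" "dmn \<mu> = cod \<alpha>" "\<kappa> = \<mu> \<cdot> \<alpha>" "\<beta> \<in> P" "dmn \<kappa> = cod \<beta>" "\<xi> = \<kappa> \<cdot> \<beta>"
    using assms unfolding extends_def by blast
  then have "\<xi> = \<mu> \<cdot> (\<alpha> \<cdot> \<beta>)" "\<alpha> \<cdot> \<beta> \<in> P" "dmn \<mu> = cod (\<alpha> \<cdot> \<beta>)" using assms(1) by auto
  then show ?thesis unfolding extends_def by blast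
qed

lemma (in fa_kgraph) extends_strict:
  assumes "\<mu> \<in> P" "\<kappa> \<in> P" "extends \<mu> \<kappa>" "\<mu> \<noteq> \<kappa>"
  obtains \<nu> where "\<nu> \<in> P" "dmn \<mu> = cod \<nu>" "\<kappa> = \<mu> \<cdot> \<nu>" "deg \<nu> \<noteq> 0"
proof -
  obtain \<nu> where \<nu>: "\<nu> \<in> P" "dmn \<mu> = cod \<nu>" "\<kappa> = \<mu> \<cdot> \<nu>" using assms by (auto simp: extends_def)
  have "deg \<nu> \<noteq> 0" using \<nu> assms deg_0[of \<nu>] path_simps(8)[of \<mu>] by metis
  then show ?thesis using that \<nu> by blast
qed

text \<open>
  The closure property makes the span of the $s_\kappa s_\mu^*$ with $\kappa, \mu$ in \<open>C\<close> of equal degree and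
  source a *-algebra. Its case \<open>\<kappa> = \<mu>\<close> says that \<open>C\<close> contains the minimal common
  extensions of its members.
\<close>

locale tck_core = tck \<Lambda> A s
  for \<Lambda> :: "('p, 'k::finite) kgraph" and A :: "'a cstar" (structure) and s :: "'p \<Rightarrow> 'a" +
  fixes C :: "'p set"
  assumes finite_C: "finite C" and C_paths: "\<xi> \<in> C \<Longrightarrow> \<xi> \<in> P"
    and C_closed: "\<kappa> \<in> C \<Longrightarrow> \<mu> \<in> C \<Longrightarrow> \<sigma> \<in> C \<Longrightarrow> deg \<kappa> = deg \<mu> \<Longrightarrow> dmn \<kappa> = dmn \<mu> \<Longrightarrow>
      (\<alpha>, \<beta>) \<in> lambda_min \<Lambda> \<mu> \<sigma> \<Longrightarrow> \<kappa> \<cdot> \<alpha> \<in> C"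
begin

lemma C_shift:
  assumes "\<kappa> \<in> C" "\<mu> \<in> C" "deg \<kappa> = deg \<mu>" "dmn \<kappa> = dmn \<mu>" "\<nu> \<in> P" "dmn \<mu> = cod \<nu>" "\<mu> \<cdot> \<nu> \<in> C"
  shows "\<kappa> \<cdot> \<nu> \<in> C"
  using C_closed[OF assms(1,2,7,3,4)] lambda_min_extension[of \<mu> \<nu>] assms C_paths by blast

text \<open>
  The tails lead from \<open>\<xi>\<close> to its proper extensions in \<open>C\<close>, and \<open>Q \<xi>\<close> below is what remains of
  the range projection of \<open>\<xi>\<close> when those of the proper extensions are removed. The elements
  \<open>unit \<xi> \<eta>\<close>, for \<open>\<xi>\<close> and \<open>\<eta>\<close> of equal degree and source, are matrix units with these diagonal
  projections.
\<close>

definition tails :: "'p \<Rightarrow> 'p set" where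
  "tails \<xi> = {\<nu> \<in> P. cod \<nu> = dmn \<xi> \<and> deg \<nu> \<noteq> 0 \<and> \<xi> \<cdot> \<nu> \<in> C}"

lemma tails:
  assumes "\<xi> \<in> C"
  shows "dmn \<xi> \<in> vertices \<Lambda>" "finite (tails \<xi>)" "tails \<xi> \<subseteq> paths_to \<Lambda> (dmn \<xi>)"
proof -
  have "inj_on (\<lambda>\<nu>. \<xi> \<cdot> \<nu>) (tails \<xi>)"
    using assms C_paths comp_cancel by (auto simp: inj_on_def tails_def)
  moreover have "(\<lambda>\<nu>. \<xi> \<cdot> \<nu>) ` tails \<xi> \<subseteq> C" by (auto simp: tails_def)
  ultimately show "finite (tails \<xi>)" using finite_C inj_on_finite by blast
qed (use assms C_paths in \<open>auto simp: tails_def paths_to_def\<close>)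

lemma tails_shift:
  assumes "\<xi> \<in> C" "\<eta> \<in> C" "deg \<xi> = deg \<eta>" "dmn \<xi> = dmn \<eta>"
  shows "tails \<xi> = tails \<eta>"
  using C_shift[of \<xi> \<eta>] C_shift[of \<eta> \<xi>] assms by (auto simp: tails_def)

definition tail_gap :: "'p \<Rightarrow> 'a" where
  "tail_gap \<xi> = gap (dmn \<xi>) (tails \<xi>)"

lemma tail_gap [simp]:
  assumes "\<xi> \<in> C"
  shows "tail_gap \<xi> \<in> carrier A" "adj A (tail_gap \<xi>) = tail_gap \<xi>"
    and tail_gap_idem: "tail_gap \<xi> \<otimes> tail_gap \<xi> = tail_gap \<xi>"
    and tail_gap_vertex: "s (dmn \<xi>) \<otimes> tail_gap \<xi> = tail_gap \<xi>" "tail_gap \<xi> \<otimes> s (dmn \<xi>) = tail_gap \<xi>"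
  using gap_closed gap_adj gap_idem gap_vertex tails[OF assms] by (auto simp: tail_gap_def)

definition unit :: "'p \<Rightarrow> 'p \<Rightarrow> 'a" where
  "unit \<xi> \<eta> = s \<xi> \<otimes> tail_gap \<eta> \<otimes> adj A (s \<eta>)"

definition Q :: "'p \<Rightarrow> 'a" where
  "Q \<xi> = unit \<xi> \<xi>"

lemma unit_closed [simp]: "\<xi> \<in> C \<Longrightarrow> \<eta> \<in> C \<Longrightarrow> unit \<xi> \<eta> \<in> carrier A"
  by (simp add: unit_def C_paths)

lemma Q_closed [simp]: "\<xi> \<in> C \<Longrightarrow> Q \<xi> \<in> carrier A"
  by (simp add: Q_def)

lemma adj_Q [simp]: "\<xi> \<in> C \<Longrightarrow> adj A (Q \<xi>) = Q \<xi>"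
  by (simp add: Q_def unit_def C_paths m_assoc)

lemma source_cancel:
  assumes "\<xi> \<in> C" "x \<in> carrier A"
  shows "adj A (s \<xi>) \<otimes> (s \<xi> \<otimes> (tail_gap \<xi> \<otimes> x)) = tail_gap \<xi> \<otimes> x"
proof -
  have "adj A (s \<xi>) \<otimes> (s \<xi> \<otimes> (tail_gap \<xi> \<otimes> x)) = adj A (s \<xi>) \<otimes> s \<xi> \<otimes> tail_gap \<xi> \<otimes> x"
    using assms C_paths by (simp add: m_assoc)
  then show ?thesis using assms C_paths by (simp add: s_source tail_gap_vertex)
qed

lemma Q_unit:
  assumes "\<xi> \<in> C" "\<eta> \<in> C" "deg \<xi> = deg \<eta>" "dmn \<xi> = dmn \<eta>"
  shows "Q \<xi> \<otimes> unit \<xi> \<eta> = unit \<xi> \<eta>"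
proof -
  have g: "tail_gap \<eta> = tail_gap \<xi>" using tails_shift[OF assms] assms(4) by (simp add: tail_gap_def)
  have c: "s \<xi> \<in> carrier A" "s \<eta> \<in> carrier A" "tail_gap \<xi> \<in> carrier A" using assms(1,2) C_paths by auto
  have "Q \<xi> \<otimes> unit \<xi> \<eta> = s \<xi> \<otimes> (tail_gap \<xi> \<otimes> (adj A (s \<xi>) \<otimes> (s \<xi> \<otimes> (tail_gap \<xi> \<otimes> adj A (s \<eta>)))))"
    using c by (simp add: Q_def unit_def g m_assoc)
  also have "\<dots> = s \<xi> \<otimes> (tail_gap \<xi> \<otimes> tail_gap \<xi>) \<otimes> adj A (s \<eta>)"
    using c source_cancel[OF assms(1), of "adj A (s \<eta>)"] by (simp add: m_assoc)
  finally show ?thesis using assms(1) by (simp add: unit_def g tail_gap_idem)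
qed

lemma Q_idem: "\<xi> \<in> C \<Longrightarrow> Q \<xi> \<otimes> Q \<xi> = Q \<xi>"
  using Q_unit[of \<xi> \<xi>] by (simp add: Q_def)

lemma Q_comp_q:
  assumes "\<xi> \<in> C" "\<nu> \<in> P" "dmn \<xi> = cod \<nu>"
  shows "q (\<xi> \<cdot> \<nu>) \<otimes> Q \<xi> = s \<xi> \<otimes> (q \<nu> \<otimes> tail_gap \<xi>) \<otimes> adj A (s \<xi>)"
proof -
  have "q (\<xi> \<cdot> \<nu>) \<otimes> Q \<xi> = (q (\<xi> \<cdot> \<nu>) \<otimes> s \<xi>) \<otimes> tail_gap \<xi> \<otimes> adj A (s \<xi>)"
    using assms C_paths by (simp add: Q_def unit_def m_assoc)
  then show ?thesis using assms C_paths by (simp add: q_comp_s m_assoc)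
qed

lemma q_Q_self: "\<xi> \<in> C \<Longrightarrow> q \<xi> \<otimes> Q \<xi> = Q \<xi>"
  using Q_comp_q[of \<xi> "dmn \<xi>"] C_paths by (simp add: q_vertex Q_def unit_def tail_gap_vertex)

lemma q_Q_strict:
  assumes "\<xi> \<in> C" "\<nu> \<in> tails \<xi>"
  shows "q (\<xi> \<cdot> \<nu>) \<otimes> Q \<xi> = \<zero>"
proof -
  have "q \<nu> \<otimes> tail_gap \<xi> = \<zero>" using gap_kill[OF tails[OF assms(1)] assms(2)] by (simp add: tail_gap_def)
  then show ?thesis using Q_comp_q[of \<xi> \<nu>] assms C_paths by (simp add: tails_def)
qed

lemma q_Q_comm:
  assumes "\<xi> \<in> C" "\<kappa> \<in> P" "q \<kappa> \<otimes> Q \<xi> = x"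
  shows "Q \<xi> \<otimes> q \<kappa> = adj A x"
  using assms by (metis adj_Q adj_mult adj_q q_closed Q_closed)

text \<open>
  The product of the range projections of \<open>\<xi>\<close> and \<open>\<kappa>\<close> is a sum over common extensions, all of
  which lie in \<open>C\<close>. If \<open>\<xi>\<close> does not extend \<open>\<kappa>\<close>, they extend \<open>\<xi>\<close> properly and \<open>Q \<xi>\<close> kills them.
\<close>

lemma Q_q:
  assumes \<xi>: "\<xi> \<in> C" and \<kappa>: "\<kappa> \<in> C"
  shows "Q \<xi> \<otimes> q \<kappa> = (if extends \<kappa> \<xi> then Q \<xi> else \<zero>)"
proof -
  note P = C_paths[OF \<xi>] C_paths[OF \<kappa>]
  have self: "Q \<xi> \<otimes> q \<xi> = Q \<xi>" using q_Q_comm[OF \<xi> P(1) q_Q_self] \<xi> by simp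
  have "Q \<xi> \<otimes> q \<kappa> = Q \<xi> \<otimes> (q \<xi> \<otimes> q \<kappa>)" using self \<xi> P by (simp flip: m_assoc)
  also have "\<dots> = (if extends \<kappa> \<xi> then Q \<xi> else \<zero>)"
  proof (cases "extends \<kappa> \<xi>")
    case True
    then obtain \<alpha> where "\<alpha> \<in> P" "dmn \<kappa> = cod \<alpha>" "\<xi> = \<kappa> \<cdot> \<alpha>" unfolding extends_def by blast
    then have "q \<xi> \<otimes> q \<kappa> = q \<xi>" using q_q_comp P by simp
    then show ?thesis using True self by simp
  next
    case False
    have "Q \<xi> \<otimes> q (\<xi> \<cdot> \<alpha>) = \<zero>" if \<alpha>: "(\<alpha>, \<beta>) \<in> lambda_min \<Lambda> \<xi> \<kappa>" for \<alpha> \<beta>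
    proof -
      note * = \<alpha>[unfolded lambda_min_iff[OF P]]
      have "\<xi> \<cdot> \<alpha> \<in> C" using C_closed[OF \<xi> \<xi> \<kappa> refl refl \<alpha>] .
      moreover have "deg \<alpha> \<noteq> 0"
      proof
        assume "deg \<alpha> = 0"
        then have "\<xi> = \<kappa> \<cdot> \<beta>" using deg_0 * P by (metis path_simps(8))
        then show False using False * unfolding extends_def by blast
      qed
      ultimately have "\<alpha> \<in> tails \<xi>" using * by (simp add: tails_def)
      then have "Q \<xi> \<otimes> q (\<xi> \<cdot> \<alpha>) = adj A \<zero>"
        using \<open>\<xi> \<cdot> \<alpha> \<in> C\<close> C_paths by (intro q_Q_comm[OF \<xi>] q_Q_strict[OF \<xi>]) auto
      then show ?thesis by (simp only: adj_zero)
    qed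
    then have "Q \<xi> \<otimes> (q \<xi> \<otimes> q \<kappa>) = \<zero>"
      using \<xi> P unfolding q_mult[OF P]
      by (subst mult_finsum) (auto simp: lambda_min_iff intro!: finsum_all_zero)
    then show ?thesis using False by simp
  qed
  finally show ?thesis .
qed

lemma q_Q:
  assumes "\<xi> \<in> C" "\<kappa> \<in> C"
  shows "q \<kappa> \<otimes> Q \<xi> = (if extends \<kappa> \<xi> then Q \<xi> else \<zero>)"
proof -
  have "adj A (Q \<xi> \<otimes> q \<kappa>) = q \<kappa> \<otimes> Q \<xi>" using assms C_paths by simp
  then show ?thesis using Q_q[OF assms] assms by (auto split: if_splits)
qed

lemma Q_orth:
  assumes "\<xi> \<in> C" "\<eta> \<in> C" "\<xi> \<noteq> \<eta>"
  shows "Q \<xi> \<otimes> Q \<eta> = \<zero>"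
proof -
  note P = C_paths[OF assms(1)] C_paths[OF assms(2)]
  have 1: "Q \<xi> \<otimes> Q \<eta> = Q \<xi> \<otimes> q \<eta> \<otimes> Q \<eta>" using assms P by (simp add: m_assoc q_Q_self)
  show ?thesis
  proof (cases "extends \<eta> \<xi>")
    case False
    then show ?thesis using 1 assms by (simp add: Q_q)
  next
    case True
    then obtain \<nu> where \<nu>: "\<nu> \<in> P" "dmn \<eta> = cod \<nu>" "\<xi> = \<eta> \<cdot> \<nu>" "deg \<nu> \<noteq> 0"
      using extends_strict[OF P(2,1)] assms by metis
    then have "q \<xi> \<otimes> Q \<eta> = \<zero>" using q_Q_strict assms by (simp add: tails_def)
    moreover have "Q \<xi> \<otimes> Q \<eta> = Q \<xi> \<otimes> q \<xi> \<otimes> Q \<eta>"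
      using assms P Q_q[of \<xi> \<xi>] extends_refl[OF P(1)] by simp
    ultimately show ?thesis using assms P by (simp add: m_assoc)
  qed
qed

definition extC :: "'p \<Rightarrow> 'p set" where "extC \<kappa> = {\<xi> \<in> C. extends \<kappa> \<xi>}"

lemma finsum_Q_q:
  assumes "D \<subseteq> C" "\<kappa> \<in> C"
  shows "finsum A Q D \<otimes> q \<kappa> = finsum A Q (D \<inter> extC \<kappa>)"
proof -
  have D: "finite D" "Q \<in> D \<rightarrow> carrier A" using assms finite_C finite_subset by auto
  have "finsum A Q D \<otimes> q \<kappa> = finsum A (\<lambda>\<xi>. if extends \<kappa> \<xi> then Q \<xi> else \<zero>) D"
    using D assms C_paths by (subst finsum_mult) (auto simp: Q_q intro!: finsum_cong')
  also have "\<dots> = finsum A Q {\<xi> \<in> D. extends \<kappa> \<xi>}" by (rule finsum_if[OF D])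
  also have "{\<xi> \<in> D. extends \<kappa> \<xi>} = D \<inter> extC \<kappa>" using assms by (auto simp: extC_def)
  finally show ?thesis .
qed

lemma finsum_Q_closed [simp]: "D \<subseteq> C \<Longrightarrow> finsum A Q D \<in> carrier A"
  by (intro finsum_closed) auto

lemma adj_finsum_Q [simp]: "D \<subseteq> C \<Longrightarrow> adj A (finsum A Q D) = finsum A Q D"
  by (subst adj_finsum) (auto intro!: finsum_cong')

lemma extC_subset [simp]: "extC \<kappa> \<subseteq> C"
  by (auto simp: extC_def)

lemma extC_self: "\<kappa> \<in> C \<Longrightarrow> \<kappa> \<in> extC \<kappa>"
  using extends_refl C_paths by (simp add: extC_def)

text \<open>
  Induction from long paths to short ones. Let \<open>x\<close> be the difference of the two sides. By induction
  it is annihilated by the range projections of all proper extensions of \<open>\<kappa>\<close> in \<open>C\<close>, so the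
  compression \<open>y\<close> of \<open>x\<close> by $s_\kappa$ is unchanged under multiplication by the gap of the tails.
  But that product vanishes, since \<open>Q \<kappa>\<close> is the only term of the sum that the gap does not kill.
\<close>

lemma q_eq_sum_Q:
  assumes "\<kappa> \<in> C"
  shows "q \<kappa> = finsum A Q (extC \<kappa>)"
  using assms
proof (induction "card (extC \<kappa>)" arbitrary: \<kappa> rule: less_induct)
  case less
  note \<kappa> = C_paths[OF less.prems]
  let ?R = "finsum A Q (extC \<kappa>)" and ?g = "tail_gap \<kappa>"
  have [simp]: "?g \<in> carrier A" "?R \<in> carrier A" "s \<kappa> \<in> carrier A" using less.prems \<kappa> by simp_all
  define x where "x = q \<kappa> \<ominus> ?R"
  define y where "y = adj A (s \<kappa>) \<otimes> x \<otimes> s \<kappa>"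
  have x [simp]: "x \<in> carrier A" using \<kappa> by (simp add: x_def)
  have R_q: "?R \<otimes> q \<kappa> = ?R" using finsum_Q_q[OF extC_subset less.prems] by simp
  have "y \<otimes> ?g = y"
    unfolding tail_gap_def
  proof (rule gap_absorb[OF tails[OF less.prems]])
    show "y \<in> carrier A" using \<kappa> by (simp add: y_def)
    show "y \<otimes> s (dmn \<kappa>) = y" using \<kappa> by (simp add: y_def m_assoc s_units)
  next
    fix \<nu> assume \<nu>: "\<nu> \<in> tails \<kappa>"
    let ?\<eta> = "\<kappa> \<cdot> \<nu>"
    have \<nu>': "\<nu> \<in> P" "dmn \<kappa> = cod \<nu>" "deg \<nu> \<noteq> 0" "?\<eta> \<in> C" using \<nu> by (auto simp: tails_def)
    have ext: "extends \<kappa> ?\<eta>" using \<nu>' \<kappa> by (intro extends_comp)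
    have sub: "extC ?\<eta> \<subseteq> extC \<kappa>" using extends_trans[OF \<kappa> ext] by (auto simp: extC_def)
    have "\<kappa> \<notin> extC ?\<eta>"
    proof
      assume "\<kappa> \<in> extC ?\<eta>"
      then have "deg ?\<eta> \<le> deg \<kappa>" using extends_deg_le[of ?\<eta> \<kappa>] \<nu>' C_paths by (simp add: extC_def)
      then have "deg \<nu> = 0" using \<nu>' \<kappa> by (simp add: less_eq_vec_def vec_eq_iff)
      then show False using \<nu>' by simp
    qed
    then have "extC ?\<eta> \<subset> extC \<kappa>" using sub extC_self[OF less.prems] by blast
    then have "card (extC ?\<eta>) < card (extC \<kappa>)"
      using finite_C extC_subset by (meson finite_subset psubset_card_mono)
    then have IH: "q ?\<eta> = finsum A Q (extC ?\<eta>)" using less.hyps \<nu>' by blast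
    have "?R \<otimes> q ?\<eta> = finsum A Q (extC ?\<eta>)"
      using finsum_Q_q[OF extC_subset \<nu>'(4)] sub by (simp add: Int_absorb1)
    then have "x \<otimes> q ?\<eta> = \<zero>"
      unfolding x_def using \<nu>' \<kappa> C_paths[OF \<nu>'(4)] q_q_comp(1)[of \<kappa> \<nu>]
      by (simp add: mult_diff_left flip: IH)
    then have "adj A (s \<kappa>) \<otimes> (x \<otimes> q ?\<eta>) \<otimes> s \<kappa> = \<zero>" using \<kappa> by simp
    moreover have "y \<otimes> q \<nu> = adj A (s \<kappa>) \<otimes> x \<otimes> (s \<kappa> \<otimes> q \<nu>)" using \<kappa> \<nu>' by (simp add: y_def m_assoc)
    moreover have "\<dots> = adj A (s \<kappa>) \<otimes> (x \<otimes> q ?\<eta>) \<otimes> s \<kappa>"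
      using \<kappa> \<nu>' C_paths[OF \<nu>'(4)] by (simp add: m_assoc flip: q_comp_s)
    ultimately show "y \<otimes> q \<nu> = \<zero>" by simp
  qed
  moreover have "y \<otimes> ?g = \<zero>"
  proof -
    have Qs: "Q \<xi> \<otimes> (s \<kappa> \<otimes> ?g) = (if \<xi> = \<kappa> then s \<kappa> \<otimes> ?g else \<zero>)" if \<xi>: "\<xi> \<in> extC \<kappa>" for \<xi>
    proof (cases "\<xi> = \<kappa>")
      case True
      then show ?thesis using source_cancel[OF less.prems, of ?g] less.prems \<kappa>
        by (simp add: Q_def unit_def m_assoc)
    next
      case False
      have \<xi>C: "\<xi> \<in> C" "\<xi> \<in> P" using \<xi> C_paths by (auto simp: extC_def)
      then obtain \<nu> where \<nu>: "\<nu> \<in> P" "dmn \<kappa> = cod \<nu>" "\<xi> = \<kappa> \<cdot> \<nu>" "deg \<nu> \<noteq> 0"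
        using extends_strict[OF \<kappa>] \<xi> False unfolding extC_def by (metis mem_Collect_eq)
      then have "\<nu> \<in> tails \<kappa>" using \<xi>C by (simp add: tails_def)
      then have kill: "q \<nu> \<otimes> ?g = \<zero>" using gap_kill[OF tails[OF less.prems]] by (simp add: tail_gap_def)
      have "Q \<xi> \<otimes> (s \<kappa> \<otimes> ?g) = Q \<xi> \<otimes> q \<xi> \<otimes> (s \<kappa> \<otimes> ?g)"
        using Q_q[OF \<xi>C(1) \<xi>C(1)] extC_self[OF \<xi>C(1)] by (simp add: extC_def)
      also have "\<dots> = Q \<xi> \<otimes> ((q \<xi> \<otimes> s \<kappa>) \<otimes> ?g)" using \<xi>C by (simp add: m_assoc)
      also have "\<dots> = Q \<xi> \<otimes> (s \<kappa> \<otimes> (q \<nu> \<otimes> ?g))" using \<nu> \<kappa> \<xi>C by (simp add: q_comp_s m_assoc)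
      finally show ?thesis using kill \<xi>C False by simp
    qed
    have fin: "finite (extC \<kappa>)" using finite_C extC_subset by (rule finite_subset[rotated])
    have Qc: "Q \<in> extC \<kappa> \<rightarrow> carrier A" by (auto simp: extC_def)
    have "?R \<otimes> (s \<kappa> \<otimes> ?g) = finsum A (\<lambda>\<xi>. Q \<xi> \<otimes> (s \<kappa> \<otimes> ?g)) (extC \<kappa>)"
      using Qc by (intro finsum_mult) auto
    also have "\<dots> = s \<kappa> \<otimes> ?g"
      using Qs[OF extC_self[OF less.prems]] Qs extC_self[OF less.prems] fin Qc
      by (subst finsum_only[of _ \<kappa>]) auto
    finally have "x \<otimes> (s \<kappa> \<otimes> ?g) = \<zero>"
      using \<kappa> by (simp add: x_def mult_diff_left q_s flip: m_assoc)
    then show ?thesis using \<kappa> by (simp add: y_def m_assoc)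
  qed
  ultimately have "y = \<zero>" by simp
  moreover have "s \<kappa> \<otimes> y \<otimes> adj A (s \<kappa>) = q \<kappa> \<otimes> x \<otimes> q \<kappa>"
    using \<kappa> by (simp add: y_def q_def ss_def m_assoc)
  moreover have "x \<otimes> q \<kappa> = x" using \<kappa> R_q by (simp add: x_def mult_diff_left q_idem)
  moreover have "q \<kappa> \<otimes> x = x"
  proof -
    have "adj A x = x" using \<kappa> by (simp add: x_def)
    then show ?thesis using \<open>x \<otimes> q \<kappa> = x\<close> \<kappa> x by (metis adj_mult adj_q q_closed)
  qed
  ultimately have "x = \<zero>" using \<kappa> by simp
  then show ?case using \<kappa> by (simp add: x_def diff_eq_zero)
qed

end

section \<open>The core\<close>

inductive_set (in tck) ss_span :: "('p \<times> 'p) set \<Rightarrow> 'a set" for R where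
  zero: "\<zero> \<in> ss_span R"
| add: "(\<kappa>, \<mu>) \<in> R \<Longrightarrow> x \<in> ss_span R \<Longrightarrow> c \<odot> ss \<kappa> \<mu> \<oplus> x \<in> ss_span R"

context tck
begin

definition parallel :: "('p \<times> 'p) set" where
  "parallel = {(\<kappa>, \<mu>). \<kappa> \<in> P \<and> \<mu> \<in> P \<and> dmn \<kappa> = dmn \<mu>}"

lemma parallelD: "(\<kappa>, \<mu>) \<in> parallel \<Longrightarrow> \<kappa> \<in> P \<and> \<mu> \<in> P \<and> dmn \<kappa> = dmn \<mu>"
  by (simp add: parallel_def)

lemma ss_span_closed:
  assumes R: "R \<subseteq> parallel" and "x \<in> ss_span R"
  shows "x \<in> carrier A"
  using assms(2) by induction (use R parallelD in auto)

lemma ss_span_mono: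
  assumes "R \<subseteq> R'" "x \<in> ss_span R"
  shows "x \<in> ss_span R'"
  using assms(2) by induction (use assms(1) in \<open>auto intro: ss_span.intros\<close>)

lemma ss_in_span:
  assumes "(\<kappa>, \<mu>) \<in> R" "R \<subseteq> parallel"
  shows "ss \<kappa> \<mu> \<in> ss_span R"
  using ss_span.add[OF assms(1) ss_span.zero, of 1] parallelD assms by auto

lemma ss_span_add:
  assumes R: "R \<subseteq> parallel" and x: "x \<in> ss_span R" and y: "y \<in> ss_span R"
  shows "x \<oplus> y \<in> ss_span R"
  using x
proof induction
  case zero
  then show ?case using y ss_span_closed[OF R] by simp
next
  case (add \<kappa> \<mu> x c)
  then have "(c \<odot> ss \<kappa> \<mu> \<oplus> x) \<oplus> y = c \<odot> ss \<kappa> \<mu> \<oplus> (x \<oplus> y)"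
    using y ss_span_closed[OF R] R parallelD by (intro a_assoc) auto
  then show ?case using add ss_span.add by metis
qed

lemma ss_span_smult:
  assumes R: "R \<subseteq> parallel" and x: "x \<in> ss_span R"
  shows "c \<odot> x \<in> ss_span R"
  using x
proof induction
  case zero
  then show ?case by (simp add: ss_span.zero)
next
  case (add \<kappa> \<mu> x d)
  then have "c \<odot> (d \<odot> ss \<kappa> \<mu> \<oplus> x) = (c * d) \<odot> ss \<kappa> \<mu> \<oplus> c \<odot> x"
    using ss_span_closed[OF R] R parallelD by (subst smult_add) auto
  then show ?case using add ss_span.add by metis
qed

lemma ss_span_finsum:
  assumes R: "R \<subseteq> parallel" and "finite I" "\<And>i. i \<in> I \<Longrightarrow> f i \<in> ss_span R"
  shows "finsum A f I \<in> ss_span R"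
  using assms(2,3)
proof (induction I)
  case (insert i I)
  then have "finsum A f (insert i I) = f i \<oplus> finsum A f I"
    using ss_span_closed[OF R] by (intro finsum_insert) auto
  then show ?case using insert ss_span_add[OF R] by simp
qed (simp add: ss_span.zero)

text \<open>
  The map \<open>h\<close> on scalars lets the lemma cover the adjoint, which is conjugate linear.
\<close>

lemma ss_span_linear:
  assumes R: "R \<subseteq> parallel" and R': "R' \<subseteq> parallel"
    and F: "\<And>x. x \<in> carrier A \<Longrightarrow> F x \<in> carrier A"
      "\<And>x y. x \<in> carrier A \<Longrightarrow> y \<in> carrier A \<Longrightarrow> F (x \<oplus> y) = F x \<oplus> F y"
      "\<And>c x. x \<in> carrier A \<Longrightarrow> F (c \<odot> x) = h c \<odot> F x"
    and gen: "\<And>\<kappa> \<mu>. (\<kappa>, \<mu>) \<in> R \<Longrightarrow> F (ss \<kappa> \<mu>) \<in> ss_span R'"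
    and x: "x \<in> ss_span R"
  shows "F x \<in> ss_span R'"
  using x
proof induction
  case zero
  have "F \<zero> \<oplus> F \<zero> = F \<zero>" using F(2)[of \<zero> \<zero>] by simp
  then have "F \<zero> = \<zero>" using F(1)[of \<zero>] add_eq_self by blast
  then show ?case by (simp add: ss_span.zero)
next
  case (add \<kappa> \<mu> x c)
  then have "F (c \<odot> ss \<kappa> \<mu> \<oplus> x) = h c \<odot> F (ss \<kappa> \<mu>) \<oplus> F x"
    using ss_span_closed[OF R] R parallelD by (subst F(2)) (auto simp: F(3))
  then show ?case using add gen ss_span_add[OF R'] ss_span_smult[OF R'] by simp
qed

lemma ss_span_mult:
  assumes R: "R \<subseteq> parallel" "R' \<subseteq> parallel" "R'' \<subseteq> parallel"
    and RR': "\<And>\<kappa> \<mu> \<sigma> \<tau> \<alpha> \<beta>. (\<kappa>, \<mu>) \<in> R \<Longrightarrow> (\<sigma>, \<tau>) \<in> R' \<Longrightarrow> (\<alpha>, \<beta>) \<in> lambda_min \<Lambda> \<mu> \<sigma> \<Longrightarrow>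
        (\<kappa> \<cdot> \<alpha>, \<tau> \<cdot> \<beta>) \<in> R''"
    and x: "x \<in> ss_span R" and y: "y \<in> ss_span R'"
  shows "x \<otimes> y \<in> ss_span R''"
proof (rule ss_span_linear[OF R(1,3), where F = "\<lambda>x. x \<otimes> y" and h = "\<lambda>c. c", OF _ _ _ _ x])
  have yc: "y \<in> carrier A" using ss_span_closed R y by blast
  show "(x \<oplus> x') \<otimes> y = x \<otimes> y \<oplus> x' \<otimes> y" if "x \<in> carrier A" "x' \<in> carrier A" for x x'
    using that yc by (simp add: l_distr)
  show "(c \<odot> x) \<otimes> y = c \<odot> (x \<otimes> y)" "x \<otimes> y \<in> carrier A" if "x \<in> carrier A" for x c
    using that yc by simp_all
  fix \<kappa> \<mu> assume k: "(\<kappa>, \<mu>) \<in> R"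
  then have kP: "\<kappa> \<in> P" "\<mu> \<in> P" "dmn \<kappa> = dmn \<mu>" using R parallelD by blast+
  show "ss \<kappa> \<mu> \<otimes> y \<in> ss_span R''"
  proof (rule ss_span_linear[OF R(2,3), where F = "\<lambda>y. ss \<kappa> \<mu> \<otimes> y" and h = "\<lambda>c. c", OF _ _ _ _ y])
    show "ss \<kappa> \<mu> \<otimes> (x \<oplus> x') = ss \<kappa> \<mu> \<otimes> x \<oplus> ss \<kappa> \<mu> \<otimes> x'" if "x \<in> carrier A" "x' \<in> carrier A" for x x'
      using that kP by (simp add: r_distr)
    show "ss \<kappa> \<mu> \<otimes> (c \<odot> x) = c \<odot> (ss \<kappa> \<mu> \<otimes> x)" "ss \<kappa> \<mu> \<otimes> x \<in> carrier A" if "x \<in> carrier A" for x c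
      using that kP by simp_all
    fix \<sigma> \<tau> assume t: "(\<sigma>, \<tau>) \<in> R'"
    then have tP: "\<sigma> \<in> P" "\<tau> \<in> P" "dmn \<sigma> = dmn \<tau>" using R parallelD by blast+
    show "ss \<kappa> \<mu> \<otimes> ss \<sigma> \<tau> \<in> ss_span R''"
      unfolding ss_mult[OF kP(1,2) tP(1,2) kP(3) tP(3)]
    proof (rule ss_span_finsum[OF R(3)])
      show "finite (lambda_min \<Lambda> \<mu> \<sigma>)" using kP tP by simp
      fix p assume "p \<in> lambda_min \<Lambda> \<mu> \<sigma>"
      then show "(case p of (\<alpha>, \<beta>) \<Rightarrow> ss (\<kappa> \<cdot> \<alpha>) (\<tau> \<cdot> \<beta>)) \<in> ss_span R''"
        using RR'[OF k t] ss_in_span[OF _ R(3)] by (cases p) simp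
    qed
  qed
qed

lemma ss_span_adj:
  assumes R: "R \<subseteq> parallel" "R' \<subseteq> parallel" and RR': "\<And>\<kappa> \<mu>. (\<kappa>, \<mu>) \<in> R \<Longrightarrow> (\<mu>, \<kappa>) \<in> R'" and x: "x \<in> ss_span R"
  shows "adj A x \<in> ss_span R'"
proof (rule ss_span_linear[OF R, where F = "adj A" and h = cnj, OF _ _ _ _ x])
  fix \<kappa> \<mu> assume k: "(\<kappa>, \<mu>) \<in> R"
  then have "\<kappa> \<in> P" "\<mu> \<in> P" using R parallelD by blast+
  then show "adj A (ss \<kappa> \<mu>) \<in> ss_span R'" using ss_in_span[OF RR'[OF k] R(2)] by simp
qed auto

lemma ss_span_finite:
  assumes "R \<subseteq> parallel" "x \<in> ss_span R"
  shows "\<exists>E. finite E \<and> E \<subseteq> P \<and> x \<in> ss_span (R \<inter> E \<times> E)"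
  using assms(2)
proof induction
  case zero
  then show ?case using ss_span.zero by blast
next
  case (add \<kappa> \<mu> x c)
  then obtain E where E: "finite E" "E \<subseteq> P" "x \<in> ss_span (R \<inter> E \<times> E)" by blast
  let ?E = "insert \<kappa> (insert \<mu> E)"
  have "x \<in> ss_span (R \<inter> ?E \<times> ?E)" by (rule ss_span_mono[OF _ E(3)]) blast
  then have "c \<odot> ss \<kappa> \<mu> \<oplus> x \<in> ss_span (R \<inter> ?E \<times> ?E)" using add by (intro ss_span.add) auto
  moreover have "?E \<subseteq> P" using E add assms(1) parallelD by auto
  ultimately show ?case using E by (intro exI[of _ ?E]) auto
qed

lemma s_nrm_le_1:
  assumes "\<kappa> \<in> P"
  shows "nrm A (s \<kappa>) \<le> 1"
proof -
  have "(nrm A (s \<kappa>))\<^sup>2 = nrm A (s (dmn \<kappa>))" using nrm_adj_mult[of "s \<kappa>"] assms by (simp add: s_source)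
  also have "\<dots> \<le> 1" using nrm_projection[of "s (dmn \<kappa>)"] assms by (simp add: s_vertex)
  finally show ?thesis by (simp add: power_le_one_iff abs_square_le_1[symmetric] assms flip: abs_square_le_1)
qed

end

context tck_core
begin

definition core_pairs :: "('p \<times> 'p) set" where
  "core_pairs = {(\<kappa>, \<mu>). \<kappa> \<in> C \<and> \<mu> \<in> C \<and> deg \<kappa> = deg \<mu> \<and> dmn \<kappa> = dmn \<mu>}"

lemma core_pairs_parallel: "core_pairs \<subseteq> parallel"
  using C_paths by (auto simp: core_pairs_def parallel_def)

lemma finsum_Q_ss:
  assumes "\<kappa> \<in> C" "\<mu> \<in> C"
  shows "finsum A Q C \<otimes> ss \<kappa> \<mu> = ss \<kappa> \<mu>" "ss \<kappa> \<mu> \<otimes> finsum A Q C = ss \<kappa> \<mu>"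
proof -
  have *: "finsum A Q C \<otimes> ss \<kappa> \<mu> = ss \<kappa> \<mu>" if "\<kappa> \<in> C" "\<mu> \<in> C" for \<kappa> \<mu>
  proof -
    have P: "\<kappa> \<in> P" "\<mu> \<in> P" using that C_paths by auto
    have "finsum A Q C \<otimes> q \<kappa> = q \<kappa>"
      using finsum_Q_q[OF subset_refl that(1)] extC_subset[of \<kappa>] q_eq_sum_Q[OF that(1)] by (simp add: Int_absorb1)
    then have "finsum A Q C \<otimes> (q \<kappa> \<otimes> ss \<kappa> \<mu>) = q \<kappa> \<otimes> ss \<kappa> \<mu>" using P by (simp flip: m_assoc)
    then show ?thesis using P by (simp add: q_ss)
  qed
  then show "finsum A Q C \<otimes> ss \<kappa> \<mu> = ss \<kappa> \<mu>" using assms by blast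
  have "adj A (finsum A Q C \<otimes> ss \<mu> \<kappa>) = adj A (ss \<mu> \<kappa>)" using * assms by simp
  then show "ss \<kappa> \<mu> \<otimes> finsum A Q C = ss \<kappa> \<mu>" using assms C_paths by simp
qed

text \<open>
  If \<open>\<eta> = \<mu> \<cdot> \<nu>\<close>, then $s_\kappa s_\mu^*$ carries \<open>Q \<eta>\<close> to the matrix unit of \<open>\<kappa> \<cdot> \<nu>\<close> and \<open>\<eta>\<close>,
  because \<open>\<kappa> \<cdot> \<nu>\<close> and \<open>\<mu> \<cdot> \<nu>\<close> have the same tails; otherwise it kills \<open>Q \<eta>\<close>.
\<close>

lemma Q_ss_Q:
  assumes k: "(\<kappa>, \<mu>) \<in> core_pairs" and \<xi>: "\<xi> \<in> C" and \<eta>: "\<eta> \<in> C"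
  shows "\<exists>a. Q \<xi> \<otimes> ss \<kappa> \<mu> \<otimes> Q \<eta> = a \<odot> unit \<xi> \<eta>"
proof -
  have kC: "\<kappa> \<in> C" "\<mu> \<in> C" "deg \<kappa> = deg \<mu>" "dmn \<kappa> = dmn \<mu>" using k by (auto simp: core_pairs_def)
  have P: "\<kappa> \<in> P" "\<mu> \<in> P" "\<xi> \<in> P" "\<eta> \<in> P" using kC \<xi> \<eta> C_paths by auto
  show ?thesis
  proof (cases "extends \<mu> \<eta>")
    case False
    have "ss \<kappa> \<mu> \<otimes> q \<mu> = ss \<kappa> \<mu>" using q_ss[of \<mu> \<kappa>, THEN arg_cong[of _ _ "adj A"]] P by simp
    then have "ss \<kappa> \<mu> \<otimes> Q \<eta> = ss \<kappa> \<mu> \<otimes> (q \<mu> \<otimes> Q \<eta>)" using P \<eta> by (simp flip: m_assoc)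
    then have "ss \<kappa> \<mu> \<otimes> Q \<eta> = \<zero>" using q_Q[OF \<eta> kC(2)] False P by simp
    then have "Q \<xi> \<otimes> ss \<kappa> \<mu> \<otimes> Q \<eta> = 0 \<odot> unit \<xi> \<eta>" using P \<xi> \<eta> by (simp add: m_assoc)
    then show ?thesis by blast
  next
    case True
    then obtain \<nu> where \<nu>: "\<nu> \<in> P" "dmn \<mu> = cod \<nu>" "\<eta> = \<mu> \<cdot> \<nu>" unfolding extends_def by blast
    define \<zeta> where "\<zeta> = \<kappa> \<cdot> \<nu>"
    have \<zeta>: "\<zeta> \<in> C" unfolding \<zeta>_def by (rule C_shift[of \<kappa> \<mu>]) (use kC \<nu> \<eta> in auto)
    have \<zeta>\<eta>: "deg \<zeta> = deg \<eta>" "dmn \<zeta> = dmn \<eta>" using \<nu> kC P by (simp_all add: \<zeta>_def)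
    have "ss \<kappa> \<mu> \<otimes> s \<eta> = s \<zeta>"
    proof -
      have "ss \<kappa> \<mu> \<otimes> s \<eta> = s \<kappa> \<otimes> (adj A (s \<mu>) \<otimes> s \<mu>) \<otimes> s \<nu>"
        using P \<nu> by (simp add: ss_def m_assoc flip: s_comp)
      also have "\<dots> = s \<kappa> \<otimes> s \<nu>" using P kC(4)[symmetric] by (simp add: s_source s_units)
      finally show ?thesis using P \<nu> kC by (simp add: \<zeta>_def s_comp)
    qed
    then have "ss \<kappa> \<mu> \<otimes> Q \<eta> = unit \<zeta> \<eta>"
      using P \<eta> by (simp add: Q_def unit_def flip: m_assoc)
    moreover have "\<dots> = Q \<zeta> \<otimes> unit \<zeta> \<eta>" using Q_unit[OF \<zeta> \<eta> \<zeta>\<eta>] by simp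
    ultimately have eq: "Q \<xi> \<otimes> ss \<kappa> \<mu> \<otimes> Q \<eta> = Q \<xi> \<otimes> Q \<zeta> \<otimes> unit \<zeta> \<eta>"
      using P \<xi> \<eta> \<zeta> by (simp add: m_assoc)
    show ?thesis
    proof (cases "\<xi> = \<zeta>")
      case True
      then have "Q \<xi> \<otimes> ss \<kappa> \<mu> \<otimes> Q \<eta> = 1 \<odot> unit \<xi> \<eta>"
        unfolding eq using \<zeta> \<eta> Q_unit[OF \<zeta> \<eta> \<zeta>\<eta>] by (simp add: Q_idem)
      then show ?thesis by blast
    next
      case False
      then have "Q \<xi> \<otimes> ss \<kappa> \<mu> \<otimes> Q \<eta> = 0 \<odot> unit \<xi> \<eta>"
        unfolding eq using \<xi> \<zeta> \<eta> by (simp add: Q_orth)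
      then show ?thesis by blast
    qed
  qed
qed

lemma core_matrix_form:
  assumes "x \<in> ss_span core_pairs"
  shows "finsum A Q C \<otimes> x = x \<and> x \<otimes> finsum A Q C = x \<and>
    (\<forall>\<xi>\<in>C. \<forall>\<eta>\<in>C. \<exists>a. Q \<xi> \<otimes> x \<otimes> Q \<eta> = a \<odot> unit \<xi> \<eta>)"
  using assms
proof induction
  case zero
  have "Q \<xi> \<otimes> \<zero> \<otimes> Q \<eta> = 0 \<odot> unit \<xi> \<eta>" if "\<xi> \<in> C" "\<eta> \<in> C" for \<xi> \<eta> using that by simp
  then show ?case by (metis finsum_Q_closed mult_zero subset_refl zero_mult)
next
  case (add \<kappa> \<mu> x c)
  have k: "\<kappa> \<in> C" "\<mu> \<in> C" "ss \<kappa> \<mu> \<in> carrier A" using add C_paths by (auto simp: core_pairs_def)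
  have x: "x \<in> carrier A" using add ss_span_closed[OF core_pairs_parallel] by blast
  have "\<exists>a. Q \<xi> \<otimes> (c \<odot> ss \<kappa> \<mu> \<oplus> x) \<otimes> Q \<eta> = a \<odot> unit \<xi> \<eta>" if C: "\<xi> \<in> C" "\<eta> \<in> C" for \<xi> \<eta>
  proof -
    obtain a b where ab: "Q \<xi> \<otimes> x \<otimes> Q \<eta> = a \<odot> unit \<xi> \<eta>" "Q \<xi> \<otimes> ss \<kappa> \<mu> \<otimes> Q \<eta> = b \<odot> unit \<xi> \<eta>"
      using add Q_ss_Q C by meson
    have "Q \<xi> \<otimes> (c \<odot> ss \<kappa> \<mu> \<oplus> x) \<otimes> Q \<eta> = c \<odot> (Q \<xi> \<otimes> ss \<kappa> \<mu> \<otimes> Q \<eta>) \<oplus> Q \<xi> \<otimes> x \<otimes> Q \<eta>"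
      using C k x by (simp add: l_distr r_distr)
    also have "\<dots> = (c * b + a) \<odot> unit \<xi> \<eta>" using C by (simp add: ab smult_add_left)
    finally show ?thesis by blast
  qed
  then show ?case using add k x finsum_Q_ss[OF k(1,2)] by (simp add: l_distr r_distr)
qed

text \<open>
  The entries of \<open>x\<close> are multiples of the \<open>unit \<xi> \<eta>\<close>. Such an element is zero if the sources
  differ; otherwise it has the norm of its gap projection, which is 0 or 1, and by hypothesis \<open>\<phi>\<close>
  does not change that norm. So each entry of \<open>x\<close> is bounded by
  the norm of the corresponding entry of \<open>\<phi> x\<close>. The number of entries enters the constant.
\<close>

lemma core_nrm_bound:
  assumes hom: "cstar_hom A B \<phi>"
    and gap: "\<And>v T. v \<in> vertices \<Lambda> \<Longrightarrow> finite T \<Longrightarrow> T \<subseteq> paths_to \<Lambda> v - {v} \<Longrightarrow>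
        \<phi> (gap v T) = \<zero>\<^bsub>B\<^esub> \<Longrightarrow> gap v T = \<zero>"
    and x: "x \<in> ss_span core_pairs"
  shows "nrm A x \<le> (real (card C))\<^sup>2 * nrm B (\<phi> x)"
proof -
  interpret \<phi>: cstar_hom A B \<phi> by (rule hom)
  have xc: "x \<in> carrier A" using x ss_span_closed[OF core_pairs_parallel] by blast
  note form = core_matrix_form[OF x]
  have gap_nrm: "nrm A (tail_gap \<eta>) = nrm B (\<phi> (tail_gap \<eta>))" if \<eta>: "\<eta> \<in> C" for \<eta>
  proof -
    have "dmn \<eta> \<notin> tails \<eta>" using C_paths[OF \<eta>] by (auto simp: tails_def)
    then have "\<phi> (tail_gap \<eta>) = \<zero>\<^bsub>B\<^esub> \<longleftrightarrow> tail_gap \<eta> = \<zero>"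
      unfolding tail_gap_def using gap[OF tails(1,2)[OF \<eta>]] tails(3)[OF \<eta>] by auto
    moreover have "nrm B (\<phi> (tail_gap \<eta>)) = (if \<phi> (tail_gap \<eta>) = \<zero>\<^bsub>B\<^esub> then 0 else 1)"
      using \<eta> tail_gap_idem[OF \<eta>]
      by (intro \<phi>.B.nrm_projection) (auto simp flip: \<phi>.hom_adj \<phi>.hom_mult)
    moreover have "nrm A (tail_gap \<eta>) = (if tail_gap \<eta> = \<zero> then 0 else 1)"
      using \<eta> by (intro nrm_projection) (auto simp: tail_gap_idem)
    ultimately show ?thesis by simp
  qed
  have contr: "nrm B (\<phi> u) \<le> 1" if "u \<in> carrier A" "nrm A u \<le> 1" for u
    using \<phi>.contractive[OF that(1)] that(2) by simp
  have prod3: "nrm D (u \<otimes>\<^bsub>D\<^esub> w \<otimes>\<^bsub>D\<^esub> y) \<le> nrm D w"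
    if "cstar D" "u \<in> carrier D" "w \<in> carrier D" "y \<in> carrier D" "nrm D u \<le> 1" "nrm D y \<le> 1" for D :: "'x cstar" and u w y
  proof -
    interpret D: cstar D by fact
    have "nrm D (u \<otimes>\<^bsub>D\<^esub> w \<otimes>\<^bsub>D\<^esub> y) \<le> nrm D (u \<otimes>\<^bsub>D\<^esub> w) * nrm D y" using that by (intro D.nrm_mult) auto
    also have "\<dots> \<le> nrm D (u \<otimes>\<^bsub>D\<^esub> w) * 1" using that by (intro mult_left_mono) auto
    also have "\<dots> \<le> nrm D u * nrm D w" using that by (simp add: D.nrm_mult)
    also have "\<dots> \<le> 1 * nrm D w" using that by (intro mult_right_mono) auto
    finally show ?thesis by simp
  qed
  have Q_nrm: "nrm A (Q \<xi>) \<le> 1" if "\<xi> \<in> C" for \<xi>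
    using nrm_projection[of "Q \<xi>"] that by (simp add: Q_idem)
  have unit_nrm: "nrm A (unit \<xi> \<eta>) \<le> nrm B (\<phi> (unit \<xi> \<eta>))" if C: "\<xi> \<in> C" "\<eta> \<in> C" for \<xi> \<eta>
  proof (cases "dmn \<xi> = dmn \<eta>")
    case True
    note P = C_paths[OF C(1)] C_paths[OF C(2)]
    have "nrm A (unit \<xi> \<eta>) \<le> nrm A (tail_gap \<eta>)"
      unfolding unit_def using C P s_nrm_le_1 by (intro prod3 cstar_axioms) auto
    also have "\<dots> = nrm B (\<phi> (tail_gap \<eta>))" by (rule gap_nrm[OF C(2)])
    also have "tail_gap \<eta> = adj A (s \<xi>) \<otimes> unit \<xi> \<eta> \<otimes> s \<eta>"
    proof -
      have "adj A (s \<xi>) \<otimes> unit \<xi> \<eta> \<otimes> s \<eta> = (adj A (s \<xi>) \<otimes> s \<xi>) \<otimes> tail_gap \<eta> \<otimes> (adj A (s \<eta>) \<otimes> s \<eta>)"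
        using C P by (simp add: unit_def m_assoc)
      then show ?thesis using C P by (simp add: s_source True tail_gap_vertex)
    qed
    also have "nrm B (\<phi> (adj A (s \<xi>) \<otimes> unit \<xi> \<eta> \<otimes> s \<eta>)) \<le> nrm B (\<phi> (unit \<xi> \<eta>))"
      using C P contr[OF s_closed s_nrm_le_1] by (simp add: prod3 \<phi>.B.cstar_axioms)
    finally show ?thesis .
  next
    case False
    note P = C_paths[OF C(1)] C_paths[OF C(2)]
    have "s \<xi> \<otimes> tail_gap \<eta> = s \<xi> \<otimes> (s (dmn \<xi>) \<otimes> s (dmn \<eta>)) \<otimes> tail_gap \<eta>"
      using C P by (simp add: m_assoc tail_gap_vertex) (simp add: s_units flip: m_assoc)
    then have "unit \<xi> \<eta> = \<zero>" using C P False by (simp add: unit_def s_vertex_orth)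
    then show ?thesis by simp
  qed
  have entry: "nrm A (Q \<xi> \<otimes> x \<otimes> Q \<eta>) \<le> nrm B (\<phi> x)" if C: "\<xi> \<in> C" "\<eta> \<in> C" for \<xi> \<eta>
  proof -
    obtain a where a: "Q \<xi> \<otimes> x \<otimes> Q \<eta> = a \<odot> unit \<xi> \<eta>" using form C by blast
    have "nrm A (Q \<xi> \<otimes> x \<otimes> Q \<eta>) \<le> nrm B (\<phi> (Q \<xi> \<otimes> x \<otimes> Q \<eta>))"
      unfolding a using C unit_nrm[OF C] by (simp add: mult_left_mono)
    also have "\<dots> \<le> nrm B (\<phi> x)"
      using C xc contr[OF Q_closed Q_nrm] by (simp add: prod3 \<phi>.B.cstar_axioms)
    finally show ?thesis .
  qed
  have Qc: "Q \<in> C \<rightarrow> carrier A" by simp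
  have row: "nrm A (Q \<xi> \<otimes> x) \<le> real (card C) * nrm B (\<phi> x)" if \<xi>: "\<xi> \<in> C" for \<xi>
  proof -
    have "Q \<xi> \<otimes> x = Q \<xi> \<otimes> x \<otimes> finsum A Q C" using form \<xi> xc by (simp add: m_assoc)
    also have "\<dots> = finsum A (\<lambda>\<eta>. Q \<xi> \<otimes> x \<otimes> Q \<eta>) C" using Qc \<xi> xc by (intro mult_finsum) auto
    finally have "nrm A (Q \<xi> \<otimes> x) \<le> (\<Sum>\<eta>\<in>C. nrm A (Q \<xi> \<otimes> x \<otimes> Q \<eta>))"
      using nrm_finsum[OF finite_C, of "\<lambda>\<eta>. Q \<xi> \<otimes> x \<otimes> Q \<eta>"] \<xi> xc by simp
    also have "\<dots> \<le> (\<Sum>\<eta>\<in>C. nrm B (\<phi> x))" using entry \<xi> by (intro sum_mono) auto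
    finally show ?thesis by simp
  qed
  have "x = finsum A (\<lambda>\<xi>. Q \<xi> \<otimes> x) C" using form finsum_mult[OF Qc xc] by simp
  then have "nrm A x \<le> (\<Sum>\<xi>\<in>C. nrm A (Q \<xi> \<otimes> x))"
    using nrm_finsum[OF finite_C, of "\<lambda>\<xi>. Q \<xi> \<otimes> x"] xc by simp
  also have "\<dots> \<le> (\<Sum>\<xi>\<in>C. real (card C) * nrm B (\<phi> x))" using row by (intro sum_mono) auto
  finally show ?thesis by (simp add: power2_eq_square)
qed

end

context tck
begin

lemma FE_nonempty: "v \<in> vertices \<Lambda> \<Longrightarrow> exhaustive \<Lambda> v T \<Longrightarrow> T \<noteq> {}"
  using vertex_path by (fastforce simp: exhaustive_def paths_to_def Ext_def)

lemma path_closure_core: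
  assumes E: "finite E" "E \<subseteq> P"
  shows "tck_core \<Lambda> A s (path_closure E)"
proof unfold_locales
  show "finite (path_closure E)" using E by (rule finite_path_closure[rotated])
  show "\<xi> \<in> P" if "\<xi> \<in> path_closure E" for \<xi> using path_closure_paths E that by blast
qed (rule path_closure.step)

lemma parallel_mult:
  assumes "(\<kappa>, \<mu>) \<in> parallel" "(\<sigma>, \<tau>) \<in> parallel" and l: "(\<alpha>, \<beta>) \<in> lambda_min \<Lambda> \<mu> \<sigma>"
  shows "(\<kappa> \<cdot> \<alpha>, \<tau> \<cdot> \<beta>) \<in> parallel" "deg (\<kappa> \<cdot> \<alpha>) = deg \<kappa> + deg \<alpha>" "deg (\<tau> \<cdot> \<beta>) = deg \<tau> + deg \<beta>"
    "deg \<mu> + deg \<alpha> = deg \<sigma> + deg \<beta>" "(\<beta>, \<alpha>) \<in> lambda_min \<Lambda> \<sigma> \<mu>" "dmn \<alpha> = dmn \<beta>"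
proof -
  have P: "\<kappa> \<in> P" "\<mu> \<in> P" "dmn \<kappa> = dmn \<mu>" "\<sigma> \<in> P" "\<tau> \<in> P" "dmn \<sigma> = dmn \<tau>"
    using assms parallelD by blast+
  note * = l[unfolded lambda_min_iff[OF P(2,4)]]
  show d: "dmn \<alpha> = dmn \<beta>" by (rule lambda_min_src[OF P(2,4) l])
  show "(\<kappa> \<cdot> \<alpha>, \<tau> \<cdot> \<beta>) \<in> parallel" "deg (\<kappa> \<cdot> \<alpha>) = deg \<kappa> + deg \<alpha>" "deg (\<tau> \<cdot> \<beta>) = deg \<tau> + deg \<beta>"
    using P * d by (simp_all add: parallel_def)
  show "deg \<mu> + deg \<alpha> = deg \<sigma> + deg \<beta>" using * P by (metis comp_simps(4))
  show "(\<beta>, \<alpha>) \<in> lambda_min \<Lambda> \<sigma> \<mu>" by (rule lambda_min_swap[OF P(2,4) l])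
qed

text \<open>
  The sets \<open>R n\<close> are allowed to grow, since squaring doubles the range of the degrees.
\<close>

lemma sq_in_span:
  assumes "\<And>n. R n \<subseteq> parallel"
    and "\<And>n \<kappa> \<mu> \<sigma> \<tau> \<alpha> \<beta>. (\<kappa>, \<mu>) \<in> R n \<Longrightarrow> (\<sigma>, \<tau>) \<in> R n \<Longrightarrow> (\<alpha>, \<beta>) \<in> lambda_min \<Lambda> \<mu> \<sigma> \<Longrightarrow>
        (\<kappa> \<cdot> \<alpha>, \<tau> \<cdot> \<beta>) \<in> R (Suc n)"
    and "y \<in> ss_span (R 0)"
  shows "(sq ^^ n) y \<in> ss_span (R n)"
proof (induction n)
  case (Suc n)
  show ?case
    unfolding sq_Suc by (rule ss_span_mult[OF assms(1) assms(1) assms(1) _ Suc Suc]) (rule assms(2))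
qed (use assms in simp)

text \<open>
  The powers of $x^*x$ stay in the span of a fixed finite set of matrix units, so the constant in
  \<open>core_nrm_bound\<close> is the same for all of them and can be removed.
\<close>

theorem core_isometric:
  assumes hom: "cstar_hom A B \<phi>"
    and gap: "\<And>v T. v \<in> vertices \<Lambda> \<Longrightarrow> finite T \<Longrightarrow> T \<subseteq> paths_to \<Lambda> v - {v} \<Longrightarrow>
        \<phi> (gap v T) = \<zero>\<^bsub>B\<^esub> \<Longrightarrow> gap v T = \<zero>"
    and x: "x \<in> ss_span {(\<kappa>, \<mu>) \<in> parallel. deg \<kappa> = deg \<mu>}"
  shows "nrm A x \<le> nrm B (\<phi> x)"
proof -
  interpret \<phi>: cstar_hom A B \<phi> by (rule hom)
  obtain E where E: "finite E" "E \<subseteq> P" "x \<in> ss_span ({(\<kappa>, \<mu>) \<in> parallel. deg \<kappa> = deg \<mu>} \<inter> E \<times> E)"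
    using ss_span_finite[OF _ x] by auto
  interpret C: tck_core \<Lambda> A s "path_closure E" by (rule path_closure_core[OF E(1,2)])
  have xC: "x \<in> ss_span C.core_pairs"
    by (rule ss_span_mono[OF _ E(3)]) (auto simp: C.core_pairs_def parallel_def intro: path_closure.base)
  have mult: "(\<kappa> \<cdot> \<alpha>, \<tau> \<cdot> \<beta>) \<in> C.core_pairs"
    if k: "(\<kappa>, \<mu>) \<in> C.core_pairs" "(\<sigma>, \<tau>) \<in> C.core_pairs" and l: "(\<alpha>, \<beta>) \<in> lambda_min \<Lambda> \<mu> \<sigma>" for \<kappa> \<mu> \<sigma> \<tau> \<alpha> \<beta>
  proof -
    have par: "(\<kappa>, \<mu>) \<in> parallel" "(\<sigma>, \<tau>) \<in> parallel" using k C.core_pairs_parallel by blast+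
    note m = parallel_mult[OF par l]
    have "\<kappa> \<cdot> \<alpha> \<in> path_closure E" using k l by (intro C.C_closed[of \<kappa> \<mu> \<sigma> \<alpha> \<beta>]) (auto simp: C.core_pairs_def)
    moreover have "\<tau> \<cdot> \<beta> \<in> path_closure E"
      using k m(5) by (intro C.C_closed[of \<tau> \<sigma> \<mu> \<beta> \<alpha>]) (auto simp: C.core_pairs_def)
    moreover have "deg (\<kappa> \<cdot> \<alpha>) = deg (\<tau> \<cdot> \<beta>)" using k m by (simp add: C.core_pairs_def)
    ultimately show ?thesis using m(1) by (simp add: C.core_pairs_def parallel_def)
  qed
  have adj_x: "adj A x \<in> ss_span C.core_pairs"
    by (rule ss_span_adj[OF C.core_pairs_parallel C.core_pairs_parallel _ xC]) (auto simp: C.core_pairs_def)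
  have "adj A x \<otimes> x \<in> ss_span C.core_pairs"
    by (rule ss_span_mult[OF C.core_pairs_parallel C.core_pairs_parallel C.core_pairs_parallel _ adj_x xC])
      (rule mult)
  then have power: "(sq ^^ n) (adj A x \<otimes> x) \<in> ss_span C.core_pairs" for n
    using sq_in_span[of "\<lambda>_. C.core_pairs"] C.core_pairs_parallel mult by blast
  have "nrm A ((sq ^^ n) (adj A x \<otimes> x)) \<le>
      (real (card (path_closure E)))\<^sup>2 * (2 ^ n) ^ 0 * nrm B (\<phi> ((sq ^^ n) (adj A x \<otimes> x)))" for n
  proof -
    have "nrm A ((sq ^^ n) (adj A x \<otimes> x)) \<le>
        (real (card (path_closure E)))\<^sup>2 * nrm B (\<phi> ((sq ^^ n) (adj A x \<otimes> x)))"
      by (rule C.core_nrm_bound[OF hom _ power]) (rule gap)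
    then show ?thesis by simp
  qed
  then show ?thesis
    by (rule \<phi>.nrm_le_if_powers_le[rotated]) (rule ss_span_closed[OF C.core_pairs_parallel xC])
qed

section \<open>The grading\<close>

definition deg_diff :: "'p \<Rightarrow> 'p \<Rightarrow> 'k \<Rightarrow> int" where
  "deg_diff \<kappa> \<mu> i = int (deg \<kappa> $ i) - int (deg \<mu> $ i)"

definition graded_pairs :: "('k \<Rightarrow> int) set \<Rightarrow> ('p \<times> 'p) set" where
  "graded_pairs M = {(\<kappa>, \<mu>) \<in> parallel. deg_diff \<kappa> \<mu> \<in> M}"

lemma graded_pairs_parallel: "graded_pairs M \<subseteq> parallel"
  by (auto simp: graded_pairs_def)

lemma deg_diff_swap: "deg_diff \<mu> \<kappa> = - deg_diff \<kappa> \<mu>"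
  by (simp add: fun_eq_iff deg_diff_def)

lemma graded_pairs_swap: "(\<kappa>, \<mu>) \<in> graded_pairs M \<Longrightarrow> (\<mu>, \<kappa>) \<in> graded_pairs (uminus ` M)"
  using deg_diff_swap[of \<mu> \<kappa>] by (auto simp: graded_pairs_def parallel_def)

lemma deg_diff_mult:
  assumes "(\<kappa>, \<mu>) \<in> parallel" "(\<sigma>, \<tau>) \<in> parallel" "(\<alpha>, \<beta>) \<in> lambda_min \<Lambda> \<mu> \<sigma>"
  shows "deg_diff (\<kappa> \<cdot> \<alpha>) (\<tau> \<cdot> \<beta>) i = deg_diff \<kappa> \<mu> i + deg_diff \<sigma> \<tau> i"
proof -
  note m = parallel_mult[OF assms]
  have "deg \<mu> $ i + deg \<alpha> $ i = deg \<sigma> $ i + deg \<beta> $ i"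
    using m(4) by (metis vector_add_component)
  then show ?thesis unfolding deg_diff_def m(2,3) by simp
qed

lemma ss_span_box:
  assumes "x \<in> ss_span parallel"
  shows "\<exists>N. x \<in> ss_span (graded_pairs (deg_box N))"
  using assms
proof induction
  case zero
  then show ?case using ss_span.zero by blast
next
  case (add \<kappa> \<mu> x c)
  then obtain N where N: "x \<in> ss_span (graded_pairs (deg_box N))" by blast
  define M where "M = (\<Sum>i\<in>UNIV. nat \<bar>deg_diff \<kappa> \<mu> i\<bar>)"
  have "nat \<bar>deg_diff \<kappa> \<mu> i\<bar> \<le> M" for i unfolding M_def by (rule member_le_sum) auto
  then have "deg_diff \<kappa> \<mu> \<in> deg_box (max M N)" unfolding mem_deg_box by (metis nat_le_iff max.coboundedI1 of_nat_mono)
  moreover have "x \<in> ss_span (graded_pairs (deg_box (max M N)))"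
    using deg_box_mono[of N "max M N"] by (intro ss_span_mono[OF _ N]) (auto simp: graded_pairs_def)
  ultimately show ?case using add by (intro exI[of _ "max M N"] ss_span.add) (auto simp: graded_pairs_def)
qed

text \<open>
  Sorting the terms of a linear combination by their degree.
\<close>

lemma ss_span_decompose:
  assumes "x \<in> ss_span (graded_pairs M)" "finite M"
  shows "\<exists>y. (\<forall>m\<in>M. y m \<in> ss_span (graded_pairs {m})) \<and> x = finsum A y M"
  using assms(1)
proof induction
  case zero
  show ?case by (rule exI[of _ "\<lambda>_. \<zero>"]) (simp add: ss_span.zero finsum_zero)
next
  case (add \<kappa> \<mu> x c)
  then obtain y where y: "\<And>m. m \<in> M \<Longrightarrow> y m \<in> ss_span (graded_pairs {m})" "x = finsum A y M" by blast
  let ?m = "deg_diff \<kappa> \<mu>"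
  have m: "?m \<in> M" "(\<kappa>, \<mu>) \<in> graded_pairs {?m}" "ss \<kappa> \<mu> \<in> carrier A"
    using add parallelD by (auto simp: graded_pairs_def)
  have yc: "y m \<in> carrier A" if "m \<in> M" for m using y(1) ss_span_closed[OF graded_pairs_parallel] that by blast
  define e where "e m = (if m = ?m then c \<odot> ss \<kappa> \<mu> else \<zero>)" for m
  have ec: "e m \<in> carrier A" for m using m by (simp add: e_def)
  have "finsum A (\<lambda>m. e m \<oplus> y m) M = finsum A e M \<oplus> finsum A y M"
    using ec yc by (intro finsum_addf) auto
  also have "finsum A e M = c \<odot> ss \<kappa> \<mu>"
    using finsum_only[OF assms(2) m(1), of e] ec by (simp add: e_def)
  finally have "c \<odot> ss \<kappa> \<mu> \<oplus> x = finsum A (\<lambda>m. e m \<oplus> y m) M" using y by simp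
  moreover have "e m \<oplus> y m \<in> ss_span (graded_pairs {m})" if "m \<in> M" for m
    using y(1)[OF that] yc[OF that] m(2) by (auto simp: e_def intro: ss_span.add)
  ultimately show ?case by (intro exI[of _ "\<lambda>m. e m \<oplus> y m"]) simp
qed

end

section \<open>Isometry on the span of the generators\<close>

lemma unimodular_power:
  assumes "cmod w = 1"
  shows "w ^ a * cnj w ^ b = w powi (int a - int b)"
proof -
  have "w * cnj w = 1" using complex_norm_square[of w] assms by simp
  then have "cnj w = inverse w" by (metis inverse_unique)
  moreover have "w \<noteq> 0" using assms by auto
  ultimately show ?thesis by (simp add: power_int_diff divide_inverse power_inverse)
qed

lemma torus_pow_char:
  assumes "z \<in> torus"
  shows "torus_pow z m * cnj (torus_pow z n) = torus_char (\<lambda>i. int (m $ i) - int (n $ i)) z"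
  using assms unfolding torus_pow_def torus_char_def torus_def
  by (simp add: unimodular_power flip: prod.distrib)

locale tck_hom = SA: tck \<Lambda> A s + SB: tck \<Lambda> B t + cstar_hom A B \<phi>
  for \<Lambda> :: "('p, 'k::finite) kgraph" and A :: "'a cstar" and s :: "'p \<Rightarrow> 'a"
    and B :: "'b cstar" and t :: "'p \<Rightarrow> 'b" and \<phi> :: "'a \<Rightarrow> 'b" +
  assumes hom_s: "\<kappa> \<in> paths \<Lambda> \<Longrightarrow> \<phi> (s \<kappa>) = t \<kappa>"
begin

lemma hom_ss: "\<kappa> \<in> paths \<Lambda> \<Longrightarrow> \<mu> \<in> paths \<Lambda> \<Longrightarrow> \<phi> (SA.ss \<kappa> \<mu>) = SB.ss \<kappa> \<mu>"
  by (simp add: SA.ss_def SB.ss_def hom_s)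

lemma hom_span:
  assumes "R \<subseteq> SA.parallel" "x \<in> SA.ss_span R"
  shows "\<phi> x \<in> SB.ss_span R"
  using assms(2)
proof induction
  case zero
  then show ?case by (simp add: SB.ss_span.zero)
next
  case (add \<kappa> \<mu> x c)
  have "\<kappa> \<in> paths \<Lambda>" "\<mu> \<in> paths \<Lambda>" using SA.parallelD assms(1) add by blast+
  moreover have "x \<in> carrier A" using SA.ss_span_closed[OF assms(1)] add by blast
  ultimately have "\<phi> (c \<odot>\<^bsub>A\<^esub> SA.ss \<kappa> \<mu> \<oplus>\<^bsub>A\<^esub> x) = c \<odot>\<^bsub>B\<^esub> SB.ss \<kappa> \<mu> \<oplus>\<^bsub>B\<^esub> \<phi> x"
    by (simp add: hom_ss)
  then show ?case using SB.ss_span.add add by metis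
qed

lemma hom_gap:
  assumes "v \<in> vertices \<Lambda>" "finite T" "T \<subseteq> paths_to \<Lambda> v"
  shows "\<phi> (SA.gap v T) = SB.gap v T"
proof -
  have "SA.gap v T \<in> carrier A \<and> \<phi> (SA.gap v T) = SB.gap v T"
    using assms
  proof (induction rule: SA.gap_induct)
    case empty
    then show ?case using assms(1) SA.vertex_path by (simp add: hom_s SB.gap_empty)
  next
    case (insert \<kappa> T)
    then show ?case using assms(1) SA.vertex_path
      by (simp add: SB.gap_insert hom_s hom_ss SA.q_def SB.q_def)
  qed
  then show ?thesis by simp
qed

text \<open>
  A homogeneous \<open>y\<close> keeps its norm because $y^*y$ lies in the core. Let \<open>x\<close> be arbitrary with
  degrees in a box of radius \<open>N\<close>. The power $(x^*x)^{2^n}$ is a sum of at most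
  $(4 N 2^n + 1)^k$ homogeneous components, and the norm of each is at most that of the image of the
  whole power, by averaging over the gauge action. The number of components is polynomial in
  $2^n$, so \<open>nrm_le_if_powers_le\<close> applies.
\<close>

theorem isometric_on_span:
  fixes \<theta> :: "complex ^ 'k \<Rightarrow> 'b \<Rightarrow> 'b"
  assumes gap: "\<And>v T. v \<in> vertices \<Lambda> \<Longrightarrow> finite T \<Longrightarrow> T \<subseteq> paths_to \<Lambda> v - {v} \<Longrightarrow>
        SB.gap v T = \<zero>\<^bsub>B\<^esub> \<Longrightarrow> SA.gap v T = \<zero>\<^bsub>A\<^esub>"
    and \<theta>: "\<And>z. z \<in> torus \<Longrightarrow> \<theta> z \<in> star_hom B B"
    and gauge: "\<And>z \<kappa>. z \<in> torus \<Longrightarrow> \<kappa> \<in> paths \<Lambda> \<Longrightarrow> \<theta> z (t \<kappa>) = torus_pow z (dg \<Lambda> \<kappa>) \<odot>\<^bsub>B\<^esub> t \<kappa>"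
    and x: "x \<in> SA.ss_span SA.parallel"
  shows "nrm A x \<le> nrm B (\<phi> x)"
proof -
  have hom: "cstar_hom A B \<phi>" ..
  note closed = SA.ss_span_closed[OF SA.graded_pairs_parallel]
  have core: "nrm A y \<le> nrm B (\<phi> y)" if "y \<in> SA.ss_span {(\<kappa>, \<mu>) \<in> SA.parallel. dg \<Lambda> \<kappa> = dg \<Lambda> \<mu>}" for y
  proof (rule SA.core_isometric[OF hom _ that])
    fix v T assume vT: "v \<in> vertices \<Lambda>" "finite T" "T \<subseteq> paths_to \<Lambda> v - {v}" "\<phi> (SA.gap v T) = \<zero>\<^bsub>B\<^esub>"
    then have "T \<subseteq> paths_to \<Lambda> v" by blast
    then show "SA.gap v T = \<zero>\<^bsub>A\<^esub>" using vT gap[of v T] hom_gap[of v T] by simp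
  qed
  have homogeneous: "nrm A y \<le> nrm B (\<phi> y)" if y: "y \<in> SA.ss_span (SA.graded_pairs {m})" for y m
  proof -
    have yc: "y \<in> carrier A" using closed y by blast
    have adj_y: "adj A y \<in> SA.ss_span (SA.graded_pairs {- m})"
      by (rule SA.ss_span_adj[OF SA.graded_pairs_parallel SA.graded_pairs_parallel _ y])
        (use SA.graded_pairs_swap[of _ _ "{m}"] in simp)
    have "adj A y \<otimes>\<^bsub>A\<^esub> y \<in> SA.ss_span {(\<kappa>, \<mu>) \<in> SA.parallel. dg \<Lambda> \<kappa> = dg \<Lambda> \<mu>}"
    proof (rule SA.ss_span_mult[OF SA.graded_pairs_parallel SA.graded_pairs_parallel _ _ adj_y y])
      fix \<kappa> \<mu> \<sigma> \<tau> \<alpha> \<beta>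
      assume k: "(\<kappa>, \<mu>) \<in> SA.graded_pairs {- m}" "(\<sigma>, \<tau>) \<in> SA.graded_pairs {m}" "(\<alpha>, \<beta>) \<in> lambda_min \<Lambda> \<mu> \<sigma>"
      then have par: "(\<kappa>, \<mu>) \<in> SA.parallel" "(\<sigma>, \<tau>) \<in> SA.parallel" using SA.graded_pairs_parallel by blast+
      have "SA.deg_diff (cmp \<Lambda> \<kappa> \<alpha>) (cmp \<Lambda> \<tau> \<beta>) i = 0" for i
        using SA.deg_diff_mult[OF par k(3), of i] k(1,2) by (simp add: SA.graded_pairs_def)
      then have "dg \<Lambda> (cmp \<Lambda> \<kappa> \<alpha>) = dg \<Lambda> (cmp \<Lambda> \<tau> \<beta>)" by (simp add: SA.deg_diff_def vec_eq_iff)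
      then show "(cmp \<Lambda> \<kappa> \<alpha>, cmp \<Lambda> \<tau> \<beta>) \<in> {(\<kappa>, \<mu>) \<in> SA.parallel. dg \<Lambda> \<kappa> = dg \<Lambda> \<mu>}"
        using SA.parallel_mult[OF par k(3)] by simp
    qed auto
    from core[OF this] have "(nrm A y)\<^sup>2 \<le> (nrm B (\<phi> y))\<^sup>2"
      using yc by (simp add: SA.nrm_adj_mult SB.nrm_adj_mult)
    then show ?thesis using yc by (simp add: power2_le_iff_abs_le)
  qed
  have eig: "\<theta> z y = torus_char m z \<odot>\<^bsub>B\<^esub> y" if z: "z \<in> torus" and y: "y \<in> SB.ss_span (SB.graded_pairs {m})" for z m y
  proof -
    interpret \<theta>: cstar_hom B B "\<theta> z" by unfold_locales (rule \<theta>[OF z])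
    show ?thesis using y
    proof induction
      case (add \<kappa> \<mu> y c)
      have k: "\<kappa> \<in> paths \<Lambda>" "\<mu> \<in> paths \<Lambda>" "SB.deg_diff \<kappa> \<mu> = m"
        using add by (auto simp: SB.graded_pairs_def SB.parallel_def)
      have yc: "y \<in> carrier B" using SB.ss_span_closed[OF SB.graded_pairs_parallel] add by blast
      have "\<theta> z (SB.ss \<kappa> \<mu>) = (torus_pow z (dg \<Lambda> \<kappa>) * cnj (torus_pow z (dg \<Lambda> \<mu>))) \<odot>\<^bsub>B\<^esub> SB.ss \<kappa> \<mu>"
        using k z by (simp add: SB.ss_def gauge mult.commute)
      also have "torus_pow z (dg \<Lambda> \<kappa>) * cnj (torus_pow z (dg \<Lambda> \<mu>)) = torus_char m z"
        unfolding torus_pow_char[OF z] k(3)[symmetric] SB.deg_diff_def ..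
      finally show ?case using add k yc by (simp add: SB.smult_add mult.commute)
    qed simp
  qed
  obtain N where N: "x \<in> SA.ss_span (SA.graded_pairs (deg_box N))" using SA.ss_span_box[OF x] by blast
  have xc: "x \<in> carrier A" using closed N by blast
  define R where "R n = SA.graded_pairs (deg_box (2 ^ n * (2 * N)))" for n
  have R_mult: "(cmp \<Lambda> \<kappa> \<alpha>, cmp \<Lambda> \<tau> \<beta>) \<in> SA.graded_pairs (deg_box (M + M'))"
    if k: "(\<kappa>, \<mu>) \<in> SA.graded_pairs (deg_box M)" "(\<sigma>, \<tau>) \<in> SA.graded_pairs (deg_box M')" "(\<alpha>, \<beta>) \<in> lambda_min \<Lambda> \<mu> \<sigma>"
    for M M' \<kappa> \<mu> \<sigma> \<tau> \<alpha> \<beta>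
  proof -
    have par: "(\<kappa>, \<mu>) \<in> SA.parallel" "(\<sigma>, \<tau>) \<in> SA.parallel" using k SA.graded_pairs_parallel by blast+
    have "\<bar>SA.deg_diff (cmp \<Lambda> \<kappa> \<alpha>) (cmp \<Lambda> \<tau> \<beta>) i\<bar> \<le> int (M + M')" for i
    proof -
      have "\<bar>SA.deg_diff \<kappa> \<mu> i\<bar> \<le> int M" "\<bar>SA.deg_diff \<sigma> \<tau> i\<bar> \<le> int M'"
        using k by (auto simp: SA.graded_pairs_def mem_deg_box)
      then show ?thesis using SA.deg_diff_mult[OF par k(3), of i] by simp
    qed
    then show ?thesis using SA.parallel_mult(1)[OF par k(3)] by (simp add: SA.graded_pairs_def mem_deg_box)
  qed
  have adj_x: "adj A x \<in> SA.ss_span (SA.graded_pairs (deg_box N))"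
    by (rule SA.ss_span_adj[OF SA.graded_pairs_parallel SA.graded_pairs_parallel _ N])
      (use SA.graded_pairs_swap[of _ _ "deg_box N"] in \<open>simp add: uminus_deg_box\<close>)
  have "adj A x \<otimes>\<^bsub>A\<^esub> x \<in> SA.ss_span (SA.graded_pairs (deg_box (N + N)))"
    by (rule SA.ss_span_mult[OF SA.graded_pairs_parallel SA.graded_pairs_parallel SA.graded_pairs_parallel _ adj_x N])
      (rule R_mult)
  then have R0: "adj A x \<otimes>\<^bsub>A\<^esub> x \<in> SA.ss_span (R 0)" by (simp add: R_def mult_2)
  have power: "(SA.sq ^^ n) (adj A x \<otimes>\<^bsub>A\<^esub> x) \<in> SA.ss_span (R n)" for n
  proof (rule SA.sq_in_span[of R, OF _ _ R0])
    show "R n \<subseteq> SA.parallel" for n unfolding R_def by (rule SA.graded_pairs_parallel)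
    show "(cmp \<Lambda> \<kappa> \<alpha>, cmp \<Lambda> \<tau> \<beta>) \<in> R (Suc n)"
      if "(\<kappa>, \<mu>) \<in> R n" "(\<sigma>, \<tau>) \<in> R n" "(\<alpha>, \<beta>) \<in> lambda_min \<Lambda> \<mu> \<sigma>" for n \<kappa> \<mu> \<sigma> \<tau> \<alpha> \<beta>
      using R_mult that unfolding R_def by (simp add: mult_2 distrib_right)
  qed
  show ?thesis
  proof (rule nrm_le_if_powers_le[OF xc, where K = "real (4 * N + 1) ^ CARD('k)" and k = "CARD('k)"])
    fix n
    let ?M = "2 ^ n * (2 * N)" and ?y = "(SA.sq ^^ n) (adj A x \<otimes>\<^bsub>A\<^esub> x)"
    obtain y where y: "\<And>m. m \<in> deg_box ?M \<Longrightarrow> y m \<in> SA.ss_span (SA.graded_pairs {m})" "?y = finsum A y (deg_box ?M)"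
      using SA.ss_span_decompose[OF power[of n, unfolded R_def] finite_deg_box] by blast
    have yc: "y m \<in> carrier A" if "m \<in> deg_box ?M" for m using closed y(1) that by blast
    have \<phi>y: "\<phi> ?y = finsum B (\<lambda>m. \<phi> (y m)) (deg_box ?M)" unfolding y(2) using yc by (intro hom_finsum) auto
    have comp: "nrm A (y m) \<le> nrm B (\<phi> ?y)" if m: "m \<in> deg_box ?M" for m
    proof -
      have "nrm A (y m) \<le> nrm B (\<phi> (y m))" using homogeneous y(1) m by blast
      also have "\<dots> \<le> nrm B (finsum B (\<lambda>m. \<phi> (y m)) (deg_box ?M))"
      proof (rule SB.spectral_component_nrm_le[OF \<theta> _ _ m])
        show "\<theta> z (\<phi> (y p)) = torus_char p z \<odot>\<^bsub>B\<^esub> \<phi> (y p)" if "p \<in> deg_box ?M" "z \<in> torus" for p z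
          using hom_span[OF SA.graded_pairs_parallel y(1)] that
          by (intro eig) (auto simp: SA.graded_pairs_def SB.graded_pairs_def)
      qed (use yc in auto)
      finally show ?thesis using \<phi>y by simp
    qed
    have "nrm A ?y \<le> (\<Sum>m\<in>deg_box ?M. nrm A (y m))"
      unfolding y(2) using yc by (intro SA.nrm_finsum) auto
    also have "\<dots> \<le> (\<Sum>m\<in>(deg_box ?M :: ('k \<Rightarrow> int) set). nrm B (\<phi> ?y))" using comp by (intro sum_mono) auto
    also have "\<dots> = real (2 * ?M + 1) ^ CARD('k) * nrm B (\<phi> ?y)" by (simp add: card_deg_box)
    also have "\<dots> \<le> (real (4 * N + 1) * 2 ^ n) ^ CARD('k) * nrm B (\<phi> ?y)"
    proof (intro mult_right_mono power_mono)
      have "2 * ?M + 1 \<le> (4 * N + 1) * 2 ^ n" by (simp add: algebra_simps)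
      then have "real (2 * ?M + 1) \<le> real ((4 * N + 1) * 2 ^ n)" by (rule of_nat_mono)
      then show "real (2 * ?M + 1) \<le> real (4 * N + 1) * 2 ^ n"
        by (simp only: of_nat_mult of_nat_power of_nat_numeral)
    qed (use xc in auto)
    finally show "nrm A ?y \<le> real (4 * N + 1) ^ CARD('k) * (2 ^ n) ^ CARD('k) * nrm B (\<phi> ?y)"
      by (simp only: power_mult_distrib)
  qed
qed

end

section \<open>The canonical homomorphism\<close>

lemma ck_family_toeplitz: "ck_family \<Lambda> \<E> A s \<Longrightarrow> ck_family \<Lambda> {} A s"
  by (auto simp: ck_family_def)

text \<open>
  The relations may be checked after an injective *-homomorphism. The relations of the empty set of
  exhaustive sets come first, because the gap products are well behaved only for commuting
  projections.
\<close>

lemma ck_family_pullback: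
  assumes \<Lambda>: "k_graph \<Lambda>" "finitely_aligned \<Lambda>" and \<E>: "\<E> \<subseteq> FE \<Lambda>"
    and C: "cstar_algebra C" and B: "cstar_algebra B"
    and g: "g \<in> star_hom C B" "inj_on g (carrier C)"
    and t': "\<And>\<kappa>. \<kappa> \<in> paths \<Lambda> \<Longrightarrow> t' \<kappa> \<in> carrier C" "\<And>\<kappa>. \<kappa> \<in> paths \<Lambda> \<Longrightarrow> g (t' \<kappa>) = t \<kappa>"
    and t: "ck_family \<Lambda> \<E> B t"
  shows "ck_family \<Lambda> \<E> C t'"
proof -
  interpret B: tck \<Lambda> B t using \<Lambda> B ck_family_toeplitz[OF t] by unfold_locales
  interpret g: cstar_hom C B g using C B g by unfold_locales
  have eqI: "x = y" if "x \<in> carrier C" "y \<in> carrier C" "g x = g y" for x y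
    using that g(2) by (auto dest: inj_onD)
  note t_rules = B.family[unfolded ck_family_def]
  have toeplitz: "ck_family \<Lambda> {} C t'"
    unfolding ck_family_def
  proof (intro conjI ballI impI)
    fix \<kappa> \<mu> assume k: "\<kappa> \<in> paths \<Lambda>" "\<mu> \<in> paths \<Lambda>"
    let ?f = "\<lambda>(\<alpha>, \<beta>). t' \<alpha> \<otimes>\<^bsub>C\<^esub> adj C (t' \<beta>)"
    have f: "?f \<in> lambda_min \<Lambda> \<kappa> \<mu> \<rightarrow> carrier C" using t' by (auto simp: B.lambda_min_iff[OF k])
    have "g (finsum C ?f (lambda_min \<Lambda> \<kappa> \<mu>)) = finsum B (\<lambda>p. g (?f p)) (lambda_min \<Lambda> \<kappa> \<mu>)"
      by (rule g.hom_finsum[OF f])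
    also have "\<dots> = finsum B (\<lambda>(\<alpha>, \<beta>). t \<alpha> \<otimes>\<^bsub>B\<^esub> adj B (t \<beta>)) (lambda_min \<Lambda> \<kappa> \<mu>)"
      using t' by (intro B.finsum_cong') (auto simp: B.lambda_min_iff[OF k])
    also have "\<dots> = adj B (t \<kappa>) \<otimes>\<^bsub>B\<^esub> t \<mu>" using B.s_adj_mult k by simp
    finally show "adj C (t' \<kappa>) \<otimes>\<^bsub>C\<^esub> t' \<mu> = finsum C ?f (lambda_min \<Lambda> \<kappa> \<mu>)"
      using k t' f by (intro eqI g.A.finsum_closed) auto
  next
    fix \<kappa> assume "\<kappa> \<in> paths \<Lambda>"
    then show "t' \<kappa> \<otimes>\<^bsub>C\<^esub> adj C (t' \<kappa>) \<otimes>\<^bsub>C\<^esub> t' \<kappa> = t' \<kappa>" "t' \<kappa> \<in> carrier C"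
      using t' t_rules by (auto intro!: eqI)
  next
    fix v assume v: "v \<in> vertices \<Lambda>"
    then show "adj C (t' v) = t' v" "t' v \<otimes>\<^bsub>C\<^esub> t' v = t' v"
      using t' B.vertex_path B.s_vertex by (auto intro!: eqI)
    fix w assume "w \<in> vertices \<Lambda>" "v \<noteq> w"
    then show "t' v \<otimes>\<^bsub>C\<^esub> t' w = \<zero>\<^bsub>C\<^esub>"
      using v t' B.vertex_path B.s_vertex_orth by (auto intro!: eqI)
  next
    fix \<kappa> \<mu> assume "\<kappa> \<in> paths \<Lambda>" "\<mu> \<in> paths \<Lambda>" "src \<Lambda> \<kappa> = rng \<Lambda> \<mu>"
    then show "t' \<kappa> \<otimes>\<^bsub>C\<^esub> t' \<mu> = t' (cmp \<Lambda> \<kappa> \<mu>)" using t' B.s_comp by (auto intro!: eqI)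
  qed simp
  interpret H: tck_hom \<Lambda> C t' B t g using toeplitz t' by unfold_locales
  have "gap_prod \<Lambda> C t' E = \<zero>\<^bsub>C\<^esub>" if E: "E \<in> \<E>" for E
  proof -
    obtain v where v: "v \<in> vertices \<Lambda>" "finite E" "E \<subseteq> paths_to \<Lambda> v" "exhaustive \<Lambda> v E"
      using E \<E> unfolding FE_def by blast
    have "E \<noteq> {}" using B.FE_nonempty v by blast
    have "g (gap_prod \<Lambda> C t' E) = gap_prod \<Lambda> B t E"
      using H.hom_gap[OF v(1-3)] H.SA.gap_prod_eq[OF v(1,3) \<open>E \<noteq> {}\<close>] B.gap_prod_eq[OF v(1,3) \<open>E \<noteq> {}\<close>] by simp
    also have "\<dots> = \<zero>\<^bsub>B\<^esub>" using t E by (simp add: ck_family_def)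
    finally show ?thesis
      using H.SA.gap_prod_eq[OF v(1,3) \<open>E \<noteq> {}\<close>] H.SA.gap_closed[OF v(1-3)] by (intro eqI) auto
  qed
  then show ?thesis using toeplitz by (simp add: ck_family_def)
qed

text \<open>
  The family generates a separable subalgebra of \<open>B\<close>, which has an isomorphic copy on sets of natural
  numbers; there the universal property applies.
\<close>

lemma universal_hom_exists:
  fixes A :: "'a cstar" and B :: "'b cstar"
  assumes \<Lambda>: "k_graph \<Lambda>" "finitely_aligned \<Lambda>" and \<E>: "\<E> \<subseteq> FE \<Lambda>"
    and A: "universal_ck \<Lambda> \<E> A s" and B: "cstar_algebra B" "ck_family \<Lambda> \<E> B t"
  shows "\<exists>\<pi>\<in>star_hom A B. \<forall>\<kappa>\<in>paths \<Lambda>. \<pi> (s \<kappa>) = t \<kappa>"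
proof -
  interpret B: tck \<Lambda> B t using \<Lambda> B ck_family_toeplitz[OF B(2)] by unfold_locales auto
  define x where "x i = (if paths \<Lambda> = {} then \<zero>\<^bsub>B\<^esub> else t (from_nat_into (paths \<Lambda>) i))" for i
  have x: "x i \<in> carrier B" for i by (simp add: x_def from_nat_into)
  obtain D where D: "countable D" "D \<noteq> {}" "D \<subseteq> carrier B" "range x \<subseteq> B.norm_closure D"
    "cstar_subalgebra B (B.norm_closure D)"
    using B.separable_subalgebra[OF x] .
  let ?S = "B.norm_closure D"
  obtain f :: "'b \<Rightarrow> nat set" where f: "inj_on f ?S" using B.norm_closure_continuum[OF D(1-3)] by blast
  let ?C = "transport f B ?S" and ?g = "inv_into ?S f"
  have t: "t \<kappa> \<in> ?S" if "\<kappa> \<in> paths \<Lambda>" for \<kappa>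
  proof -
    have "countable (paths \<Lambda>)" using \<Lambda> by (simp add: k_graph_def)
    from from_nat_into_surj[OF this that] obtain i where "from_nat_into (paths \<Lambda>) i = \<kappa>" ..
    then have "x i = t \<kappa>" using that by (auto simp: x_def)
    then show ?thesis using D(4) by (metis rangeI subsetD)
  qed
  have C: "cstar_algebra ?C" "?g \<in> star_hom ?C B" using B.transport_cstar[OF D(5) f] by auto
  have family: "ck_family \<Lambda> \<E> ?C (\<lambda>\<kappa>. f (t \<kappa>))"
  proof (rule ck_family_pullback[OF \<Lambda> \<E> C(1) B(1) C(2) B.transport_inj[OF f] _ _ B(2)])
    show "f (t \<kappa>) \<in> carrier ?C" "?g (f (t \<kappa>)) = t \<kappa>" if "\<kappa> \<in> paths \<Lambda>" for \<kappa>
      using t[OF that] f by (simp_all add: transport_def Let_def)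
  qed
  have "\<exists>\<pi>\<in>star_hom A ?C. \<forall>\<kappa>\<in>paths \<Lambda>. \<pi> (s \<kappa>) = f (t \<kappa>)"
    using A[unfolded universal_ck_def, THEN conjunct2, THEN conjunct2, THEN conjunct2] C(1) family
    by (elim allE impE) (rule conjI)
  then obtain \<pi> where \<pi>: "\<pi> \<in> star_hom A ?C" "\<And>\<kappa>. \<kappa> \<in> paths \<Lambda> \<Longrightarrow> \<pi> (s \<kappa>) = f (t \<kappa>)"
    by blast
  have "(\<lambda>a. ?g (\<pi> a)) \<in> star_hom A B"
    using \<pi>(1) C(2) unfolding star_hom_def by (auto simp: Pi_iff)
  moreover have "?g (\<pi> (s \<kappa>)) = t \<kappa>" if "\<kappa> \<in> paths \<Lambda>" for \<kappa>
    using that t f \<pi>(2) by simp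
  ultimately show ?thesis by (intro bexI[of _ "\<lambda>a. ?g (\<pi> a)"]) auto
qed

lemma universal_ck_generated:
  "universal_ck \<Lambda> \<E> A s \<Longrightarrow> cstar_subalgebra A S \<Longrightarrow> s ` paths \<Lambda> \<subseteq> S \<Longrightarrow> S = carrier A"
  by (simp add: universal_ck_def)

text \<open>
  Uniqueness, which the definite description requires, holds because the equalizer of two candidates
  is a C*-subalgebra that contains the generators.
\<close>

lemma ck_hom_eq:
  assumes A: "universal_ck \<Lambda> \<E> A s" and B: "cstar_algebra B"
    and \<pi>: "\<pi> \<in> star_hom A B" "\<And>\<kappa>. \<kappa> \<in> paths \<Lambda> \<Longrightarrow> \<pi> (s \<kappa>) = t \<kappa>"
  shows "ck_hom \<Lambda> A s B t = restrict \<pi> (carrier A)"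
  unfolding ck_hom_def
proof (rule the_equality)
  have A': "cstar_algebra A" using A by (simp add: universal_ck_def)
  interpret cstar_hom A B \<pi> using A' B \<pi> by unfold_locales
  have s: "s \<kappa> \<in> carrier A" if "\<kappa> \<in> paths \<Lambda>" for \<kappa>
    using A that by (simp add: universal_ck_def ck_family_def)
  show "restrict \<pi> (carrier A) \<in> star_hom A B \<and> restrict \<pi> (carrier A) \<in> extensional (carrier A) \<and>
      (\<forall>\<kappa>\<in>paths \<Lambda>. restrict \<pi> (carrier A) (s \<kappa>) = t \<kappa>)"
    using \<pi> s by (simp add: star_hom_def Pi_iff)
  fix \<psi> assume \<psi>: "\<psi> \<in> star_hom A B \<and> \<psi> \<in> extensional (carrier A) \<and> (\<forall>\<kappa>\<in>paths \<Lambda>. \<psi> (s \<kappa>) = t \<kappa>)"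
  have "cstar_subalgebra A {x \<in> carrier A. \<psi> x = \<pi> x}"
    using equalizer_subalgebra A' B \<psi> \<pi> by blast
  moreover have "s ` paths \<Lambda> \<subseteq> {x \<in> carrier A. \<psi> x = \<pi> x}" using \<psi> \<pi> s by auto
  ultimately have "{x \<in> carrier A. \<psi> x = \<pi> x} = carrier A" by (rule universal_ck_generated[OF A])
  then show "\<psi> = restrict \<pi> (carrier A)"
    using \<psi> by (intro extensionalityI[of _ "carrier A"]) auto
qed

section \<open>The gauge-invariant uniqueness theorem\<close>

text \<open>
  The span is a *-algebra that contains each $s_\kappa = s_\kappa s_{s(\kappa)}^*$.
\<close>

lemma (in tck) generated_by_span:
  assumes gen: "\<And>S. cstar_subalgebra A S \<Longrightarrow> s ` P \<subseteq> S \<Longrightarrow> S = carrier A"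
  shows "norm_closure (ss_span parallel) = carrier A"
proof (rule gen)
  let ?D = "ss_span parallel"
  have D: "?D \<subseteq> carrier A" using ss_span_closed by blast
  show "cstar_subalgebra A (norm_closure ?D)"
  proof (rule norm_closure_subalgebra[where Q = UNIV, OF D ss_span.zero])
    show "x \<oplus> y \<in> ?D" "x \<otimes> y \<in> ?D" if "x \<in> ?D" "y \<in> ?D" for x y
      using ss_span_add[OF subset_refl that] ss_span_mult[OF subset_refl subset_refl subset_refl _ that]
        parallel_mult(1) by blast+
    show "adj A x \<in> ?D" if "x \<in> ?D" for x
      by (rule ss_span_adj[OF subset_refl subset_refl _ that]) (simp add: parallel_def)
    show "c \<odot> x \<in> ?D" if "x \<in> ?D" for c x by (rule ss_span_smult[OF subset_refl that])
    show "\<exists>q\<in>UNIV. cmod (c - q) < e" if "e > 0" for c e using that by (intro bexI[of _ c]) auto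
  qed
  have "s \<kappa> \<in> ?D" if "\<kappa> \<in> P" for \<kappa>
  proof -
    have "ss \<kappa> (dmn \<kappa>) \<in> ?D" using that by (intro ss_in_span) (auto simp: parallel_def)
    then show ?thesis using that by (simp add: ss_def s_vertex s_units)
  qed
  then show "s ` P \<subseteq> norm_closure ?D" using norm_closure_subset[OF D] by blast
qed

lemma (in cstar_hom) inj_if_isometric_on_dense:
  assumes D: "D \<subseteq> carrier A" "A.norm_closure D = carrier A"
    and iso: "\<And>x. x \<in> D \<Longrightarrow> nrm A x \<le> nrm B (\<phi> x)"
  shows "inj_on \<phi> (carrier A)"
proof (rule inj_onI)
  fix x y assume c: "x \<in> carrier A" "y \<in> carrier A" and eq: "\<phi> x = \<phi> y"
  let ?z = "x \<ominus>\<^bsub>A\<^esub> y"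
  have z: "?z \<in> carrier A" "\<phi> ?z = \<zero>\<^bsub>B\<^esub>" using c eq by simp_all
  have "nrm A ?z \<le> 0 + e" if "e > 0" for e
  proof -
    have "?z \<in> A.norm_closure D" using z(1) D(2) by simp
    then obtain d where d: "d \<in> D" "nrm A (?z \<ominus>\<^bsub>A\<^esub> d) < e / 2"
      using \<open>e > 0\<close> unfolding A.norm_closure_def by (auto dest: spec[of _ "e / 2"])
    have dc: "d \<in> carrier A" using d D by blast
    have "nrm A d \<le> nrm B (\<phi> d)" by (rule iso[OF d(1)])
    also have "\<dots> = nrm B (\<phi> (d \<ominus>\<^bsub>A\<^esub> ?z))" using z dc by simp
    also have "\<dots> \<le> nrm A (d \<ominus>\<^bsub>A\<^esub> ?z)" using z dc by (intro contractive) simp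
    also have "\<dots> = nrm A (?z \<ominus>\<^bsub>A\<^esub> d)" using z dc by (simp add: A.nrm_diff_commute)
    finally show ?thesis using A.nrm_le_diff[OF z(1) dc] d(2) by simp
  qed
  then have "nrm A ?z \<le> 0" by (rule field_le_epsilon)
  then have "nrm A ?z = 0" using A.nrm_nonneg[OF z(1)] by simp
  then show "x = y" using c z by (simp add: A.diff_eq_zero)
qed

theorem theorem6p1:
  fixes \<Lambda> :: "('p, 'k::finite) kgraph"
    and \<E> :: "'p set set"
    and A :: "'a cstar" and s :: "'p \<Rightarrow> 'a"
    and B :: "'b cstar" and t :: "'p \<Rightarrow> 'b"
  assumes "k_graph \<Lambda>" and "finitely_aligned \<Lambda>"
    and "\<E> \<subseteq> FE \<Lambda>" and "satiated \<Lambda> \<E>"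
    and "universal_ck \<Lambda> \<E> A s"
    and "cstar_algebra B" and "ck_family \<Lambda> \<E> B t"
    and "\<forall>v\<in>vertices \<Lambda>. t v \<noteq> \<zero>\<^bsub>B\<^esub>"
    and "\<forall>F\<in>FE \<Lambda> - \<E>. gap_prod \<Lambda> B t F \<noteq> \<zero>\<^bsub>B\<^esub>"
    and "\<exists>\<theta> :: complex ^ 'k \<Rightarrow> 'b \<Rightarrow> 'b. torus_action B \<theta> \<and>
           (\<forall>z\<in>torus. \<forall>\<kappa>\<in>paths \<Lambda>. \<theta> z (t \<kappa>) = torus_pow z (dg \<Lambda> \<kappa>) \<odot>\<^bsub>B\<^esub> t \<kappa>)"
  shows "inj_on (ck_hom \<Lambda> A s B t) (carrier A)"
proof -
  have A: "cstar_algebra A" "ck_family \<Lambda> \<E> A s"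
    using assms(5) by (simp_all add: universal_ck_def)
  obtain \<pi> where \<pi>: "\<pi> \<in> star_hom A B" "\<And>\<kappa>. \<kappa> \<in> paths \<Lambda> \<Longrightarrow> \<pi> (s \<kappa>) = t \<kappa>"
    using universal_hom_exists[OF assms(1,2,3,5,6,7)] by blast
  interpret H: tck_hom \<Lambda> A s B t \<pi>
    using assms(1,2,6) A \<pi> ck_family_toeplitz[OF A(2)] ck_family_toeplitz[OF assms(7)]
    by unfold_locales auto
  \<comment> \<open>A gap of \<open>t\<close> vanishes only if \<open>T\<close> is exhaustive, because the \<open>t v\<close> are nonzero, and then \<open>T\<close> belongs to \<open>\<E>\<close>.\<close>
  have gap: "H.SA.gap v T = \<zero>\<^bsub>A\<^esub>"
    if vT: "v \<in> vertices \<Lambda>" "finite T" "T \<subseteq> paths_to \<Lambda> v - {v}" and zero: "H.SB.gap v T = \<zero>\<^bsub>B\<^esub>" for v T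
  proof -
    have T: "T \<subseteq> paths_to \<Lambda> v" using vT by blast
    have ex: "exhaustive \<Lambda> v T" using H.SB.gap_not_exhaustive[OF vT(1,2) T] zero assms(8) by blast
    have "T \<noteq> {}" by (rule H.SA.FE_nonempty[OF vT(1) ex])
    note eq = H.SA.gap_prod_eq[OF vT(1) T \<open>T \<noteq> {}\<close>] H.SB.gap_prod_eq[OF vT(1) T \<open>T \<noteq> {}\<close>]
    have "T \<in> FE \<Lambda>" using vT ex by (auto simp: FE_def)
    then have "T \<in> \<E>" using assms(9) eq zero by auto
    then show ?thesis using A(2) eq by (simp add: ck_family_def)
  qed
  obtain \<theta> :: "complex ^ 'k \<Rightarrow> 'b \<Rightarrow> 'b" where \<theta>: "torus_action B \<theta>"
    "\<And>z \<kappa>. z \<in> torus \<Longrightarrow> \<kappa> \<in> paths \<Lambda> \<Longrightarrow> \<theta> z (t \<kappa>) = torus_pow z (dg \<Lambda> \<kappa>) \<odot>\<^bsub>B\<^esub> t \<kappa>"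
    using assms(10) by blast
  have "inj_on \<pi> (carrier A)"
  proof (rule H.inj_if_isometric_on_dense)
    show "H.SA.ss_span H.SA.parallel \<subseteq> carrier A" using H.SA.ss_span_closed by blast
    show "H.SA.norm_closure (H.SA.ss_span H.SA.parallel) = carrier A"
      by (rule H.SA.generated_by_span[OF universal_ck_generated[OF assms(5)]])
    show "nrm A x \<le> nrm B (\<pi> x)" if "x \<in> H.SA.ss_span H.SA.parallel" for x
    proof (rule H.isometric_on_span[OF gap _ \<theta>(2) that])
      show "\<theta> z \<in> star_hom B B" if "z \<in> torus" for z
        using \<theta>(1) that by (simp add: torus_action_def star_aut_def)
    qed
  qed
  moreover have "ck_hom \<Lambda> A s B t = restrict \<pi> (carrier A)"
    by (rule ck_hom_eq[OF assms(5,6) \<pi>])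
  ultimately show ?thesis by (simp add: inj_on_def)
qed

end
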